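(* Let $(\xi_i)_{i\ge 0}$ be independent (not necessarily identically distributed) real random variables with mean $0$ and variance $1$, and assume that they have uniformly bounded $(2+\varepsilon_0)$-moments for some $\varepsilon_0>0$. Let $f_n(x)=\sum_{i=0}^n \xi_i x^i$. Then for any $\varepsilon>0$ there exist positive constants $c$ and $C$ (not depending on $n$) such that for all $n$, $$\mathbb{P}\left(N_n(\mathbb{R})\ge \mathbb{E}N_n(\mathbb{R})+\varepsilon\log n\right)\le C\exp\left(-c\sqrt{\log n}\right).$$ The same holds if $N_n(\mathbb{R})$ is replaced (in both occurrences) by $N_n([0,1])$, $N_n([1,\infty))$, $N_n([-1,0])$, or $N_n((-\infty,-1])$.
   Context: For a set $S\subset\mathbb{R}$, $N_n(S)$ denotes the number of roots of $f_n$ in $S$. The random variables $\xi_i$ have uniformly bounded $(2+\varepsilon_0)$-moments if there is a constant $C_0$ such that $\mathbb{E}|\xi_i|^{2+\varepsilon_0}\le C_0$ for all $i$. *)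

theory Defs
  imports "HOL-Probability.Probability"
begin

definition rand_poly :: "(nat \<Rightarrow> 'a \<Rightarrow> real) \<Rightarrow> nat \<Rightarrow> 'a \<Rightarrow> real \<Rightarrow> real" where
  "rand_poly \<xi> n \<omega> x = (\<Sum>i\<le>n. \<xi> i \<omega> * x ^ i)"

(* Distinct roots are counted.  If the polynomial vanishes identically, which may happen with
   positive probability for coefficients with an atom at 0, the root set in a nondegenerate
   interval is infinite and the count is 0 by the library convention for card.  The count is
   therefore always at most n and has a finite expectation. *)
definition num_roots :: "(nat \<Rightarrow> 'a \<Rightarrow> real) \<Rightarrow> nat \<Rightarrow> real set \<Rightarrow> 'a \<Rightarrow> real" where
  "num_roots \<xi> n S \<omega> = real (card {x \<in> S. rand_poly \<xi> n \<omega> x = 0})"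

(* Integrability is part of the condition because the Bochner integral of a nonintegrable
   function is 0. *)
definition unif_bounded_moments :: "'a measure \<Rightarrow> (nat \<Rightarrow> 'a \<Rightarrow> real) \<Rightarrow> real \<Rightarrow> bool" where
  "unif_bounded_moments M \<xi> p \<longleftrightarrow>
     (\<exists>C\<^sub>0. \<forall>i. integrable M (\<lambda>\<omega>. \<bar>\<xi> i \<omega>\<bar> powr p) \<and>
                (\<integral>\<omega>. \<bar>\<xi> i \<omega>\<bar> powr p \<partial>M) \<le> C\<^sub>0)"

end

theory Submission
  imports Defs "HOL-Computational_Algebra.Polynomial" "HOL-Real_Asymp.Real_Asymp"
begin

text \<open>
  The proof works on \<open>[0, 1]\<close> and looks at the scales \<open>[1 - h, 1 - 7 h / 8)\<close> with \<open>h = (7/8)^k\<close>, of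
  which a number of order \<open>ln n\<close> matters. At such a scale the polynomial is governed by the coefficients
  with index of order \<open>1 / h\<close>: those with smaller index contribute less than the typical size
  \<open>1 / sqrt h\<close>, and those with larger index are damped by the powers of \<open>x\<close>. Hence the numbers of
  roots at distant scales are nearly independent, and their sum concentrates.

  One scale. Dividing out the real roots near the centre \<open>c\<close> shows that \<open>N\<close> roots force
  \<open>\<bar>f c\<bar> \<le> 2^(- N) * norm f\<close> for a weighted norm of the Taylor coefficients of \<open>f\<close> at \<open>c\<close>
  (\<open>nroots_le_taylor_norm\<close>). The norm has a controlled mean, and \<open>f c\<close> is rarely small
  (\<open>small_ball\<close>), so the number of roots has an exponential tail (\<open>nroots_tail\<close>). The moment condition
  enters only through the bound \<open>exp (- t^2 / 4)\<close> for the characteristic functions of the coefficients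
  near the origin.

  Localization. Let \<open>D\<close> be a parameter. Dropping all indices outside a window of \<open>12 D\<close> scales on either
  side changes \<open>f\<close> by a perturbation that is exponentially small in \<open>D\<close>. The number of roots is then
  unchanged unless \<open>f\<close> has nearly a double root or nearly vanishes at an end of the interval
  (\<open>nroots_stable\<close>). Near a double root \<open>f\<close> is quadratically small on a whole neighbourhood, while a net
  of the scale has only linearly many points, so the one-dimensional small ball estimate suffices to
  make this unlikely (\<open>nroots_window_eq\<close>). Windows of scales in one residue class modulo \<open>24 D + 1\<close> are
  disjoint, the localized counts in a class are independent, and a Chernoff bound applies
  (\<open>chernoff_bound\<close>).

  Balance. Localization fails with probability of order \<open>exp (- c D)\<close>, while the Chernoff bound for a
  class of about \<open>ln n / D\<close> scales gives \<open>exp (- c ln n / D)\<close>; both are of the desired order when \<open>D\<close> is a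
  small multiple of \<open>sqrt (ln n)\<close>. The first \<open>12 D\<close> scales cannot be localized. There a small ball
  estimate with exponentially small probability (\<open>geometric_small_ball\<close>) leaves \<open>O(D)\<close> roots per scale,
  hence \<open>O(D^2)\<close> in total, which is a small multiple of \<open>ln n\<close>.

  The mean is compared rather than computed: outside events of small probability the localized counts,
  truncated at \<open>D\<close>, agree with the true counts, and in mean they exceed the true counts by very little.
  Comparing means requires the counts to be measurable, which is proved by counting roots below rational
  levels.

  All constants depend only on the radius \<open>s\<close> on which the characteristic functions are controlled
  (\<open>unit_interval_tail\<close>). This uniformity yields the other intervals: \<open>x \<mapsto> - x\<close> alternates the signs of
  the coefficients, and \<open>x \<mapsto> 1 / x\<close> reverses their order in a way that depends on \<open>n\<close>.
\<close>

section \<open>Roots and coefficients of a real polynomial\<close>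

definition nroots :: "real set \<Rightarrow> real poly \<Rightarrow> nat" where
  "nroots S p = card {x \<in> S. poly p x = 0}"

text \<open>
  The weight \<open>\<rho>\<close> plays the part of a radius: the norm dominates the polynomial on the disc of radius
  \<open>\<rho>\<close>, and unlike the supremum over that disc it is a finite sum of moduli of linear forms in the
  coefficients, so that its mean is easily bounded.
\<close>
definition weighted_norm :: "real \<Rightarrow> real poly \<Rightarrow> real" where
  "weighted_norm \<rho> p = (\<Sum>j\<le>degree p. \<bar>coeff p j\<bar> * \<rho> ^ j)"

definition taylor_norm :: "real \<Rightarrow> real \<Rightarrow> real poly \<Rightarrow> real" where
  "taylor_norm c \<rho> p = weighted_norm \<rho> (pcompose p [:c, 1:])"

lemma weighted_norm_eq_sum:
  assumes "degree p \<le> n"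
  shows "weighted_norm \<rho> p = (\<Sum>j\<le>n. \<bar>coeff p j\<bar> * \<rho> ^ j)"
  unfolding weighted_norm_def
  by (rule sum.mono_neutral_left) (use assms in \<open>auto simp: coeff_eq_0\<close>)

lemma weighted_norm_nonneg: "\<rho> \<ge> 0 \<Longrightarrow> weighted_norm \<rho> p \<ge> 0"
  by (auto simp: weighted_norm_def intro!: sum_nonneg)

lemma weighted_norm_mono: "0 \<le> r \<Longrightarrow> r \<le> \<rho> \<Longrightarrow> weighted_norm r p \<le> weighted_norm \<rho> p"
  by (auto simp: weighted_norm_def intro!: sum_mono mult_left_mono power_mono)

lemma abs_poly_le_weighted_norm:
  assumes "\<bar>y\<bar> \<le> r"
  shows "\<bar>poly p y\<bar> \<le> weighted_norm r p"
proof -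
  have "\<bar>poly p y\<bar> \<le> (\<Sum>j\<le>degree p. \<bar>coeff p j * y ^ j\<bar>)"
    by (simp add: poly_altdef sum_abs)
  also have "\<dots> \<le> weighted_norm r p"
    unfolding weighted_norm_def using assms
    by (intro sum_mono) (auto simp: abs_mult power_abs intro!: mult_left_mono power_mono)
  finally show ?thesis .
qed

text \<open>
  Multiplication by \<open>x - z\<close> has norm gain at least \<open>\<rho> - \<bar>z\<bar>\<close>, by the triangle inequality for the
  coefficients \<open>coeff q (j - 1) - z * coeff q j\<close> of the product.
\<close>
lemma weighted_norm_divide_root:
  assumes "\<bar>z\<bar> \<le> l" "l \<le> \<rho>"
  shows "(\<rho> - l) * weighted_norm \<rho> q \<le> weighted_norm \<rho> ([:-z, 1:] * q)"
proof -
  have \<rho>: "\<rho> \<ge> 0" using assms by linarith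
  define n where "n = degree q"
  have deg: "degree ([:-z, 1:] * q) \<le> Suc n"
    using degree_mult_le[of "[:-z, 1:]" q] by (simp add: n_def)
  have c0: "coeff ([:-z, 1:] * q) 0 = - z * coeff q 0"
    by simp
  have cS: "coeff ([:-z, 1:] * q) (Suc j) = coeff q j - z * coeff q (Suc j)" for j
    by simp
  have "(\<Sum>j\<le>Suc n. \<bar>z * coeff q j\<bar> * \<rho> ^ j) = \<bar>z\<bar> * weighted_norm \<rho> q"
    by (subst weighted_norm_eq_sum[of q "Suc n"])
       (simp_all add: n_def sum_distrib_left abs_mult mult_ac del: sum.atMost_Suc)
  then have zs: "(\<Sum>j\<le>n. \<bar>z * coeff q (Suc j)\<bar> * \<rho> ^ Suc j) + \<bar>z * coeff q 0\<bar> = \<bar>z\<bar> * weighted_norm \<rho> q"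
    by (subst (asm) sum.atMost_Suc_shift) simp
  have "\<rho> * weighted_norm \<rho> q - \<bar>z\<bar> * weighted_norm \<rho> q =
     (\<Sum>j\<le>n. (\<bar>coeff q j\<bar> - \<bar>z * coeff q (Suc j)\<bar>) * \<rho> ^ Suc j) - \<bar>z * coeff q 0\<bar>"
    unfolding zs[symmetric]
    by (simp add: weighted_norm_def n_def[symmetric] sum_distrib_left algebra_simps sum_subtractf)
  also have "\<dots> \<le> (\<Sum>j\<le>n. \<bar>coeff q j - z * coeff q (Suc j)\<bar> * \<rho> ^ Suc j) + \<bar>z * coeff q 0\<bar>"
  proof -
    have "(\<Sum>j\<le>n. (\<bar>coeff q j\<bar> - \<bar>z * coeff q (Suc j)\<bar>) * \<rho> ^ Suc j)
       \<le> (\<Sum>j\<le>n. \<bar>coeff q j - z * coeff q (Suc j)\<bar> * \<rho> ^ Suc j)"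
      using \<rho> by (intro sum_mono mult_right_mono) auto
    then show ?thesis by linarith
  qed
  also have "\<dots> = weighted_norm \<rho> ([:-z, 1:] * q)"
    by (subst weighted_norm_eq_sum[OF deg], subst sum.atMost_Suc_shift) (simp only: c0 cS, simp)
  finally have "(\<rho> - \<bar>z\<bar>) * weighted_norm \<rho> q \<le> weighted_norm \<rho> ([:-z, 1:] * q)"
    by (simp add: left_diff_distrib)
  moreover have "(\<rho> - l) * weighted_norm \<rho> q \<le> (\<rho> - \<bar>z\<bar>) * weighted_norm \<rho> q"
    using assms \<rho> by (intro mult_right_mono weighted_norm_nonneg) auto
  ultimately show ?thesis by linarith
qed

text \<open>
  Each division by a root \<open>z\<close> multiplies the value at 0 by \<open>1 / \<bar>z\<bar> \<ge> 1 / l\<close> but the norm by at most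
  \<open>1 / (\<rho> - l)\<close>. This plays the part of Jensen's formula.
\<close>
lemma roots_force_small_value:
  assumes "finite F" "\<And>z. z \<in> F \<Longrightarrow> \<bar>z\<bar> \<le> l \<and> poly p z = 0" "0 \<le> l" "l \<le> \<rho>"
  shows "\<bar>poly p 0\<bar> * (\<rho> - l) ^ card F \<le> l ^ card F * weighted_norm \<rho> p"
  using assms(1,2)
proof (induction F arbitrary: p rule: finite_induct)
  case empty
  then show ?case using abs_poly_le_weighted_norm[of 0 \<rho> p] assms by auto
next
  case (insert z F)
  from insert.prems have z: "\<bar>z\<bar> \<le> l" "poly p z = 0" by auto
  then obtain q where q: "p = [:-z, 1:] * q"
    by (auto simp: poly_eq_0_iff_dvd elim: dvdE)
  have rts: "\<bar>y\<bar> \<le> l \<and> poly q y = 0" if "y \<in> F" for y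
    using insert.prems[of y] insert.hyps that by (auto simp: q)
  have IH: "\<bar>poly q 0\<bar> * (\<rho> - l) ^ card F \<le> l ^ card F * weighted_norm \<rho> q"
    using rts by (rule insert.IH)
  have "\<bar>poly p 0\<bar> * (\<rho> - l) ^ card (insert z F)
      = (\<bar>z\<bar> * (\<rho> - l)) * (\<bar>poly q 0\<bar> * (\<rho> - l) ^ card F)"
    using insert.hyps by (simp add: q abs_mult)
  also have "\<dots> \<le> (l * (\<rho> - l)) * (l ^ card F * weighted_norm \<rho> q)"
    by (rule mult_mono[OF _ IH]) (use z assms in \<open>auto intro: mult_right_mono\<close>)
  also have "\<dots> = l ^ Suc (card F) * ((\<rho> - l) * weighted_norm \<rho> q)"
    by simp
  also have "\<dots> \<le> l ^ Suc (card F) * weighted_norm \<rho> p"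
    using weighted_norm_divide_root[of z l \<rho> q] z assms q by (intro mult_left_mono) auto
  finally show ?case using insert.hyps by simp
qed

text \<open>
  For radius \<open>3 * l\<close> every root costs a factor of 2. An infinite root set has count 0, and the bound
  then reduces to the domination of the value by the norm.
\<close>
lemma nroots_le_taylor_norm:
  assumes "S \<subseteq> {c - l..c + l}" "l > 0"
  shows "\<bar>poly p c\<bar> * 2 ^ nroots S p \<le> taylor_norm c (3 * l) p"
proof (cases "finite {x \<in> S. poly p x = 0}")
  case True
  define F where "F = (\<lambda>x. x - c) ` {x \<in> S. poly p x = 0}"
  have card: "card F = nroots S p"
    unfolding F_def nroots_def by (intro card_image) (auto simp: inj_on_def)
  have "\<bar>poly (pcompose p [:c, 1:]) 0\<bar> * (3 * l - l) ^ card F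
      \<le> l ^ card F * weighted_norm (3 * l) (pcompose p [:c, 1:])"
  proof (rule roots_force_small_value)
    show "finite F" using True by (simp add: F_def)
  qed (use assms in \<open>auto simp: F_def poly_pcompose abs_le_iff\<close>)
  then have "l ^ card F * (\<bar>poly p c\<bar> * 2 ^ card F) \<le> l ^ card F * taylor_norm c (3 * l) p"
    by (simp add: poly_pcompose taylor_norm_def power_mult_distrib mult_ac)
  then show ?thesis using assms card by simp
next
  case False
  then have "nroots S p = 0" by (simp add: nroots_def)
  moreover have "\<bar>poly (pcompose p [:c, 1:]) 0\<bar> \<le> taylor_norm c (3 * l) p"
    unfolding taylor_norm_def using assms by (intro abs_poly_le_weighted_norm) auto
  ultimately show ?thesis by (simp add: poly_pcompose)
qed

text \<open>
  Enlarging the radius by \<open>3 / 2\<close> absorbs the factor \<open>j\<close> in the coefficients of the derivative,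
  since \<open>j \<le> (3 / 2)^j\<close>. Two derivatives fit into the radius \<open>3 * l\<close> because \<open>(3 / 2)^2 < 3\<close>.
\<close>
lemma weighted_norm_pderiv:
  assumes "r > 0"
  shows "r * weighted_norm r (pderiv p) \<le> weighted_norm (3 / 2 * r) p"
proof -
  have pow: "real j \<le> (3/2) ^ j" for j :: nat
  proof (induction j)
    case (Suc j)
    show ?case
    proof (cases "j < 2")
      case True
      then have "j = 0 \<or> j = 1" by auto
      then show ?thesis by (auto simp: power2_eq_square)
    next
      case False
      then have "real (Suc j) \<le> 3/2 * real j" by simp
      then show ?thesis using Suc by simp
    qed
  qed simp
  define n where "n = degree p"
  have "r * weighted_norm r (pderiv p) = r * (\<Sum>j\<le>n. \<bar>coeff (pderiv p) j\<bar> * r ^ j)"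
    by (subst weighted_norm_eq_sum[of _ n]) (auto simp: n_def degree_pderiv)
  also have "\<dots> = (\<Sum>j\<le>n. \<bar>coeff p (Suc j)\<bar> * (real (Suc j) * r ^ Suc j))"
    using assms by (simp add: coeff_pderiv sum_distrib_left abs_mult mult_ac)
  also have "\<dots> \<le> (\<Sum>j\<le>n. \<bar>coeff p (Suc j)\<bar> * ((3/2) ^ Suc j * r ^ Suc j))"
    using assms by (intro sum_mono mult_left_mono mult_right_mono pow) auto
  also have "\<dots> = (\<Sum>j\<le>n. \<bar>coeff p (Suc j)\<bar> * (3/2 * r) ^ Suc j)"
    by (simp only: power_mult_distrib)
  also have "\<dots> \<le> (\<Sum>j\<le>Suc n. \<bar>coeff p j\<bar> * (3/2 * r) ^ j)"
    using assms by (simp only: sum.atMost_Suc_shift) simp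
  also have "\<dots> = weighted_norm (3 / 2 * r) p"
    by (subst weighted_norm_eq_sum[of p "Suc n"]) (auto simp: n_def)
  finally show ?thesis .
qed

lemma pderiv_shift: "pderiv (pcompose p [:c, 1:]) = pcompose (pderiv p) [:c, 1:]" for c :: real
  by (simp add: pderiv_pcompose pderiv_pCons)

lemma taylor_norm_nonneg: "\<rho> \<ge> 0 \<Longrightarrow> taylor_norm c \<rho> p \<ge> 0"
  unfolding taylor_norm_def by (rule weighted_norm_nonneg)

lemma taylor_norm_add: "\<rho> \<ge> 0 \<Longrightarrow> taylor_norm c \<rho> (p + q) \<le> taylor_norm c \<rho> p + taylor_norm c \<rho> q"
proof -
  assume \<rho>: "\<rho> \<ge> 0"
  define p' where "p' = pcompose p [:c, 1:]"
  define q' where "q' = pcompose q [:c, 1:]"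
  define n where "n = max (degree p') (degree q')"
  have "weighted_norm \<rho> (p' + q') = (\<Sum>j\<le>n. \<bar>coeff p' j + coeff q' j\<bar> * \<rho> ^ j)"
    by (subst weighted_norm_eq_sum[of _ n]) (auto simp: n_def degree_add_le_max)
  also have "\<dots> \<le> (\<Sum>j\<le>n. \<bar>coeff p' j\<bar> * \<rho> ^ j + \<bar>coeff q' j\<bar> * \<rho> ^ j)"
    using \<rho> by (intro sum_mono) (auto simp flip: distrib_right intro!: mult_right_mono)
  also have "\<dots> = weighted_norm \<rho> p' + weighted_norm \<rho> q'"
    by (subst (1 2) weighted_norm_eq_sum[of _ n]) (auto simp: n_def sum.distrib)
  finally show ?thesis by (simp add: taylor_norm_def p'_def q'_def pcompose_add)
qed

lemma abs_poly_le_taylor_norm: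
  assumes "\<bar>x - c\<bar> \<le> l"
  shows "\<bar>poly p x\<bar> \<le> taylor_norm c (3 * l) p"
proof -
  have "\<bar>poly (pcompose p [:c, 1:]) (x - c)\<bar> \<le> weighted_norm (3 * l) (pcompose p [:c, 1:])"
    using assms by (intro abs_poly_le_weighted_norm) auto
  then show ?thesis by (simp add: poly_pcompose taylor_norm_def)
qed

lemma abs_pderiv_le_taylor_norm:
  assumes "\<bar>x - c\<bar> \<le> l" "l > 0"
  shows "\<bar>poly (pderiv p) x\<bar> \<le> taylor_norm c (3 * l) p / l"
proof -
  define g where "g = pcompose p [:c, 1:]"
  have "\<bar>poly (pderiv g) (x - c)\<bar> \<le> weighted_norm l (pderiv g)"
    using assms by (intro abs_poly_le_weighted_norm) auto
  also have "\<dots> \<le> weighted_norm (3 / 2 * l) g / l"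
    using weighted_norm_pderiv[of l g] assms by (simp add: field_simps)
  also have "\<dots> \<le> weighted_norm (3 * l) g / l"
    using assms by (intro divide_right_mono weighted_norm_mono) auto
  finally show ?thesis by (simp add: g_def pderiv_shift poly_pcompose taylor_norm_def)
qed

lemma abs_pderiv2_le_taylor_norm:
  assumes "\<bar>x - c\<bar> \<le> l" "l > 0"
  shows "\<bar>poly (pderiv (pderiv p)) x\<bar> \<le> taylor_norm c (3 * l) p / l\<^sup>2"
proof -
  define g where "g = pcompose p [:c, 1:]"
  have "\<bar>poly (pderiv (pderiv g)) (x - c)\<bar> \<le> weighted_norm l (pderiv (pderiv g))"
    using assms by (intro abs_poly_le_weighted_norm) auto
  also have "\<dots> \<le> weighted_norm (3 / 2 * l) (pderiv g) / l"
    using weighted_norm_pderiv[of l "pderiv g"] assms by (simp add: field_simps)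
  also have "weighted_norm (3 / 2 * l) (pderiv g) \<le> weighted_norm (3 / 2 * (3 / 2 * l)) g / (3 / 2 * l)"
    using weighted_norm_pderiv[of "3 / 2 * l" g] assms by (simp add: field_simps)
  also have "\<dots> \<le> weighted_norm (3 * l) g / l"
    using assms by (intro frac_le weighted_norm_mono weighted_norm_nonneg) auto
  finally show ?thesis using assms
    by (simp add: g_def pderiv_shift poly_pcompose taylor_norm_def power2_eq_square divide_right_mono)
qed

section \<open>Stability of the number of roots\<close>

text \<open>
  Around a root \<open>z\<close> take the largest interval on which \<open>\<bar>p\<bar> \<le> \<eta>\<close>. The derivative does not vanish
  there, so \<open>p\<close> takes the values \<open>\<eta>\<close> and \<open>- \<eta>\<close> at its two ends, and a function closer than \<open>\<eta>\<close> to
  \<open>p\<close> changes sign in between.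
\<close>
lemma root_bracket:
  fixes p :: "real poly"
  assumes z: "a \<le> z" "z \<le> b" "poly p z = 0"
    and nd: "\<And>x. a \<le> x \<Longrightarrow> x \<le> b \<Longrightarrow> \<bar>poly p x\<bar> \<le> \<eta> \<Longrightarrow> poly (pderiv p) x \<noteq> 0"
    and ends: "\<bar>poly p a\<bar> > \<eta>" "\<bar>poly p b\<bar> > \<eta>" and \<eta>: "\<eta> > 0"
    and close: "\<And>x. a \<le> x \<Longrightarrow> x \<le> b \<Longrightarrow> \<bar>poly p x - poly q x\<bar> < \<eta>"
  obtains u v w where "a \<le> u" "u \<le> z" "z \<le> v" "v \<le> b" "u \<le> w" "w \<le> v" "poly q w = 0"
    "\<And>x. u \<le> x \<Longrightarrow> x \<le> v \<Longrightarrow> \<bar>poly p x\<bar> \<le> \<eta>"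
proof -
  have cont: "continuous_on A (\<lambda>x. \<bar>poly p x\<bar>)" for A by (intro continuous_intros)
  have closed: "closed ({x. \<bar>poly p x\<bar> = \<eta>} \<inter> T)" if "closed T" for T
    using that by (intro closed_Int closed_Collect_eq continuous_intros) auto
  define U where "U = {x. \<bar>poly p x\<bar> = \<eta>} \<inter> {a..z}"
  define V where "V = {x. \<bar>poly p x\<bar> = \<eta>} \<inter> {z..b}"
  \<comment> \<open>The nearest points on either side of \<open>z\<close> at which \<open>\<bar>p\<bar>\<close> reaches \<open>\<eta>\<close> are \<open>Max U\<close> and \<open>Min V\<close>.\<close>
  have Une: "U \<noteq> {}"
    using IVT2'[of "\<lambda>x. \<bar>poly p x\<bar>" z \<eta> a] z ends \<eta> cont by (auto simp: U_def)
  have Vne: "V \<noteq> {}"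
    using IVT'[of "\<lambda>x. \<bar>poly p x\<bar>" z \<eta> b] z ends \<eta> cont by (auto simp: V_def)
  have Uc: "compact U" and Vc: "compact V"
    unfolding U_def V_def by (auto intro!: closed_Int_compact closed_Collect_eq continuous_intros)
  obtain u where u: "u \<in> U" "\<And>x. x \<in> U \<Longrightarrow> x \<le> u"
    using compact_attains_sup[OF Uc Une] by auto
  obtain v where v: "v \<in> V" "\<And>x. x \<in> V \<Longrightarrow> v \<le> x"
    using compact_attains_inf[OF Vc Vne] by auto
  have u': "a \<le> u" "u \<le> z" "\<bar>poly p u\<bar> = \<eta>" and v': "z \<le> v" "v \<le> b" "\<bar>poly p v\<bar> = \<eta>"
    using u v by (auto simp: U_def V_def)
  have small: "\<bar>poly p x\<bar> \<le> \<eta>" if "u \<le> x" "x \<le> v" for x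
  proof (rule ccontr)
    assume big: "\<not> \<bar>poly p x\<bar> \<le> \<eta>"
    show False
    proof (cases "x \<le> z")
      case True
      then obtain y where y: "x \<le> y" "y \<le> z" "\<bar>poly p y\<bar> = \<eta>"
        using IVT2'[of "\<lambda>x. \<bar>poly p x\<bar>" z \<eta> x] z big \<eta> cont by auto
      then have "y \<le> u" using u that u' by (auto simp: U_def)
      then have "x = u" using y that by auto
      then show False using big u' by auto
    next
      case False
      then obtain y where y: "z \<le> y" "y \<le> x" "\<bar>poly p y\<bar> = \<eta>"
        using IVT'[of "\<lambda>x. \<bar>poly p x\<bar>" z \<eta> x] z big \<eta> cont by auto
      then have "v \<le> y" using v that v' by (auto simp: V_def)
      then have "x = v" using y that by auto
      then show False using big v' by auto
    qed
  qed
  have uv: "u < v"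
  proof -
    have "u \<noteq> z" using u' z \<eta> by auto
    then show ?thesis using u' v' by auto
  qed
  have "poly p u \<noteq> poly p v"
  proof
    assume "poly p u = poly p v"
    then obtain x where x: "u < x" "x < v" "poly (pderiv p) x = 0"
      using poly_MVT[OF uv, of p] uv by auto
    then show False using nd[of x] small[of x] u' v' by auto
  qed
  then have sgn: "poly p u = \<eta> \<and> poly p v = - \<eta> \<or> poly p u = - \<eta> \<and> poly p v = \<eta>"
    using u' v' by auto
  have cu: "\<bar>poly p u - poly q u\<bar> < \<eta>" and cv: "\<bar>poly p v - poly q v\<bar> < \<eta>"
    using u' v' close[of u] close[of v] uv by auto
  have cq: "continuous_on {u..v} (poly q)" by (intro continuous_intros)
  have "\<exists>w\<ge>u. w \<le> v \<and> poly q w = 0"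
    using sgn
  proof
    assume "poly p u = \<eta> \<and> poly p v = - \<eta>"
    then show ?thesis using cu cv uv cq IVT2'[of "poly q" v 0 u] by auto
  next
    assume "poly p u = - \<eta> \<and> poly p v = \<eta>"
    then show ?thesis using cu cv uv cq IVT'[of "poly q" u 0 v] by auto
  qed
  then show ?thesis using that[of u v] u' v' small by blast
qed

text \<open>
  A root of \<open>q\<close> cannot serve two roots of \<open>p\<close>: otherwise \<open>\<bar>p\<bar> \<le> \<eta>\<close> would hold between the two roots
  of \<open>p\<close>, and Rolle's theorem would give a critical point there.
\<close>
lemma nroots_le_of_close:
  fixes p q :: "real poly"
  assumes ab: "a < b"
    and nd: "\<And>x. a \<le> x \<Longrightarrow> x \<le> b \<Longrightarrow> \<bar>poly p x\<bar> \<le> \<eta> \<Longrightarrow> poly (pderiv p) x \<noteq> 0"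
    and ends: "\<bar>poly p a\<bar> > \<eta>" "\<bar>poly p b\<bar> > \<eta>" and \<eta>: "\<eta> > 0"
    and close: "\<And>x. a \<le> x \<Longrightarrow> x \<le> b \<Longrightarrow> \<bar>poly p x - poly q x\<bar> < \<eta>"
  shows "nroots {a..<b} p \<le> nroots {a..<b} q"
proof -
  define R where "R z w \<longleftrightarrow> (\<exists>u v. a \<le> u \<and> u \<le> z \<and> z \<le> v \<and> v \<le> b \<and> u \<le> w \<and> w \<le> v \<and> poly q w = 0 \<and>
     (\<forall>x. u \<le> x \<and> x \<le> v \<longrightarrow> \<bar>poly p x\<bar> \<le> \<eta>))" for z w
  have qa: "poly q b \<noteq> 0" "poly q a \<noteq> 0" using close[of b] close[of a] ends ab by auto
  then have "q \<noteq> 0" by auto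
  then have fin: "finite {x \<in> {a..<b}. poly q x = 0}"
    using poly_roots_finite[of q] by (auto intro: finite_subset[rotated])
  have "\<exists>w. R z w" if "z \<in> {x \<in> {a..<b}. poly p x = 0}" for z
  proof -
    have "a \<le> z" "z \<le> b" "poly p z = 0" using that by auto
    then show ?thesis
      by (rule root_bracket[OF _ _ _ nd ends \<eta> close]) (auto simp: R_def)
  qed
  then obtain W where W: "\<And>z. z \<in> {x \<in> {a..<b}. poly p x = 0} \<Longrightarrow> R z (W z)" by metis
  have no: False if "z1 < z2" "R z1 w" "R z2 w" "poly p z1 = 0" "poly p z2 = 0" for z1 z2 w
  proof -
    have small: "\<bar>poly p x\<bar> \<le> \<eta>" "a \<le> x" "x \<le> b" if "z1 \<le> x" "x \<le> z2" for x
      using \<open>R z1 w\<close> \<open>R z2 w\<close> that unfolding R_def by (cases "x \<le> w"; force)+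
    obtain x where "z1 < x" "x < z2" "poly (pderiv p) x = 0"
      using poly_MVT[of z1 z2 p] \<open>z1 < z2\<close> \<open>poly p z1 = 0\<close> \<open>poly p z2 = 0\<close> by auto
    then show False using nd[of x] small[of x] by auto
  qed
  show ?thesis unfolding nroots_def
  proof (rule card_inj_on_le[of W])
    show "inj_on W {x \<in> {a..<b}. poly p x = 0}"
    proof (rule inj_onI)
      fix x y assume "x \<in> {x \<in> {a..<b}. poly p x = 0}" "y \<in> {x \<in> {a..<b}. poly p x = 0}" "W x = W y"
      then show "x = y" using no[of x y "W x"] no[of y x "W x"] W[of x] W[of y]
        by (cases x y rule: linorder_cases) auto
    qed
    show "W ` {x \<in> {a..<b}. poly p x = 0} \<subseteq> {x \<in> {a..<b}. poly q x = 0}"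
    proof safe
      fix z assume "z \<in> {a..<b}" "poly p z = 0"
      then have "R z (W z)" using W by auto
      then have "a \<le> W z" "W z \<le> b" "poly q (W z) = 0" unfolding R_def by auto
      moreover then have "W z \<noteq> b" using qa by auto
      ultimately show "W z \<in> {a..<b}" "poly q (W z) = 0" by auto
    qed
  qed (rule fin)
qed

text \<open>
  Closeness of the derivatives transfers the absence of near-double roots from \<open>p\<close> to \<open>q\<close>, so the
  previous inequality applies in both directions.
\<close>
lemma nroots_stable:
  fixes p q :: "real poly"
  assumes ab: "a < b" and \<eta>: "\<eta> > 0"
    and nd: "\<And>x. a \<le> x \<Longrightarrow> x \<le> b \<Longrightarrow> \<bar>poly p x\<bar> \<le> \<eta> \<Longrightarrow> \<bar>poly (pderiv p) x\<bar> > \<kappa>"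
    and ends: "\<bar>poly p a\<bar> > \<eta>" "\<bar>poly p b\<bar> > \<eta>"
    and close: "\<And>x. a \<le> x \<Longrightarrow> x \<le> b \<Longrightarrow> \<bar>poly p x - poly q x\<bar> < \<eta> / 2"
    and close': "\<And>x. a \<le> x \<Longrightarrow> x \<le> b \<Longrightarrow> \<bar>poly (pderiv p) x - poly (pderiv q) x\<bar> \<le> \<kappa>"
  shows "nroots {a..<b} p = nroots {a..<b} q"
proof (rule antisym)
  have \<kappa>: "\<kappa> \<ge> 0" using close'[of a] ab by auto
  show "nroots {a..<b} p \<le> nroots {a..<b} q"
  proof (rule nroots_le_of_close[OF ab _ ends \<eta>])
    show "poly (pderiv p) x \<noteq> 0" if "a \<le> x" "x \<le> b" "\<bar>poly p x\<bar> \<le> \<eta>" for x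
      using nd[OF that] \<kappa> by auto
    show "\<bar>poly p x - poly q x\<bar> < \<eta>" if "a \<le> x" "x \<le> b" for x
      using close[OF that] \<eta> by auto
  qed
  show "nroots {a..<b} q \<le> nroots {a..<b} p"
  proof (rule nroots_le_of_close[OF ab, where \<eta> = "\<eta> / 2"])
    show "poly (pderiv q) x \<noteq> 0" if "a \<le> x" "x \<le> b" "\<bar>poly q x\<bar> \<le> \<eta> / 2" for x
    proof -
      have "\<bar>poly p x\<bar> \<le> \<eta>" using close[of x] that by linarith
      then show ?thesis using nd[of x] close'[of x] that by auto
    qed
    have "\<bar>poly p a - poly q a\<bar> < \<eta> / 2" "\<bar>poly p b - poly q b\<bar> < \<eta> / 2"
      using close[of a] close[of b] ab by auto
    then show "\<bar>poly q a\<bar> > \<eta> / 2" "\<bar>poly q b\<bar> > \<eta> / 2"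
      using ends by linarith+
    show "\<bar>poly q x - poly p x\<bar> < \<eta> / 2" if "a \<le> x" "x \<le> b" for x
      using close[OF that] by linarith
  qed (use \<eta> in auto)
qed

text \<open>
  If \<open>\<bar>p\<bar> \<le> r\<^sup>2\<close> and \<open>\<bar>p'\<bar> \<le> r\<close> (in units in which \<open>\<Theta> = l = 1\<close>) at some point, then by Taylor's
  formula \<open>p\<close> is of order \<open>r\<^sup>2\<close> at the nearest of the \<open>N\<close> points with spacing at most \<open>2 * r\<close>. A union
  bound over the net thus pays \<open>1 / r\<close> for an event of probability of order \<open>r\<^sup>2\<close>.
\<close>
lemma no_near_double_root_of_net:
  fixes p :: "real poly"
  assumes l: "l > 0" and r: "0 < r" and N: "real N * r \<ge> 1"
    and T: "\<Theta> > 0" and norm: "taylor_norm c (3 * l) p \<le> \<Lambda> * \<Theta>"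
    and net: "\<And>t. t \<le> N \<Longrightarrow> \<bar>poly p (c - l + 2 * l * real t / real N)\<bar> > (3 + 4 * \<Lambda>) * r\<^sup>2 * \<Theta>"
    and x: "\<bar>x - c\<bar> \<le> l" and small: "\<bar>poly p x\<bar> \<le> r\<^sup>2 * \<Theta>"
  shows "\<bar>poly (pderiv p) x\<bar> > r * \<Theta> / l"
proof (rule ccontr)
  assume "\<not> ?thesis"
  then have d: "\<bar>poly (pderiv p) x\<bar> \<le> r * \<Theta> / l" by simp
  have N0: "N > 0" using N by (cases N) auto
  define y where "y = (x - (c - l)) * real N / (2 * l)"
  define t where "t = nat \<lfloor>y\<rfloor>"
  have "(x - (c - l)) * real N \<le> (2 * l) * real N" using x by (intro mult_right_mono) auto
  then have y: "0 \<le> y" "y \<le> real N"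
    using x l N0 by (auto simp: y_def divide_le_eq mult_ac intro!: divide_nonneg_nonneg mult_nonneg_nonneg)
  have tN: "t \<le> N" using y by (simp add: t_def nat_le_iff floor_le_iff)
  have ty: "real t \<le> y" "y < real t + 1" using y by (auto simp: t_def)
  define w where "w = c - l + 2 * l * real t / real N"
  have xw: "x = c - l + 2 * l * y / real N" using l N0 by (simp add: y_def)
  have d1: "x - w = 2 * l / real N * (y - real t)" using l N0 by (simp add: xw w_def field_simps)
  have "2 * l / real N \<le> 2 * l * r" using N N0 l by (simp add: field_simps)
  moreover have "2 * l / real N * (y - real t) \<le> 2 * l / real N * 1"
    using ty l by (intro mult_left_mono) auto
  moreover have "0 \<le> 2 * l / real N * (y - real t)" using ty l by auto
  ultimately have xw2: "\<bar>x - w\<bar> \<le> 2 * l * r" "w \<le> x" using d1 by auto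
  have w: "c - l \<le> w" using l by (auto simp: w_def)
  have D2: "\<bar>poly (pderiv (pderiv p)) z\<bar> \<le> \<Lambda> * \<Theta> / l\<^sup>2" if "\<bar>z - c\<bar> \<le> l" for z
    using abs_pderiv2_le_taylor_norm[OF that l, of p] divide_right_mono[OF norm, of "l\<^sup>2"] by simp
  have bound: "\<bar>poly p w\<bar> \<le> (3 + 4 * \<Lambda>) * r\<^sup>2 * \<Theta>"
  proof (cases "w = x")
    case True
    have "0 \<le> \<Lambda> * \<Theta>" using norm weighted_norm_nonneg[of "3*l"] l unfolding taylor_norm_def
      by (smt (verit))
    then have "\<Lambda> \<ge> 0" using T by (simp add: zero_le_mult_iff)
    then have "r\<^sup>2 * \<Theta> * 1 \<le> r\<^sup>2 * \<Theta> * (3 + 4 * \<Lambda>)" using T by (intro mult_left_mono) auto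
    then show ?thesis using small True by (simp add: mult_ac)
  next
    case False
    then have wx: "w < x" using xw2 by auto
    obtain z where z: "w < z" "z < x" "poly p x - poly p w = (x - w) * poly (pderiv p) z"
      using poly_MVT[OF wx] by auto
    obtain z' where z': "z < z'" "z' < x" "poly (pderiv p) x - poly (pderiv p) z = (x - z) * poly (pderiv (pderiv p)) z'"
      using poly_MVT[OF z(2)] by auto
    have "\<bar>poly (pderiv p) x - poly (pderiv p) z\<bar> \<le> (2 * l * r) * (\<Lambda> * \<Theta> / l\<^sup>2)"
      unfolding z'(3) abs_mult using z z' xw2 w x l r
      by (intro mult_mono D2) (auto simp: abs_le_iff)
    then have "\<bar>poly (pderiv p) z\<bar> \<le> r * \<Theta> / l + (2 * l * r) * (\<Lambda> * \<Theta> / l\<^sup>2)" using d by linarith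
    then have "\<bar>poly p x - poly p w\<bar> \<le> (2 * l * r) * (r * \<Theta> / l + (2 * l * r) * (\<Lambda> * \<Theta> / l\<^sup>2))"
      unfolding z(3) abs_mult using xw2 l r by (intro mult_mono) auto
    also have "\<dots> = (2 + 4 * \<Lambda>) * r\<^sup>2 * \<Theta>" using l by (simp add: field_simps power2_eq_square)
    finally show ?thesis using small by (simp add: algebra_simps)
  qed
  show False using net[OF tN] bound by (simp add: w_def)
qed

section \<open>Polynomials supported on a set of indices\<close>

definition coeff_poly :: "nat set \<Rightarrow> (nat \<Rightarrow> real) \<Rightarrow> real poly" where
  "coeff_poly A a = (\<Sum>i\<in>A. monom (a i) i)"

lemma poly_coeff_poly: "poly (coeff_poly A a) x = (\<Sum>i\<in>A. a i * x ^ i)"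
  by (simp add: coeff_poly_def poly_sum poly_monom)

lemma degree_coeff_poly: "A \<subseteq> {..n} \<Longrightarrow> degree (coeff_poly A a) \<le> n"
  unfolding coeff_poly_def
  by (intro degree_sum_le) (auto intro: order.trans[OF degree_monom_le] finite_subset)

lemma coeff_poly_union:
  "finite A \<Longrightarrow> finite B \<Longrightarrow> A \<inter> B = {} \<Longrightarrow> coeff_poly (A \<union> B) a = coeff_poly A a + coeff_poly B a"
  by (simp add: coeff_poly_def sum.union_disjoint)

lemma coeff_poly_cong: "(\<And>i. i \<in> A \<Longrightarrow> a i = b i) \<Longrightarrow> coeff_poly A a = coeff_poly A b"
  by (simp add: coeff_poly_def)

lemma pcompose_monom_real: "pcompose (monom a i) q = smult a (q ^ i)" for a :: real
  by (induction i) (simp_all add: monom_0 monom_Suc pcompose_pCons mult.commute)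

lemma coeff_pcompose_coeff_poly:
  "coeff (pcompose (coeff_poly A a) [:c, 1:]) j = (\<Sum>i\<in>A. a i * (real (i choose j) * c ^ (i - j)))"
proof -
  have "coeff ([:c, 1:] ^ i) j = real (i choose j) * c ^ (i - j)" for i
  proof (cases "j \<le> i")
    case True then show ?thesis by (simp add: coeff_linear_poly_power)
  next
    case False
    then have "degree ([:c, 1:] ^ i) < j" using degree_power_le[of "[:c, 1:]" i] by simp
    then show ?thesis using False by (simp add: coeff_eq_0 binomial_eq_0)
  qed
  then show ?thesis
    by (simp add: coeff_poly_def pcompose_sum pcompose_monom_real coeff_sum)
qed

lemma taylor_norm_coeff_poly:
  assumes "A \<subseteq> {..n}"
  shows "taylor_norm c \<rho> (coeff_poly A a) =
    (\<Sum>j\<le>n. \<bar>\<Sum>i\<in>A. a i * (real (i choose j) * c ^ (i - j))\<bar> * \<rho> ^ j)"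
proof -
  have "degree (pcompose (coeff_poly A a) [:c, 1:]) \<le> n"
    using degree_coeff_poly[OF assms, of a] by (simp add: degree_pcompose)
  then show ?thesis
    unfolding taylor_norm_def by (simp add: weighted_norm_eq_sum coeff_pcompose_coeff_poly)
qed

lemma nroots_le_degree: "nroots S p \<le> degree p" if "infinite S"
proof (cases "p = 0")
  case True
  then show ?thesis using that by (simp add: nroots_def)
next
  case False
  have "nroots S p \<le> card {x. poly p x = 0}"
    unfolding nroots_def using False by (intro card_mono poly_roots_finite) auto
  also have "\<dots> \<le> degree p" using False by (rule card_poly_roots_bound)
  finally show ?thesis .
qed

section \<open>Measurability\<close>

text \<open>
  Compactness turns the existence of a root into a countable condition, and all intervals that occur,
  half-open ones included, are countable unions of compact sets.
\<close>
definition sigma_compact :: "real set \<Rightarrow> bool" where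
  "sigma_compact T \<longleftrightarrow> (\<exists>C :: nat \<Rightarrow> real set. (\<forall>l. compact (C l)) \<and> T = (\<Union>l. C l))"

lemma sigma_compact_closed: "closed T \<Longrightarrow> sigma_compact T"
proof -
  assume T: "closed T"
  have "T = (\<Union>l. T \<inter> cball 0 (real l))"
    using real_arch_simple by (auto simp: dist_norm) 
  then show ?thesis unfolding sigma_compact_def using T
    by (intro exI[of _ "\<lambda>l. T \<inter> cball 0 (real l)"]) (auto intro: closed_Int_compact)
qed

lemma sigma_compact_Ico: "sigma_compact {a..<b}"
proof -
  have "{a..<b} = (\<Union>l::nat. {a..b - inverse (real (Suc l))})"
  proof (intro equalityI subsetI)
    fix x assume x: "x \<in> {a..<b}"
    then obtain l where "inverse (real (Suc l)) < b - x"
      using reals_Archimedean[of "b - x"] by auto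
    then show "x \<in> (\<Union>l::nat. {a..b - inverse (real (Suc l))})" using x
      by (intro UN_I[of l]) auto
  next
    fix x assume "x \<in> (\<Union>l::nat. {a..b - inverse (real (Suc l))})"
    then obtain l :: nat where "a \<le> x" "x \<le> b - inverse (real (Suc l))" by auto
    moreover have "inverse (real (Suc l)) > 0" by simp
    ultimately show "x \<in> {a..<b}" by (auto simp del: inverse_positive_iff_positive)
  qed
  then show ?thesis unfolding sigma_compact_def by (intro exI[of _ "\<lambda>l. {a..b - inverse (real (Suc l))}"]) auto
qed

text \<open>
  On a compact set a root exists as soon as the values on a countable dense subset come arbitrarily
  close to 0.
\<close>
lemma measurable_root_in_compact:
  assumes P: "\<And>x. (\<lambda>\<omega>. poly (P \<omega>) x) \<in> borel_measurable N" and K: "compact K"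
  shows "{\<omega> \<in> space N. \<exists>x\<in>K. poly (P \<omega>) x = (0::real)} \<in> sets N"
proof (cases "K = {}")
  case False
  obtain D where D: "countable D" "D \<subseteq> K" "K \<subseteq> closure D"
    using separable by blast
  have "(\<exists>x\<in>K. poly p x = 0) \<longleftrightarrow> (\<forall>l::nat. \<exists>x\<in>D. \<bar>poly p x\<bar> < inverse (real (Suc l)))" for p :: "real poly"
  proof safe
    fix x l assume x: "x \<in> K" "poly p x = 0"
    have "isCont (poly p) x" by simp
    then obtain \<delta> where \<delta>: "\<delta> > 0" "\<And>y. dist y x < \<delta> \<Longrightarrow> dist (poly p y) (poly p x) < inverse (real (Suc l))"
      unfolding continuous_at_eps_delta
      by (metis inverse_positive_iff_positive of_nat_0_less_iff zero_less_Suc)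
    have "x \<in> closure D" using x D by auto
    then obtain y where "y \<in> D" "dist y x < \<delta>" using \<delta>(1) closure_approachable by blast
    then show "\<exists>x\<in>D. \<bar>poly p x\<bar> < inverse (real (Suc l))" using \<delta>(2)[of y] x
      by (auto simp: dist_real_def)
  next
    assume H: "\<forall>l::nat. \<exists>x\<in>D. \<bar>poly p x\<bar> < inverse (real (Suc l))"
    obtain z where z: "z \<in> K" "\<And>y. y \<in> K \<Longrightarrow> \<bar>poly p z\<bar> \<le> \<bar>poly p y\<bar>"
      using continuous_attains_inf[OF K False, of "\<lambda>x. \<bar>poly p x\<bar>"]
        continuous_on_rabs[OF continuous_on_poly[OF continuous_on_id]] by blast
    have "\<bar>poly p z\<bar> = 0"
    proof (rule ccontr)
      assume "\<bar>poly p z\<bar> \<noteq> 0"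
      then obtain l where "inverse (real (Suc l)) < \<bar>poly p z\<bar>"
        using reals_Archimedean[of "\<bar>poly p z\<bar>"] by auto
      moreover obtain x where "x \<in> D" "\<bar>poly p x\<bar> < inverse (real (Suc l))" using H by auto
      ultimately show False using z(2)[of x] D by auto
    qed
    then show "\<exists>x\<in>K. poly p x = 0" using z by auto
  qed
  then have "{\<omega> \<in> space N. \<exists>x\<in>K. poly (P \<omega>) x = (0::real)} =
    {\<omega> \<in> space N. \<forall>l::nat. \<exists>x\<in>D. \<bar>poly (P \<omega>) x\<bar> < inverse (real (Suc l))}"
    by simp
  also have "\<dots> \<in> sets N"
    using D(1) P by (intro sets.sets_Collect_countable_All sets.sets_Collect_countable_Ex') auto
  finally show ?thesis .
qed simp

text \<open>
  Unlike a condition on the cardinality of the root set, this one distinguishes the zero polynomial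
  from a polynomial without roots.
\<close>
definition has_roots_below :: "real set \<Rightarrow> nat \<Rightarrow> real poly \<Rightarrow> real \<Rightarrow> bool" where
  "has_roots_below T k p r \<longleftrightarrow> (\<exists>F. finite F \<and> card F = k \<and> F \<subseteq> {x \<in> T. x < r \<and> poly p x = 0})"

text \<open>
  Rational levels separate the largest root from the others and from \<open>r\<close>, which makes the condition
  for \<open>Suc k\<close> roots a countable combination of measurable ones.
\<close>
lemma has_roots_below_Suc:
  "has_roots_below T (Suc k) p r \<longleftrightarrow>
    (\<exists>r1\<in>\<rat>. \<exists>r2\<in>{x\<in>\<rat>. x < r}. has_roots_below T k p r1 \<and> (\<exists>x\<in>T \<inter> {r1..r2}. poly p x = 0))"
proof safe
  assume "has_roots_below T (Suc k) p r"
  then obtain F where F: "finite F" "card F = Suc k" "F \<subseteq> {x \<in> T. x < r \<and> poly p x = 0}"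
    by (auto simp: has_roots_below_def)
  then have ne: "F \<noteq> {}" by auto
  define m where "m = Max F"
  have m: "m \<in> F" "\<And>x. x \<in> F \<Longrightarrow> x \<le> m" using F ne by (auto simp: m_def)
  define F' where "F' = F - {m}"
  have F': "finite F'" "card F' = k" "\<And>x. x \<in> F' \<Longrightarrow> x < m"
    using F m by (auto simp: F'_def le_less)
  define u where "u = Max (insert (m - 1) F')"
  have u: "u < m" "\<And>x. x \<in> F' \<Longrightarrow> x \<le> u" using F' by (auto simp: u_def)
  obtain r1 where r1: "r1 \<in> \<rat>" "u < r1" "r1 < m" using Rats_dense_in_real[OF u(1)] by auto
  have "m < r" using F m by auto
  then obtain r2 where r2: "r2 \<in> \<rat>" "m < r2" "r2 < r" using Rats_dense_in_real by blast
  have "has_roots_below T k p r1" unfolding has_roots_below_def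
    using F F' u r1 by (intro exI[of _ F']) (auto simp: F'_def intro: le_less_trans)
  moreover have "m \<in> T \<inter> {r1..r2}" "poly p m = 0" using F m r1 r2 by auto
  ultimately show "\<exists>r1\<in>\<rat>. \<exists>r2\<in>{x\<in>\<rat>. x < r}. has_roots_below T k p r1 \<and> (\<exists>x\<in>T \<inter> {r1..r2}. poly p x = 0)"
    using r1 r2 by blast
next
  fix r1 r2 x assume *: "r2 < r" "has_roots_below T k p r1" "x \<in> T" "x \<in> {r1..r2}" "poly p x = 0"
  then obtain F where F: "finite F" "card F = k" "F \<subseteq> {x \<in> T. x < r1 \<and> poly p x = 0}"
    by (auto simp: has_roots_below_def)
  then have "x \<notin> F" using * by auto
  then show "has_roots_below T (Suc k) p r" unfolding has_roots_below_def
    using F * by (intro exI[of _ "insert x F"]) force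
qed

lemma measurable_has_roots_below:
  assumes P: "\<And>x. (\<lambda>\<omega>. poly (P \<omega>) x) \<in> borel_measurable N" and T: "sigma_compact T"
  shows "{\<omega> \<in> space N. has_roots_below T k (P \<omega>) r} \<in> sets N"
proof (induction k arbitrary: r)
  case 0
  have "has_roots_below T 0 p r" for p r by (auto simp: has_roots_below_def)
  then show ?case by simp
next
  case (Suc k)
  obtain C :: "nat \<Rightarrow> real set" where C: "\<And>l. compact (C l)" "T = (\<Union>l. C l)"
    using T by (auto simp: sigma_compact_def)
  have "{\<omega> \<in> space N. \<exists>x\<in>T \<inter> {r1..r2}. poly (P \<omega>) x = 0} =
      {\<omega> \<in> space N. \<exists>l::nat. \<exists>x\<in>C l \<inter> {r1..r2}. poly (P \<omega>) x = 0}" for r1 r2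
    unfolding C(2) by auto
  also have "\<dots> r1 r2 \<in> sets N" for r1 r2
    by (intro sets.sets_Collect_countable_Ex measurable_root_in_compact P compact_Int_closed C) auto
  finally have 1: "{\<omega> \<in> space N. \<exists>x\<in>T \<inter> {r1..r2}. poly (P \<omega>) x = 0} \<in> sets N" for r1 r2 .
  have cr: "countable {x\<in>\<rat>. x < r}"
    by (rule countable_subset[OF _ countable_rat]) auto
  show ?case unfolding has_roots_below_Suc
    by (intro sets.sets_Collect_countable_Ex' countable_rat cr sets.sets_Collect_conj Suc.IH 1)
qed

text \<open>
  The second conjunct excludes infinite root sets, for which \<open>nroots\<close> is 0.
\<close>
lemma nroots_ge_iff:
  assumes "k \<ge> 1"
  shows "k \<le> nroots T p \<longleftrightarrow> (\<exists>r::nat. has_roots_below T k p (real r)) \<and> \<not> (\<forall>k. \<exists>r::nat. has_roots_below T k p (real r))"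
proof -
  define Z where "Z = {x\<in>T. poly p x = 0}"
  have below: "(\<exists>r::nat. has_roots_below T k p (real r)) \<longleftrightarrow> (\<exists>F. finite F \<and> card F = k \<and> F \<subseteq> Z)" for k
  proof safe
    fix r :: nat assume "has_roots_below T k p (real r)"
    then show "\<exists>F. finite F \<and> card F = k \<and> F \<subseteq> Z" unfolding has_roots_below_def Z_def by blast
  next
    fix F assume F: "finite F" "F \<subseteq> Z" "k = card F"
    obtain r :: nat where r: "Max (insert 0 F) < real r" using reals_Archimedean2 by blast
    then have "x < real r" if "x \<in> F" for x using F that by auto
    then show "\<exists>r::nat. has_roots_below T (card F) p (real r)" unfolding has_roots_below_def
      using F by (intro exI[of _ r] exI[of _ F]) (auto simp: Z_def)
  qed
  show ?thesis
  proof (cases "finite Z")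
    case True
    have "(\<exists>F. finite F \<and> card F = k \<and> F \<subseteq> Z) \<longleftrightarrow> k \<le> card Z" for k
      using True by (metis card_mono obtain_subset_with_card_n finite_subset)
    moreover have "\<not> (\<forall>k. k \<le> card Z)" using not_less_eq_eq by blast
    ultimately show ?thesis unfolding below by (simp add: nroots_def Z_def)
  next
    case False
    then have "\<exists>F. finite F \<and> card F = k \<and> F \<subseteq> Z" for k
      using infinite_arbitrarily_large[OF False] by blast
    moreover have "nroots T p = 0" using False by (simp add: nroots_def Z_def)
    ultimately show ?thesis unfolding below using assms by simp
  qed
qed

lemma borel_measurable_nroots:
  assumes P: "\<And>x. (\<lambda>\<omega>. poly (P \<omega>) x) \<in> borel_measurable N" and T: "sigma_compact T"
  shows "(\<lambda>\<omega>. real (nroots T (P \<omega>))) \<in> borel_measurable N"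
proof (rule borel_measurableI_ge)
  fix y :: real
  show "{\<omega> \<in> space N. y \<le> real (nroots T (P \<omega>))} \<in> sets N"
  proof (cases "y \<le> 0")
    case True
    then have "{\<omega> \<in> space N. y \<le> real (nroots T (P \<omega>))} = space N" by (auto intro: order.trans)
    then show ?thesis by simp
  next
    case False
    then have "nat \<lceil>y\<rceil> \<ge> 1" by linarith
    have "{\<omega> \<in> space N. y \<le> real (nroots T (P \<omega>))} = {\<omega> \<in> space N. nat \<lceil>y\<rceil> \<le> nroots T (P \<omega>)}"
      using False by (auto simp: nat_le_iff ceiling_le_iff)
    also have "\<dots> \<in> sets N"
      unfolding nroots_ge_iff[OF \<open>nat \<lceil>y\<rceil> \<ge> 1\<close>]
      by (intro sets.sets_Collect_conj sets.sets_Collect_neg sets.sets_Collect_countable_Ex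
        sets.sets_Collect_countable_All measurable_has_roots_below P T)
    finally show ?thesis .
  qed
qed

lemma borel_measurable_nroots_coeff_poly:
  assumes "\<And>i. i \<in> A \<Longrightarrow> a i \<in> borel_measurable N" and T: "sigma_compact T"
  shows "(\<lambda>\<omega>. real (nroots T (coeff_poly A (\<lambda>i. a i \<omega>)))) \<in> borel_measurable N"
  by (rule borel_measurable_nroots[OF _ T]) (use assms in \<open>auto simp: poly_coeff_poly intro!: borel_measurable_sum\<close>)

section \<open>Tools from probability\<close>

lemma one_minus_half_square_le_cos: "1 - y\<^sup>2 / 2 \<le> cos (y::real)"
proof -
  have "cos y = 1 - 2 * (sin (y/2))\<^sup>2" using cos_double_sin[of "y/2"] by simp
  moreover have "(sin (y/2))\<^sup>2 \<le> (y/2)\<^sup>2"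
    using abs_sin_x_le_abs_x[of "y/2"] by (metis power2_abs power_mono abs_ge_zero)
  ultimately show ?thesis by (simp add: power_divide)
qed

context prob_space
begin

lemma integrable_indicat: "A \<in> events \<Longrightarrow> integrable M (indicat_real A)"
  by (rule integrable_real_indicator) (auto simp: emeasure_eq_measure)

text \<open>
  Conditioning on \<open>X\<close>: Fubini for the joint distribution, with the conditional probability bounded by
  a function of the value of \<open>X\<close>.
\<close>
lemma prob_indep_le:
  assumes ind: "indep_var borel X borel Y" and S: "S \<in> sets (borel \<Otimes>\<^sub>M borel)"
    and le: "\<And>x::real. prob {\<omega> \<in> space M. (x, Y \<omega> :: real) \<in> S} \<le> g x"
    and g: "g \<in> borel_measurable borel" "\<And>x. g x \<le> B"
  shows "prob {\<omega> \<in> space M. (X \<omega>, Y \<omega>) \<in> S} \<le> expectation (\<lambda>\<omega>. g (X \<omega>))"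
proof -
  have X[measurable]: "X \<in> borel_measurable M" and Y[measurable]: "Y \<in> borel_measurable M"
    using indep_var_rv1[OF ind] indep_var_rv2[OF ind] by auto
  have eq: "distr M borel X \<Otimes>\<^sub>M distr M borel Y = distr M (borel \<Otimes>\<^sub>M borel) (\<lambda>x. (X x, Y x))"
    using ind unfolding indep_var_distribution_eq by blast
  interpret DY: prob_space "distr M borel Y" by (rule prob_space_distr) simp
  note g(1)[measurable] S[measurable]
  have g0: "0 \<le> g x" for x using le[of x] measure_nonneg[of M "{\<omega> \<in> space M. (x, Y \<omega>) \<in> S}"] by linarith
  have "emeasure M {\<omega> \<in> space M. (X \<omega>, Y \<omega>) \<in> S} = emeasure (distr M (borel \<Otimes>\<^sub>M borel) (\<lambda>x. (X x, Y x))) S"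
    by (subst emeasure_distr) (auto intro!: arg_cong[where f = "emeasure M"] S)
  also have "\<dots> = (\<integral>\<^sup>+x. emeasure (distr M borel Y) (Pair x -` S) \<partial>distr M borel X)"
    unfolding eq[symmetric] using S by (intro DY.emeasure_pair_measure_alt) (simp cong: sets_pair_measure_cong)
  also have "\<dots> \<le> (\<integral>\<^sup>+x. ennreal (g x) \<partial>distr M borel X)"
  proof (intro nn_integral_mono)
    fix x
    have Sx: "Pair x -` S \<in> sets borel" using sets_Pair1[OF S] by simp
    have "emeasure (distr M borel Y) (Pair x -` S) = emeasure M {\<omega> \<in> space M. (x, Y \<omega>) \<in> S}"
      using Sx by (subst emeasure_distr) (auto intro!: arg_cong[where f = "emeasure M"])
    also have "\<dots> \<le> ennreal (g x)" using le[of x] by (simp add: emeasure_eq_measure ennreal_leI)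
    finally show "emeasure (distr M borel Y) (Pair x -` S) \<le> ennreal (g x)" .
  qed
  also have "\<dots> = (\<integral>\<^sup>+\<omega>. ennreal (g (X \<omega>)) \<partial>M)"
    by (subst nn_integral_distr) auto
  also have "\<dots> = ennreal (expectation (\<lambda>\<omega>. g (X \<omega>)))"
  proof (intro nn_integral_eq_integral integrable_const_bound[where B = B])
    show "AE \<omega> in M. norm (g (X \<omega>)) \<le> B" using g0 g(2) by auto
  qed (use g0 in auto)
  finally show ?thesis using g0 by (simp add: emeasure_eq_measure)
qed

lemma expectation_cos_le_char:
  assumes [measurable]: "X \<in> borel_measurable M"
  shows "expectation (\<lambda>\<omega>. cos (t * (X \<omega> - a))) \<le> cmod (char (distr M borel X) t)"
proof -
  have int: "integrable M (\<lambda>\<omega>. iexp (t * X \<omega>))"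
    using integrable_iexp[of "\<lambda>\<omega>. t * X \<omega>"] by simp
  have c: "char (distr M borel X) t = (CLINT \<omega>|M. iexp (t * X \<omega>))"
    unfolding char_def by (subst integral_distr) auto
  have "Re (iexp u * iexp v) = cos (u + v)" for u v
    by (simp only: cis_conv_exp[symmetric] cis_mult cis.sel)
  from this[of "- t * a" "t * X \<omega>" for \<omega>]
  have cosRe: "cos (t * (X \<omega> - a)) = Re (iexp (- t * a) * iexp (t * X \<omega>))" for \<omega>
    by (simp add: algebra_simps)
  have "expectation (\<lambda>\<omega>. cos (t * (X \<omega> - a))) = Re (CLINT \<omega>|M. iexp (- t * a) * iexp (t * X \<omega>))"
    unfolding cosRe using int by (intro integral_Re) auto
  also have "\<dots> = Re (iexp (- t * a) * char (distr M borel X) t)" unfolding c by simp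
  also have "\<dots> \<le> cmod (iexp (- t * a) * char (distr M borel X) t)" by (rule complex_Re_le_cmod)
  also have "\<dots> = cmod (char (distr M borel X) t)" by (simp add: norm_mult)
  finally show ?thesis .
qed

text \<open>
  Esseen's inequality, with the kernel \<open>1 - t\<close> on \<open>[0, 1]\<close>. Its cosine transform
  \<open>(1 - cos x) / x\<^sup>2\<close> is nonnegative and at least \<open>1 / 4\<close> on \<open>[-1, 1]\<close>. Characteristic functions enter
  only on \<open>[0, 1 / R]\<close>, where they are controlled; the assumed bound \<open>1 / (1 + (\<kappa> * t)\<^sup>2)\<close> has the
  explicit primitive \<open>arctan\<close>.
\<close>
lemma prob_abs_le_char:
  assumes X[measurable]: "X \<in> borel_measurable M" and R: "R > 0" and \<kappa>: "\<kappa> > 0"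
    and ch: "\<And>t. 0 \<le> t \<Longrightarrow> t \<le> 1 \<Longrightarrow> cmod (char (distr M borel X) (t / R)) \<le> 1 / (1 + (\<kappa> * t)\<^sup>2)"
  shows "prob {\<omega> \<in> space M. \<bar>X \<omega>\<bar> \<le> R} \<le> 8 / \<kappa>"
proof -
  define N where "N = restrict_space lborel {0..1::real}"
  have idN[measurable]: "(\<lambda>t. t) \<in> borel_measurable N"
    unfolding N_def by (intro measurable_restrict_space1) simp
  have spN: "space N = {0..1}" by (simp add: N_def space_restrict_space)
  have finN: "finite_measure N"
    by (rule finite_measureI) (simp add: N_def space_restrict_space emeasure_restrict_space)
  interpret N: finite_measure N by (rule finN)
  interpret P: pair_sigma_finite M N ..
  interpret PP: finite_measure "M \<Otimes>\<^sub>M N" by (intro finite_measure_pair_measure finN) unfold_locales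
  have Nint: "(\<integral>t. f t \<partial>N) = (\<integral>t. f t * indicator {0..1} t \<partial>lborel)" for f :: "real \<Rightarrow> real"
    unfolding N_def by (subst integral_restrict_space) (auto simp: set_lebesgue_integral_def mult.commute)
  define K where "K x = (\<integral>t. (1 - t) * cos (t * x) \<partial>N)" for x
  have bnd: "\<bar>(1 - t) * cos (t * x)\<bar> \<le> 1" if "t \<in> {0..1}" for t x :: real
    using that by (auto simp: abs_mult intro!: mult_le_one)
  have Kint: "integrable N (\<lambda>t. (1 - t) * cos (t * x))" for x
    by (rule N.integrable_const_bound[where B = 1]) (auto intro!: AE_I2 simp: spN bnd)
  have K0: "K x \<ge> 0" for x
  proof (cases "x = 0")
    case True
    then show ?thesis unfolding K_def by (intro integral_nonneg_AE AE_I2) (auto simp: spN)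
  next
    case False
    define F where "F t = (1 - t) * sin (t * x) / x - cos (t * x) / x\<^sup>2" for t
    have "K x = F 1 - F 0" unfolding K_def Nint
    proof (rule integral_FTC_Icc_real)
      fix t :: real
      show "DERIV F t :> (1 - t) * cos (t * x)"
        unfolding F_def using False
        by (auto intro!: derivative_eq_intros simp: field_simps power2_eq_square)
    qed auto
    also have "\<dots> = (1 - cos x) / x\<^sup>2" by (simp add: F_def diff_divide_distrib)
    finally show ?thesis by simp
  qed
  have half: "(\<integral>t. (1 - t) * (1 / 2) \<partial>N) = 1 / 4"
  proof -
    have "(\<integral>t. (1 - t) * (1 / 2) * indicator {0..1} t \<partial>lborel) = (1/2 - 1\<^sup>2/4) - (0/2 - 0\<^sup>2/4 :: real)"
      by (rule integral_FTC_Icc_real[where F = "\<lambda>t. t / 2 - t\<^sup>2 / 4"])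
         (auto intro!: derivative_eq_intros simp: field_simps)
    then show ?thesis unfolding Nint by simp
  qed
  have K14: "K x \<ge> 1 / 4" if "\<bar>x\<bar> \<le> 1" for x
  proof -
    have "(\<integral>t. (1 - t) * (1 / 2) \<partial>N) \<le> K x" unfolding K_def
    proof (rule integral_mono)
      show "integrable N (\<lambda>t. (1 - t) * (1 / 2))"
        by (rule N.integrable_const_bound[where B = 1]) (auto intro!: AE_I2 simp: spN)
      show "integrable N (\<lambda>t. (1 - t) * cos (t * x))" by (rule Kint)
      fix t assume "t \<in> space N"
      then have t: "0 \<le> t" "t \<le> 1" by (auto simp: spN)
      have "\<bar>t * x\<bar> \<le> 1" using t that by (auto simp: abs_mult intro!: mult_le_one)
      then have "(t * x)\<^sup>2 \<le> 1" by (simp add: abs_square_le_1)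
      then have "1 / 2 \<le> cos (t * x)" using one_minus_half_square_le_cos[of "t * x"] by linarith
      then show "(1 - t) * (1 / 2) \<le> (1 - t) * cos (t * x)" using t by (intro mult_left_mono) auto
    qed
    then show ?thesis using half by simp
  qed
  have fint: "integrable (M \<Otimes>\<^sub>M N) (\<lambda>(\<omega>, t). (1 - t) * cos (t * (X \<omega> / R)))"
    by (rule PP.integrable_const_bound[where B = 1])
       (auto intro!: AE_I2 simp: space_pair_measure spN bnd simp del: times_divide_eq_right)
  have KX: "integrable M (\<lambda>\<omega>. K (X \<omega> / R))"
    using P.integrable_fst[OF fint] by (simp add: K_def)
  have int1: "integrable N (\<lambda>t. 1 / (1 + (\<kappa> * t)\<^sup>2))"
  proof (rule N.integrable_const_bound[where B = 1])
    have "1 / (1 + (\<kappa> * t)\<^sup>2) \<le> 1" for t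
      by (simp add: divide_le_eq_1 add_pos_nonneg)
    then show "AE t in N. norm (1 / (1 + (\<kappa> * t)\<^sup>2)) \<le> 1"
      by (intro AE_I2) (simp add: add_nonneg_nonneg)
  qed simp
  have "prob {\<omega> \<in> space M. \<bar>X \<omega>\<bar> \<le> R} = expectation (indicator {\<omega> \<in> space M. \<bar>X \<omega>\<bar> \<le> R})"
    by simp
  also have "\<dots> \<le> expectation (\<lambda>\<omega>. 4 * K (X \<omega> / R))"
  proof (rule integral_mono)
    show "integrable M (indicat_real {\<omega> \<in> space M. \<bar>X \<omega>\<bar> \<le> R})" by (rule integrable_indicat) simp
    show "integrable M (\<lambda>\<omega>. 4 * K (X \<omega> / R))" using KX by simp
    show "indicat_real {\<omega> \<in> space M. \<bar>X \<omega>\<bar> \<le> R} \<omega> \<le> 4 * K (X \<omega> / R)" for \<omega>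
      using K14[of "X \<omega> / R"] K0[of "X \<omega> / R"] R by (auto simp: indicator_def abs_divide divide_le_eq)
  qed
  also have "\<dots> = 4 * (\<integral>\<omega>. (\<integral>t. (1 - t) * cos (t * (X \<omega> / R)) \<partial>N) \<partial>M)" by (simp add: K_def)
  also have "\<dots> = 4 * (\<integral>t. (\<integral>\<omega>. (1 - t) * cos (t * (X \<omega> / R)) \<partial>M) \<partial>N)"
    by (subst P.Fubini_integral[OF fint]) simp
  also have "\<dots> \<le> 4 * (\<integral>t. 1 / (1 + (\<kappa> * t)\<^sup>2) \<partial>N)"
  proof (intro mult_left_mono integral_mono)
    show "integrable N (\<lambda>t. \<integral>\<omega>. (1 - t) * cos (t * (X \<omega> / R)) \<partial>M)"
      using P.integrable_snd[OF fint] by simp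
    show "integrable N (\<lambda>t. 1 / (1 + (\<kappa> * t)\<^sup>2))" by (rule int1)
    fix t assume "t \<in> space N"
    then have t: "0 \<le> t" "t \<le> 1" by (auto simp: spN)
    have pos: "0 < 1 + (\<kappa> * t)\<^sup>2" by (simp add: add_pos_nonneg)
    have "expectation (\<lambda>\<omega>. cos (t * (X \<omega> / R))) \<le> 1 / (1 + (\<kappa> * t)\<^sup>2)"
      using expectation_cos_le_char[OF X, of "t / R" 0] ch[OF t] by (simp add: mult_ac)
    then have "(1 - t) * expectation (\<lambda>\<omega>. cos (t * (X \<omega> / R))) \<le> (1 - t) * (1 / (1 + (\<kappa> * t)\<^sup>2))"
      using t by (intro mult_left_mono) auto
    also have "\<dots> \<le> 1 * (1 / (1 + (\<kappa> * t)\<^sup>2))" using t pos by (intro mult_right_mono) auto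
    finally show "(\<integral>\<omega>. (1 - t) * cos (t * (X \<omega> / R)) \<partial>M) \<le> 1 / (1 + (\<kappa> * t)\<^sup>2)" by simp
  qed auto
  also have "(\<integral>t. 1 / (1 + (\<kappa> * t)\<^sup>2) \<partial>N) = arctan (\<kappa> * 1) / \<kappa> - arctan (\<kappa> * 0) / \<kappa>"
    unfolding Nint
  proof (rule integral_FTC_Icc_real)
    fix t :: real
    have pos: "1 + (\<kappa> * t)\<^sup>2 > 0" by (simp add: add_pos_nonneg)
    show "DERIV (\<lambda>t. arctan (\<kappa> * t) / \<kappa>) t :> 1 / (1 + (\<kappa> * t)\<^sup>2)"
    proof -
      have "DERIV (\<lambda>t. arctan (\<kappa> * t) / \<kappa>) t :> inverse (1 + (\<kappa> * t)\<^sup>2) * \<kappa> / \<kappa>"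
        by (auto intro!: derivative_eq_intros)
      then show ?thesis using \<kappa> by (simp add: inverse_eq_divide)
    qed
    show "isCont (\<lambda>t. 1 / (1 + (\<kappa> * t)\<^sup>2)) t"
      using pos by (intro continuous_intros) auto
  qed auto
  also have "4 * (arctan (\<kappa> * 1) / \<kappa> - arctan (\<kappa> * 0) / \<kappa>) \<le> 8 / \<kappa>"
  proof -
    have "arctan \<kappa> \<le> 2" using arctan_ubound[of \<kappa>] pi_less_4 by linarith
    then show ?thesis using \<kappa> by (simp add: divide_right_mono)
  qed
  finally show ?thesis .
qed

lemma expectation_abs_le_sqrt:
  assumes [measurable]: "X \<in> borel_measurable M" and i2: "integrable M (\<lambda>\<omega>. (X \<omega>)\<^sup>2)"
  shows "integrable M X" "expectation (\<lambda>\<omega>. \<bar>X \<omega>\<bar>) \<le> sqrt (expectation (\<lambda>\<omega>. (X \<omega>)\<^sup>2))"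
proof -
  show i1: "integrable M X"
  proof (rule Bochner_Integration.integrable_bound)
    show "integrable M (\<lambda>\<omega>. 1 + (X \<omega>)\<^sup>2)" using i2 by simp
    have "\<bar>y\<bar> \<le> 1 + y\<^sup>2" for y :: real
    proof -
      have "0 \<le> (\<bar>y\<bar> - 1)\<^sup>2" by simp
      then show ?thesis by (simp add: power2_eq_square algebra_simps)
    qed
    then show "AE x in M. norm (X x) \<le> norm (1 + (X x)\<^sup>2)" by (auto simp: add_nonneg_nonneg)
  qed simp
  have "0 \<le> variance (\<lambda>\<omega>. \<bar>X \<omega>\<bar>)" by (rule variance_positive)
  also have "\<dots> = expectation (\<lambda>\<omega>. (X \<omega>)\<^sup>2) - (expectation (\<lambda>\<omega>. \<bar>X \<omega>\<bar>))\<^sup>2"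
    using i1 i2 by (subst variance_eq) auto
  finally show "expectation (\<lambda>\<omega>. \<bar>X \<omega>\<bar>) \<le> sqrt (expectation (\<lambda>\<omega>. (X \<omega>)\<^sup>2))"
    by (intro real_le_rsqrt) simp
qed

lemma prob_gt_le_expectation:
  assumes i: "integrable M X" and X0: "\<And>\<omega>. \<omega> \<in> space M \<Longrightarrow> 0 \<le> X \<omega>" and E: "expectation X \<le> m" and a: "a > 0"
  shows "prob {\<omega> \<in> space M. a \<le> X \<omega>} \<le> m / a"
proof -
  have "prob {\<omega> \<in> space M. a \<le> X \<omega>} \<le> expectation X / a"
    using a X0 by (intro integral_Markov_inequality_measure[OF i]) (auto intro!: AE_I2)
  also have "\<dots> \<le> m / a" using E a by (simp add: divide_right_mono)
  finally show ?thesis .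
qed

end

section \<open>Small ball estimates for random sums\<close>

text \<open>
  A Lyapunov function for the recursion \<open>b \<mapsto> (b - \<xi>) / \<rho>\<close>. Its quadratic decay is matched to the
  second moment of \<open>\<xi>\<close>, so that unbounded coefficients are covered.
\<close>
definition lyapunov :: "real \<Rightarrow> real" where
  "lyapunov x = (if \<bar>x\<bar> \<le> 4 then 1 else 16 / x\<^sup>2)"

lemma lyapunov_bounds: "0 \<le> lyapunov x" "lyapunov x \<le> 1"
proof -
  have "16 \<le> x\<^sup>2" if "\<not> \<bar>x\<bar> \<le> 4"
    using that power_mono[of 4 "\<bar>x\<bar>" 2] by simp
  then show "0 \<le> lyapunov x" "lyapunov x \<le> 1" by (auto simp: lyapunov_def divide_le_eq_1)
qed

lemma lyapunov_measurable[measurable]: "lyapunov \<in> borel_measurable borel"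
  unfolding lyapunov_def by measurable

lemma lyapunov_le: "y > 4 \<Longrightarrow> \<bar>x\<bar> \<ge> y \<Longrightarrow> lyapunov x \<le> 16 / y\<^sup>2"
proof -
  assume *: "y > 4" "\<bar>x\<bar> \<ge> y"
  then have "y\<^sup>2 \<le> x\<^sup>2" using power_mono[of y "\<bar>x\<bar>" 2] by simp
  moreover have "y\<^sup>2 > 0" using * by simp
  ultimately show ?thesis using * by (auto simp: lyapunov_def intro!: divide_left_mono)
qed

text \<open>
  The last assumption is what remains of the moment condition. The radius \<open>s\<close> is the only parameter on
  which later constants depend.
\<close>
locale tame_coeffs = prob_space M for M :: "'a measure" +
  fixes \<xi> :: "nat \<Rightarrow> 'a \<Rightarrow> real" and s :: real
  assumes indep: "indep_vars (\<lambda>_. borel) \<xi> UNIV"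
    and mean: "\<And>i. expectation (\<xi> i) = 0"
    and sq_integrable: "\<And>i. integrable M (\<lambda>\<omega>. (\<xi> i \<omega>)\<^sup>2)"
    and sq_mean: "\<And>i. expectation (\<lambda>\<omega>. (\<xi> i \<omega>)\<^sup>2) = 1"
    and s_pos: "0 < s" and s_le_1: "s \<le> 1"
    and char_le: "\<And>i t. \<bar>t\<bar> \<le> s \<Longrightarrow> cmod (char (distr M borel (\<xi> i)) t) \<le> exp (- t\<^sup>2 / 4)"
begin

lemma rv[measurable]: "\<xi> i \<in> borel_measurable M"
  using indep by (auto simp: indep_vars_def)

lemma indep_linear:
  assumes "finite A" "finite B" "A \<inter> B = {}"
  shows "indep_var borel (\<lambda>\<omega>. \<Sum>i\<in>A. \<alpha> i * \<xi> i \<omega>) borel (\<lambda>\<omega>. \<Sum>i\<in>B. \<beta> i * \<xi> i \<omega>)"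
proof -
  have "indep_var borel ((\<lambda>v. \<Sum>i\<in>A. \<alpha> i * v i) \<circ> (\<lambda>\<omega>. restrict (\<lambda>i. \<xi> i \<omega>) A))
        borel ((\<lambda>v. \<Sum>i\<in>B. \<beta> i * v i) \<circ> (\<lambda>\<omega>. restrict (\<lambda>i. \<xi> i \<omega>) B))"
    by (rule indep_var_compose[OF indep_var_restrict[OF indep]])
       (use assms in \<open>auto intro!: borel_measurable_sum borel_measurable_times measurable_component_singleton\<close>)
  then show ?thesis by (simp add: comp_def cong: sum.cong)
qed

lemma second_moment_sum:
  assumes "finite A"
  shows "integrable M (\<lambda>\<omega>. (\<Sum>i\<in>A. \<beta> i * \<xi> i \<omega>)\<^sup>2)" (is "?I A")
    and "expectation (\<lambda>\<omega>. (\<Sum>i\<in>A. \<beta> i * \<xi> i \<omega>)\<^sup>2) = (\<Sum>i\<in>A. (\<beta> i)\<^sup>2)" (is "?E A")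
proof -
  have i1: "integrable M (\<xi> i)" for i using expectation_abs_le_sqrt(1)[OF rv sq_integrable] .
  have "?I A \<and> ?E A" using assms
  proof (induction A rule: finite_induct)
    case (insert k A)
    define X where "X \<omega> = (\<Sum>i\<in>A. \<beta> i * \<xi> i \<omega>)" for \<omega>
    have iX: "integrable M X" unfolding X_def using i1 by simp
    have eX: "expectation X = 0" unfolding X_def by (subst Bochner_Integration.integral_sum) (use i1 mean in auto)
    have ind: "indep_var borel X borel (\<lambda>\<omega>. \<Sum>i\<in>{k}. \<beta> i * \<xi> i \<omega>)"
      unfolding X_def using insert by (intro indep_linear) auto
    have iY: "integrable M (\<lambda>\<omega>. \<Sum>i\<in>{k}. \<beta> i * \<xi> i \<omega>)" using i1 by simp
    have iXY: "integrable M (\<lambda>\<omega>. X \<omega> * (\<beta> k * \<xi> k \<omega>))"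
      using indep_var_integrable[OF ind iX iY] by simp
    have eXY: "expectation (\<lambda>\<omega>. X \<omega> * (\<beta> k * \<xi> k \<omega>)) = 0"
      using indep_var_lebesgue_integral[OF ind iX iY] eX by simp
    have i2: "integrable M (\<lambda>\<omega>. (\<beta> k * \<xi> k \<omega>)\<^sup>2)" using sq_integrable by (simp add: power_mult_distrib)
    have e2: "expectation (\<lambda>\<omega>. (\<beta> k * \<xi> k \<omega>)\<^sup>2) = (\<beta> k)\<^sup>2" using sq_mean by (simp add: power_mult_distrib)
    have eq: "(\<Sum>i\<in>insert k A. \<beta> i * \<xi> i \<omega>)\<^sup>2 = ((X \<omega>)\<^sup>2 + 2 * (X \<omega> * (\<beta> k * \<xi> k \<omega>))) + (\<beta> k * \<xi> k \<omega>)\<^sup>2" for \<omega>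
      using insert by (simp add: X_def power2_eq_square algebra_simps)
    have IH: "integrable M (\<lambda>\<omega>. (X \<omega>)\<^sup>2)" "expectation (\<lambda>\<omega>. (X \<omega>)\<^sup>2) = (\<Sum>i\<in>A. (\<beta> i)\<^sup>2)"
      using insert.IH by (auto simp: X_def)
    show ?case unfolding eq using IH iXY i2 eXY e2 insert.hyps by simp
  qed simp
  then show "?I A" "?E A" by auto
qed

lemma expectation_abs_sum_le:
  assumes "finite A"
  shows "integrable M (\<lambda>\<omega>. \<bar>\<Sum>i\<in>A. \<xi> i \<omega> * \<beta> i\<bar>)"
    and "expectation (\<lambda>\<omega>. \<bar>\<Sum>i\<in>A. \<xi> i \<omega> * \<beta> i\<bar>) \<le> sqrt (\<Sum>i\<in>A. (\<beta> i)\<^sup>2)"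
proof -
  have m: "(\<lambda>\<omega>. \<Sum>i\<in>A. \<beta> i * \<xi> i \<omega>) \<in> borel_measurable M" by simp
  show "integrable M (\<lambda>\<omega>. \<bar>\<Sum>i\<in>A. \<xi> i \<omega> * \<beta> i\<bar>)"
    using expectation_abs_le_sqrt(1)[OF m second_moment_sum(1)[OF assms]] by (simp add: mult.commute)
  show "expectation (\<lambda>\<omega>. \<bar>\<Sum>i\<in>A. \<xi> i \<omega> * \<beta> i\<bar>) \<le> sqrt (\<Sum>i\<in>A. (\<beta> i)\<^sup>2)"
    using expectation_abs_le_sqrt(2)[OF m second_moment_sum(1)[OF assms]]
    by (simp add: mult.commute second_moment_sum(2)[OF assms])
qed

text \<open>
  The characteristic function of the sum is at most \<open>exp (- V * t\<^sup>2 / 4)\<close> for \<open>\<bar>t\<bar> \<le> s\<close>, and Esseen's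
  inequality at level \<open>R \<ge> 1 / s\<close> sees no other \<open>t\<close>. Levels below a constant are out of reach, as the
  coefficients may be discrete.
\<close>
lemma small_ball:
  assumes A: "finite A" and b: "\<And>i. i \<in> A \<Longrightarrow> \<bar>b i\<bar> \<le> 1" and V: "(\<Sum>i\<in>A. (b i)\<^sup>2) \<ge> V" "V > 0"
    and R: "R \<ge> 1 / s"
  shows "prob {\<omega> \<in> space M. \<bar>\<Sum>i\<in>A. \<xi> i \<omega> * b i\<bar> \<le> R} \<le> 16 * R / sqrt V"
proof -
  have R0: "R > 0" using R s_pos by (smt (verit) divide_pos_pos)
  have sR: "s * R \<ge> 1" using R s_pos by (simp add: field_simps)
  have iv: "indep_vars (\<lambda>_. borel) (\<lambda>i \<omega>. \<xi> i \<omega> * b i) A"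
    using indep_vars_compose2[OF indep_vars_subset[OF indep subset_UNIV], of A "\<lambda>i x. x * b i" "\<lambda>_. borel"] by simp
  have "prob {\<omega> \<in> space M. \<bar>\<Sum>i\<in>A. \<xi> i \<omega> * b i\<bar> \<le> R} \<le> 8 / (sqrt V / (2 * R))"
  proof (rule prob_abs_le_char)
    fix t :: real assume t: "0 \<le> t" "t \<le> 1"
    have small: "\<bar>b i * (t / R)\<bar> \<le> s" if "i \<in> A" for i
    proof -
      have "\<bar>b i * (t / R)\<bar> = \<bar>b i\<bar> * t / R" using t R0 by (simp add: abs_mult)
      also have "\<dots> \<le> 1 * 1 / R" using t b[OF that] R0 by (intro divide_right_mono mult_mono) auto
      also have "\<dots> \<le> s" using sR R0 by (simp add: field_simps)
      finally show ?thesis .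
    qed
    have "cmod (char (distr M borel (\<lambda>\<omega>. \<Sum>i\<in>A. \<xi> i \<omega> * b i)) (t / R)) = (\<Prod>i\<in>A. cmod (char (distr M borel (\<xi> i)) (b i * (t / R))))"
    proof -
      have "char (distr M borel (\<lambda>\<omega>. \<xi> i \<omega> * b i)) u = char (distr M borel (\<xi> i)) (b i * u)" for i u
        unfolding char_def by (subst (1 2) integral_distr) (auto simp: mult_ac)
      then show ?thesis by (simp add: char_distr_sum[OF iv] prod_norm)
    qed
    also have "\<dots> \<le> (\<Prod>i\<in>A. exp (- (b i * (t / R))\<^sup>2 / 4))"
      by (intro prod_mono conjI norm_ge_zero char_le small)
    also have "\<dots> = exp (\<Sum>i\<in>A. - (b i * (t / R))\<^sup>2 / 4)" by (simp add: exp_sum A)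
    also have "(\<Sum>i\<in>A. - (b i * (t / R))\<^sup>2 / 4) = - ((\<Sum>i\<in>A. (b i)\<^sup>2) * (t / R)\<^sup>2 / 4)"
      by (simp only: power_mult_distrib sum_divide_distrib[symmetric] sum_distrib_right sum_negf minus_divide_left)
    also have "exp \<dots> \<le> exp (- (V * (t / R)\<^sup>2 / 4))" using V by (simp add: mult_right_mono)
    also have "V * (t / R)\<^sup>2 / 4 = (sqrt V / (2 * R) * t)\<^sup>2" using V by (simp add: power_mult_distrib power_divide)
    also have "exp (- (sqrt V / (2 * R) * t)\<^sup>2) \<le> 1 / (1 + (sqrt V / (2 * R) * t)\<^sup>2)"
    proof -
      have "1 + y \<le> exp y" for y :: real by simp
      then show ?thesis
        by (subst exp_minus, subst inverse_eq_divide, intro divide_left_mono) (auto intro!: mult_pos_pos add_pos_nonneg)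
    qed
    finally show "cmod (char (distr M borel (\<lambda>\<omega>. \<Sum>i\<in>A. \<xi> i \<omega> * b i)) (t / R)) \<le> 1 / (1 + (sqrt V / (2 * R) * t)\<^sup>2)" .
  qed (use R0 V in auto)
  then show ?thesis by simp
qed

text \<open>
  A variable that is almost constant has a characteristic function of modulus almost 1, which is
  excluded at \<open>t = s\<close>.
\<close>
lemma prob_near_le: "prob {\<omega> \<in> space M. \<bar>\<xi> i \<omega> - a\<bar> \<le> s / 32} \<le> 1 - s\<^sup>2 / 64"
proof -
  define P where "P = prob {\<omega> \<in> space M. \<bar>\<xi> i \<omega> - a\<bar> \<le> s / 32}"
  have s2: "s\<^sup>2 \<le> 1" using s_pos s_le_1 by (simp add: power_le_one)
  have ii: "integrable M (indicat_real {\<omega> \<in> space M. \<bar>\<xi> i \<omega> - a\<bar> \<le> s / 32})"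
    by (rule integrable_indicat) simp
  have "(2 - s\<^sup>2 / 32) * P - 1 = expectation (\<lambda>\<omega>. (2 - s\<^sup>2 / 32) * indicator {\<omega> \<in> space M. \<bar>\<xi> i \<omega> - a\<bar> \<le> s / 32} \<omega> - 1)"
    unfolding P_def by (subst Bochner_Integration.integral_diff) (use ii in \<open>auto simp: prob_space\<close>)
  also have "\<dots> \<le> expectation (\<lambda>\<omega>. cos (s * (\<xi> i \<omega> - a)))"
  proof (rule integral_mono)
    show "integrable M (\<lambda>\<omega>. cos (s * (\<xi> i \<omega> - a)))" by (rule integrable_const_bound[where B = 1]) auto
    fix \<omega> assume \<omega>: "\<omega> \<in> space M"
    show "(2 - s\<^sup>2 / 32) * indicator {\<omega> \<in> space M. \<bar>\<xi> i \<omega> - a\<bar> \<le> s / 32} \<omega> - 1 \<le> cos (s * (\<xi> i \<omega> - a))"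
    proof (cases "\<bar>\<xi> i \<omega> - a\<bar> \<le> s / 32")
      case True
      have "\<bar>s * (\<xi> i \<omega> - a)\<bar> \<le> s * (s / 32)" unfolding abs_mult using True s_pos by (intro mult_mono) auto
      then have "(s * (\<xi> i \<omega> - a))\<^sup>2 \<le> (s * (s / 32))\<^sup>2" by (rule power2_le_iff_abs_le[THEN iffD2, rotated]) (use s_pos in auto)
      also have "\<dots> = s\<^sup>2 * s\<^sup>2 / 1024" by (simp add: power2_eq_square)
      also have "\<dots> \<le> s\<^sup>2 * 1 / 1024" using s2 by (intro divide_right_mono mult_left_mono) auto
      finally have "(s * (\<xi> i \<omega> - a))\<^sup>2 \<le> s\<^sup>2 / 1024" by simp
      moreover have "0 \<le> s\<^sup>2" by simp
      ultimately have "1 - s\<^sup>2 / 32 \<le> cos (s * (\<xi> i \<omega> - a))"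
        using one_minus_half_square_le_cos[of "s * (\<xi> i \<omega> - a)"] by linarith
      then show ?thesis using True \<omega> by simp
    qed simp
  qed (use ii in simp)
  also have "\<dots> \<le> cmod (char (distr M borel (\<xi> i)) s)" by (rule expectation_cos_le_char) simp
  also have "\<dots> \<le> exp (- (s\<^sup>2 / 4))" using char_le[of s i] s_pos by simp
  also have "\<dots> \<le> 1 - s\<^sup>2 / 8"
  proof -
    define u where "u = s\<^sup>2 / 4"
    have u: "0 \<le> u" "u \<le> 1" using s2 by (auto simp: u_def)
    have "exp (- u) \<le> 1 / (1 + u)" using exp_ge_add_one_self[of u] u
      by (subst exp_minus, subst inverse_eq_divide, intro divide_left_mono) auto
    also have "\<dots> \<le> 1 - u / 2" using u by (simp add: field_simps mult_left_le)
    finally show ?thesis by (simp add: u_def)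
  qed
  finally have *: "(2 - s\<^sup>2 / 32) * P \<le> 2 - s\<^sup>2 / 8" by simp
  have "P \<le> 1" by (simp add: P_def)
  then have "s\<^sup>2 / 32 * P \<le> s\<^sup>2 / 32 * 1" by (intro mult_left_mono) auto
  then have "P \<le> 1 - 3 * s\<^sup>2 / 64" using * by (simp add: algebra_simps)
  moreover have "s\<^sup>2 \<ge> 0" by simp
  ultimately show ?thesis unfolding P_def[symmetric] by linarith
qed

text \<open>
  For \<open>\<bar>b\<bar> \<le> 4\<close> the variable misses a neighbourhood of \<open>b\<close> with positive probability, and then the
  small \<open>\<rho>\<close> throws \<open>(b - \<xi>) / \<rho>\<close> far out. For \<open>\<bar>b\<bar> > 4\<close> either \<open>\<xi>\<close> is exceptionally large, which
  Chebyshev's inequality makes as unlikely as \<open>lyapunov b\<close> requires, or the argument only grows.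
\<close>
lemma lyapunov_contraction:
  assumes \<rho>: "0 < \<rho>" "\<rho> \<le> s / 256"
  shows "expectation (\<lambda>\<omega>. lyapunov ((b - \<xi> i \<omega>) / \<rho>)) \<le> (1 - s\<^sup>2 / 128) * lyapunov b"
proof -
  have s2: "s\<^sup>2 \<le> 1" using s_pos s_le_1 by (simp add: power_le_one)
  have int: "integrable M (\<lambda>\<omega>. lyapunov ((b - \<xi> i \<omega>) / \<rho>))"
    by (rule integrable_const_bound[where B = 1]) (use lyapunov_bounds in auto)
  show ?thesis
  proof (cases "\<bar>b\<bar> \<le> 4")
    case True
    have ii: "integrable M (indicat_real {\<omega> \<in> space M. \<bar>\<xi> i \<omega> - b\<bar> \<le> s / 32})"
      by (rule integrable_indicat) simp
    have "expectation (\<lambda>\<omega>. lyapunov ((b - \<xi> i \<omega>) / \<rho>)) \<le> expectation (\<lambda>\<omega>. 1 / 2 + 1 / 2 * indicator {\<omega> \<in> space M. \<bar>\<xi> i \<omega> - b\<bar> \<le> s / 32} \<omega>)"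
    proof (rule integral_mono[OF int])
      fix \<omega> assume \<omega>: "\<omega> \<in> space M"
      show "lyapunov ((b - \<xi> i \<omega>) / \<rho>) \<le> 1 / 2 + 1 / 2 * indicator {\<omega> \<in> space M. \<bar>\<xi> i \<omega> - b\<bar> \<le> s / 32} \<omega>"
      proof (cases "\<bar>\<xi> i \<omega> - b\<bar> \<le> s / 32")
        case False
        have "8 \<le> (s / 32) / \<rho>" using \<rho> by (simp add: field_simps)
        also have "\<dots> \<le> \<bar>b - \<xi> i \<omega>\<bar> / \<rho>" using False \<rho>
          by (intro divide_right_mono) (auto simp: abs_minus_commute)
        finally have "\<bar>(b - \<xi> i \<omega>) / \<rho>\<bar> \<ge> 8" using \<rho> by (simp add: abs_divide)
        then have "lyapunov ((b - \<xi> i \<omega>) / \<rho>) \<le> 16 / 8\<^sup>2" by (intro lyapunov_le) auto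
        then show ?thesis using False by simp
      qed (use \<omega> lyapunov_bounds in auto)
    qed (use ii in simp)
    also have "\<dots> = 1 / 2 + 1 / 2 * prob {\<omega> \<in> space M. \<bar>\<xi> i \<omega> - b\<bar> \<le> s / 32}"
      by (subst Bochner_Integration.integral_add) (use ii in \<open>auto simp: prob_space\<close>)
    also have "\<dots> \<le> 1 / 2 + 1 / 2 * (1 - s\<^sup>2 / 64)" using prob_near_le[of i b] by simp
    also have "\<dots> = (1 - s\<^sup>2 / 128) * lyapunov b" using True by (simp add: lyapunov_def field_simps)
    finally show ?thesis .
  next
    case False
    then have b: "\<bar>b\<bar> > 4" "b \<noteq> 0" by auto
    then have b2: "b\<^sup>2 > 0" by simp
    have "expectation (\<lambda>\<omega>. lyapunov ((b - \<xi> i \<omega>) / \<rho>)) \<le> expectation (\<lambda>\<omega>. 4 / b\<^sup>2 * (\<xi> i \<omega>)\<^sup>2 + 64 * \<rho>\<^sup>2 / b\<^sup>2)"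
    proof (rule integral_mono[OF int])
      show "integrable M (\<lambda>\<omega>. 4 / b\<^sup>2 * (\<xi> i \<omega>)\<^sup>2 + 64 * \<rho>\<^sup>2 / b\<^sup>2)" using sq_integrable by simp
      fix \<omega>
      show "lyapunov ((b - \<xi> i \<omega>) / \<rho>) \<le> 4 / b\<^sup>2 * (\<xi> i \<omega>)\<^sup>2 + 64 * \<rho>\<^sup>2 / b\<^sup>2"
      proof (cases "\<bar>\<xi> i \<omega>\<bar> \<ge> \<bar>b\<bar> / 2")
        case True
        then have "(\<bar>b\<bar> / 2)\<^sup>2 \<le> \<bar>\<xi> i \<omega>\<bar>\<^sup>2" by (intro power_mono) auto
        then have "1 \<le> 4 / b\<^sup>2 * (\<xi> i \<omega>)\<^sup>2" using b2 by (simp add: field_simps)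
        moreover have "0 \<le> 64 * \<rho>\<^sup>2 / b\<^sup>2" by simp
        ultimately show ?thesis using lyapunov_bounds(2)[of "(b - \<xi> i \<omega>) / \<rho>"] by linarith
      next
        case False
        then have "\<bar>b\<bar> / 2 \<le> \<bar>b - \<xi> i \<omega>\<bar>" by linarith
        from divide_right_mono[OF this, of \<rho>]
        have "\<bar>b\<bar> / 2 / \<rho> \<le> \<bar>(b - \<xi> i \<omega>) / \<rho>\<bar>" using \<rho> by (simp add: abs_divide)
        moreover have "4 < \<bar>b\<bar> / 2 / \<rho>"
        proof -
          have "4 * \<rho> < 2" using \<rho> s_le_1 by linarith
          also have "\<dots> < \<bar>b\<bar> / 2" using b by simp
          finally show ?thesis using \<rho> by (simp add: field_simps)
        qed
        ultimately have "lyapunov ((b - \<xi> i \<omega>) / \<rho>) \<le> 16 / (\<bar>b\<bar> / 2 / \<rho>)\<^sup>2" by (intro lyapunov_le)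
        also have "\<dots> = 64 * \<rho>\<^sup>2 / b\<^sup>2" using b by (simp add: power_divide)
        finally have "lyapunov ((b - \<xi> i \<omega>) / \<rho>) \<le> 64 * \<rho>\<^sup>2 / b\<^sup>2" .
        moreover have "0 \<le> 4 / b\<^sup>2 * (\<xi> i \<omega>)\<^sup>2" by simp
        ultimately show ?thesis by linarith
      qed
    qed
    also have "\<dots> = (4 + 64 * \<rho>\<^sup>2) / b\<^sup>2" using sq_integrable sq_mean by (simp add: prob_space add_divide_distrib)
    also have "\<dots> \<le> 8 / b\<^sup>2"
    proof -
      have "\<rho>\<^sup>2 \<le> (1 / 256)\<^sup>2" using \<rho> s_le_1 by (intro power_mono) auto
      then show ?thesis using b2 by (intro divide_right_mono) (auto simp: power2_eq_square)
    qed
    also have "\<dots> = 1 / 2 * lyapunov b" using False by (simp add: lyapunov_def)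
    also have "\<dots> \<le> (1 - s\<^sup>2 / 128) * lyapunov b" using s2 lyapunov_bounds by (intro mult_right_mono) auto
    finally show ?thesis .
  qed
qed

text \<open>
  Revealing the terms one after the other divides the target by \<open>\<rho>\<close> in every step, since
  \<open>x + \<rho> * y\<close> is within \<open>\<rho>^(T + 1)\<close> of \<open>b\<close> iff \<open>y\<close> is within \<open>\<rho>^T\<close> of \<open>(b - x) / \<rho>\<close>. The
  Lyapunov function makes the induction go through with a factor below 1 per step.
\<close>
lemma geometric_small_ball_aux:
  assumes \<rho>: "0 < \<rho>" "\<rho> \<le> s / 256" and d: "d > 0"
  shows "prob {\<omega> \<in> space M. \<bar>(\<Sum>j<T. \<rho> ^ j * \<xi> (d * (a + j)) \<omega>) - b\<bar> \<le> \<rho> ^ T} \<le> (1 - s\<^sup>2 / 128) ^ T * lyapunov b"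
proof (induction T arbitrary: a b)
  case 0
  show ?case by (cases "\<bar>b\<bar> \<le> 1") (auto simp: lyapunov_def prob_le_1)
next
  case (Suc T)
  define B where "B = (\<lambda>j. d * (Suc a + j)) ` {..<T}"
  have inj: "inj_on (\<lambda>j. d * (Suc a + j)) {..<T}" using d by (auto simp: inj_on_def)
  \<comment> \<open>The sum is \<open>\<xi> (d * a) + \<rho> * Y\<close> with independent summands.\<close>
  define Y where "Y \<omega> = (\<Sum>j<T. \<rho> ^ j * \<xi> (d * (Suc a + j)) \<omega>)" for \<omega>
  define \<beta> where "\<beta> i = \<rho> ^ (i div d - Suc a)" for i
  have Y: "Y \<omega> = (\<Sum>i\<in>B. \<beta> i * \<xi> i \<omega>)" for \<omega>
    unfolding B_def Y_def by (subst sum.reindex[OF inj]) (use d in \<open>simp add: \<beta>_def\<close>)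
  have "indep_var borel (\<lambda>\<omega>. \<Sum>i\<in>{d * a}. 1 * \<xi> i \<omega>) borel (\<lambda>\<omega>. \<Sum>i\<in>B. \<beta> i * \<xi> i \<omega>)"
  proof (rule indep_linear)
    have "d * a \<noteq> d * (Suc a + j)" for j using d by (subst mult_left_cancel) auto
    then show "{d * a} \<inter> B = {}" by (auto simp: B_def simp del: mult_Suc_right add_Suc)
  qed (auto simp: B_def)
  moreover have "(\<lambda>\<omega>. \<Sum>i\<in>{d * a}. 1 * \<xi> i \<omega>) = \<xi> (d * a)" "(\<lambda>\<omega>. \<Sum>i\<in>B. \<beta> i * \<xi> i \<omega>) = Y"
    using Y by auto
  ultimately have ind: "indep_var borel (\<xi> (d * a)) borel Y" by simp
  define S where "S = {(x, y :: real). \<bar>x + \<rho> * y - b\<bar> \<le> \<rho> ^ Suc T}"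
  have eq: "(\<Sum>j<Suc T. \<rho> ^ j * \<xi> (d * (a + j)) \<omega>) = \<xi> (d * a) \<omega> + \<rho> * Y \<omega>" for \<omega>
    unfolding Y_def by (subst sum.lessThan_Suc_shift) (simp add: sum_distrib_left mult_ac)
  have "prob {\<omega> \<in> space M. (\<xi> (d * a) \<omega>, Y \<omega>) \<in> S} \<le> expectation (\<lambda>\<omega>. (1 - s\<^sup>2 / 128) ^ T * lyapunov ((b - \<xi> (d * a) \<omega>) / \<rho>))"
  proof (rule prob_indep_le[OF ind])
    have "closed S" unfolding S_def case_prod_unfold by (intro closed_Collect_le continuous_intros)
    then show "S \<in> sets (borel \<Otimes>\<^sub>M borel)" unfolding borel_prod by (rule borel_closed)
    fix x
    have "{\<omega> \<in> space M. (x, Y \<omega>) \<in> S} = {\<omega> \<in> space M. \<bar>Y \<omega> - (b - x) / \<rho>\<bar> \<le> \<rho> ^ T}"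
    proof -
      have "\<bar>x + \<rho> * y - b\<bar> \<le> \<rho> ^ Suc T \<longleftrightarrow> \<bar>y - (b - x) / \<rho>\<bar> \<le> \<rho> ^ T" for y
      proof -
        have "x + \<rho> * y - b = \<rho> * (y - (b - x) / \<rho>)" using \<rho> by (simp add: field_simps)
        then have "\<bar>x + \<rho> * y - b\<bar> = \<rho> * \<bar>y - (b - x) / \<rho>\<bar>" using \<rho> by (simp add: abs_mult)
        then show ?thesis using \<rho> by simp
      qed
      then show ?thesis by (auto simp: S_def)
    qed
    then show "prob {\<omega> \<in> space M. (x, Y \<omega>) \<in> S} \<le> (1 - s\<^sup>2 / 128) ^ T * lyapunov ((b - x) / \<rho>)"
      using Suc.IH[of "Suc a" "(b - x) / \<rho>"] by (simp add: Y_def)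
    have "s\<^sup>2 \<le> 1" using s_pos s_le_1 by (simp add: power_le_one)
    then show "(1 - s\<^sup>2 / 128) ^ T * lyapunov ((b - x) / \<rho>) \<le> 1"
      using lyapunov_bounds by (intro mult_le_one power_le_one) auto
  qed simp
  also have "\<dots> = (1 - s\<^sup>2 / 128) ^ T * expectation (\<lambda>\<omega>. lyapunov ((b - \<xi> (d * a) \<omega>) / \<rho>))" by simp
  also have "\<dots> \<le> (1 - s\<^sup>2 / 128) ^ T * ((1 - s\<^sup>2 / 128) * lyapunov b)"
  proof (intro mult_left_mono lyapunov_contraction \<rho>)
    have "s\<^sup>2 \<le> 1" using s_pos s_le_1 by (simp add: power_le_one)
    then show "0 \<le> (1 - s\<^sup>2 / 128) ^ T" by simp
  qed
  finally show ?case unfolding eq by (simp add: S_def mult_ac)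
qed

text \<open>
  For \<open>x = c\<close> the powers with exponents \<open>0, d, 2 * d, \<dots>\<close> decay geometrically with a small ratio;
  all other terms are frozen and shift the target. In contrast to \<open>small_ball\<close> the probability is
  exponentially small in the number of terms, whatever the scale.
\<close>
lemma geometric_small_ball:
  assumes c: "0 < c" and \<rho>: "c ^ d \<le> s / 256" and A: "finite A" "\<And>j. j < T \<Longrightarrow> d * j \<in> A"
  shows "prob {\<omega> \<in> space M. \<bar>\<Sum>i\<in>A. \<xi> i \<omega> * c ^ i\<bar> \<le> (c ^ d) ^ T} \<le> (1 - s\<^sup>2 / 128) ^ T"
proof -
  define \<rho> where "\<rho> = c ^ d"
  have \<rho>': "0 < \<rho>" "\<rho> \<le> s / 256" using c \<rho> by (auto simp: \<rho>_def)
  have d: "d > 0" using \<rho>' s_le_1 by (cases d) (auto simp: \<rho>_def)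
  define B where "B = (\<lambda>j. d * j) ` {..<T}"
  have BA: "B \<subseteq> A" using A by (auto simp: B_def)
  have inj: "inj_on (\<lambda>j. d * j) {..<T}" using d by (auto simp: inj_on_def)
  define X where "X \<omega> = (\<Sum>i\<in>A - B. c ^ i * \<xi> i \<omega>)" for \<omega>
  define Y where "Y \<omega> = (\<Sum>i\<in>B. c ^ i * \<xi> i \<omega>)" for \<omega>
  have Y: "Y \<omega> = (\<Sum>j<T. \<rho> ^ j * \<xi> (d * (0 + j)) \<omega>)" for \<omega>
    unfolding Y_def B_def by (subst sum.reindex[OF inj]) (simp add: \<rho>_def power_mult)
  have ind: "indep_var borel X borel Y" unfolding X_def Y_def
    using A BA by (intro indep_linear) (auto intro: finite_subset)
  have eq: "(\<Sum>i\<in>A. \<xi> i \<omega> * c ^ i) = X \<omega> + Y \<omega>" for \<omega>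
    unfolding X_def Y_def using A BA by (subst sum.subset_diff[OF BA]) (auto simp: mult.commute)
  define S where "S = {(x, y :: real). \<bar>x + y\<bar> \<le> \<rho> ^ T}"
  have \<theta>: "0 \<le> 1 - s\<^sup>2 / 128"
  proof -
    have "s\<^sup>2 \<le> 1" using s_pos s_le_1 by (simp add: power_le_one)
    then show ?thesis by simp
  qed
  have "prob {\<omega> \<in> space M. (X \<omega>, Y \<omega>) \<in> S} \<le> expectation (\<lambda>\<omega>. (1 - s\<^sup>2 / 128) ^ T)"
  proof (rule prob_indep_le[OF ind])
    have "closed S" unfolding S_def case_prod_unfold by (intro closed_Collect_le continuous_intros)
    then show "S \<in> sets (borel \<Otimes>\<^sub>M borel)" unfolding borel_prod by (rule borel_closed)
    fix x
    have "prob {\<omega> \<in> space M. (x, Y \<omega>) \<in> S} = prob {\<omega> \<in> space M. \<bar>(\<Sum>j<T. \<rho> ^ j * \<xi> (d * (0 + j)) \<omega>) - (- x)\<bar> \<le> \<rho> ^ T}"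
      by (simp add: S_def Y add.commute)
    also have "\<dots> \<le> (1 - s\<^sup>2 / 128) ^ T * lyapunov (- x)"
      by (rule geometric_small_ball_aux[OF \<rho>' d])
    also have "\<dots> \<le> (1 - s\<^sup>2 / 128) ^ T" using lyapunov_bounds(2)[of "-x"] \<theta> by (intro mult_right_le_one_le) (auto simp: lyapunov_bounds)
    finally show "prob {\<omega> \<in> space M. (x, Y \<omega>) \<in> S} \<le> (1 - s\<^sup>2 / 128) ^ T" .
  qed auto
  then show ?thesis by (simp add: prob_space eq S_def \<rho>_def)
qed

end

section \<open>Sums of squared binomial coefficients\<close>

text \<open>
  Partial sums of the binomial series of \<open>(1 - y)^(- r - 1)\<close>; multiplication by \<open>1 - y\<close> lowers \<open>r\<close> by
  Pascal's rule, up to a nonnegative boundary term.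
\<close>
lemma negative_binomial_sum_le:
  fixes y :: real
  assumes y: "0 \<le> y" "y < 1"
  shows "(\<Sum>l\<le>L. real (l + r choose r) * y ^ l) \<le> 1 / (1 - y) ^ Suc r"
proof (induction r arbitrary: L)
  case 0
  have "(\<Sum>l\<le>L. y ^ l) = (1 - y ^ Suc L) / (1 - y)"
    using y by (subst sum_gp0) auto
  also have "\<dots> \<le> 1 / (1 - y)" using y by (intro divide_right_mono) auto
  finally show ?case by simp
next
  case (Suc r)
  have tel: "(1 - y) * (\<Sum>l\<le>L. real (l + Suc r choose Suc r) * y ^ l) + real (Suc (L + r) choose Suc r) * y ^ Suc L
      = (\<Sum>l\<le>L. real (l + r choose r) * y ^ l)" for L
  proof (induction L)
    case (Suc L)
    have "real (Suc (Suc (L + r)) choose Suc r) = real (Suc L + r choose r) + real (Suc (L + r) choose Suc r)"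
      by simp
    then show ?case using Suc by (simp add: algebra_simps)
  qed (simp add: algebra_simps)
  have "(1 - y) * (\<Sum>l\<le>L. real (l + Suc r choose Suc r) * y ^ l) \<le> (\<Sum>l\<le>L. real (l + r choose r) * y ^ l)"
    unfolding tel[symmetric] using y by simp
  also have "\<dots> \<le> 1 / (1 - y) ^ Suc r" by (rule Suc.IH)
  finally have "(\<Sum>l\<le>L. real (l + Suc r choose Suc r) * y ^ l) \<le> 1 / (1 - y) ^ Suc r / (1 - y)"
    using y by (subst pos_le_divide_eq) (auto simp only: mult.commute)
  then show ?case by (simp add: mult.commute)
qed

lemma geometric_sum_le:
  fixes x :: real
  assumes "0 \<le> x" "x < 1"
  shows "(\<Sum>j\<le>n. x ^ j) \<le> 1 / (1 - x)"
  using negative_binomial_sum_le[of x 0 n] assms by simp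

lemma fact_square_le: "j \<le> n \<Longrightarrow> fact n * fact n \<le> fact (n + j) * (fact (n - j) :: real)"
proof (induction j)
  case (Suc j)
  define m where "m = n - Suc j"
  have m: "n - j = Suc m" "n - Suc j = m" "n = m + Suc j" using Suc.prems by (auto simp: m_def)
  have "real (Suc m) * (fact n * fact n) \<le> real (Suc (n + j)) * (fact (n + j) * fact (n - j))"
    by (rule mult_mono[OF _ Suc.IH]) (use Suc.prems m in auto)
  also have "\<dots> = real (Suc m) * (fact (n + Suc j) * fact (n - Suc j))"
    unfolding m(1,2) by (simp add: mult_ac del: of_nat_Suc)
  finally show ?case by (subst (asm) mult_le_cancel_left_pos) auto
qed simp

text \<open>
  The right-hand side is what the negative binomial sum can handle. The inequality follows from
  \<open>(n!)\<^sup>2 \<le> (n + j)! * (n - j)!\<close>, the log-convexity of the factorial.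
\<close>
lemma binomial_square_le: "(real (n choose j))\<^sup>2 \<le> 4 ^ j * real (n + j choose (2 * j))"
proof (cases "j \<le> n")
  case True
  define m where "m = n - j"
  have n: "n = m + j" using True by (simp add: m_def)
  have 1: "real ((n + j) choose (2*j)) = fact (n + j) / (fact (2 * j) * fact m)"
    using binomial_fact[of "2 * j" "n + j", where 'a = real] by (simp add: n)
  have 2: "real (n choose j) = fact n / (fact j * fact m)"
    using binomial_fact[OF True, where 'a = real] by (simp add: n)
  have 3: "real ((2 * j) choose j) = fact (2 * j) / (fact j * fact j)"
    using binomial_fact[of j "2 * j", where 'a = real] by simp
  have "(2 * j) choose j \<le> 2 ^ (2 * j)" by (rule binomial_le_pow2)
  then have 4: "real ((2 * j) choose j) \<le> 4 ^ j" by (simp add: power_mult flip: of_nat_le_iff)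
  have "(real (n choose j))\<^sup>2 = (fact n * fact n) / (fact j * fact j * fact m * fact m)"
    unfolding 2 by (simp add: power2_eq_square mult_ac)
  also have "\<dots> \<le> (fact (n + j) * fact m) / (fact j * fact j * fact m * fact m)"
    using fact_square_le[OF True] by (intro divide_right_mono) (auto simp: m_def)
  also have "\<dots> = real ((2 * j) choose j) * real ((n + j) choose (2*j))"
    unfolding 1 3 by (simp add: field_simps)
  also have "\<dots> \<le> 4 ^ j * real ((n + j) choose (2*j))" using 4 by (intro mult_right_mono) auto
  finally show ?thesis .
qed (simp add: binomial_eq_0)

text \<open>
  The extra factor \<open>n + 1\<close> pays for restricting a sum to large \<open>n\<close>.
\<close>
lemma binomial_square_le': "(real n + 1) * (real (n choose j))\<^sup>2 \<le> 4 ^ j * (2 * real j + 1) * real (n + j + 1 choose (2 * j + 1))"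
proof -
  have eq: "(2 * real j + 1) * real (n + j + 1 choose (2 * j + 1)) = (real (n + j) + 1) * real (n + j choose (2 * j))"
    using arg_cong[OF Suc_times_binomial[of "2 * j" "n + j"], of real] by (simp add: algebra_simps)
  have "(real n + 1) * (real (n choose j))\<^sup>2 \<le> (real (n + j) + 1) * (4 ^ j * real (n + j choose (2 * j)))"
    by (intro mult_mono binomial_square_le) auto
  then show ?thesis using eq by (simp add: mult_ac)
qed

context
  fixes c :: real
  assumes c: "0 \<le> c" "c < 1"
begin

lemma one_minus_square_bounds: "0 \<le> c\<^sup>2" "c\<^sup>2 < 1" "1 - c \<le> 1 - c\<^sup>2"
proof -
  have "c * c \<le> c * 1" using c by (intro mult_left_mono) auto
  then show "0 \<le> c\<^sup>2" "c\<^sup>2 < 1" "1 - c \<le> 1 - c\<^sup>2" using c by (auto simp: power2_eq_square)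
qed

lemma sum_shift_le:
  fixes g :: "nat \<Rightarrow> real"
  assumes A: "A \<subseteq> {..n}" and g: "\<And>i. i \<in> A \<Longrightarrow> i \<ge> j \<Longrightarrow> (real (i choose j))\<^sup>2 \<le> K * real (i - j + r choose r)"
    and K: "K \<ge> 0"
  shows "(\<Sum>i\<in>A. (real (i choose j) * c ^ (i - j))\<^sup>2) \<le> K / (1 - c) ^ Suc r"
proof -
  have fA: "finite A" using A finite_subset by auto
  have "(\<Sum>i\<in>A. (real (i choose j) * c ^ (i - j))\<^sup>2) = (\<Sum>i\<in>A \<inter> {j..}. (real (i choose j) * c ^ (i - j))\<^sup>2)"
    by (rule sum.mono_neutral_right) (use fA in \<open>auto simp: binomial_eq_0\<close>)
  also have "\<dots> \<le> (\<Sum>i\<in>A \<inter> {j..}. K * (real (i - j + r choose r) * (c\<^sup>2) ^ (i - j)))"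
  proof (rule sum_mono)
    fix i assume i: "i \<in> A \<inter> {j..}"
    have "(real (i choose j) * c ^ (i - j))\<^sup>2 = (real (i choose j))\<^sup>2 * (c\<^sup>2) ^ (i - j)"
      by (simp add: power2_eq_square power_mult_distrib)
    also have "\<dots> \<le> (K * real (i - j + r choose r)) * (c\<^sup>2) ^ (i - j)"
      using i g by (intro mult_right_mono) auto
    finally show "(real (i choose j) * c ^ (i - j))\<^sup>2 \<le> K * (real (i - j + r choose r) * (c\<^sup>2) ^ (i - j))" by simp
  qed
  also have "\<dots> \<le> (\<Sum>i\<in>{j..j + n}. K * (real (i - j + r choose r) * (c\<^sup>2) ^ (i - j)))"
    using A K c by (intro sum_mono2) auto
  also have "\<dots> = (\<Sum>l\<le>n. K * (real (l + r choose r) * (c\<^sup>2) ^ l))"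
    by (rule sum.reindex_bij_witness[of _ "\<lambda>l. l + j" "\<lambda>i. i - j"]) (auto simp del: binomial_Suc_Suc)
  also have "\<dots> = K * (\<Sum>l\<le>n. real (l + r choose r) * (c\<^sup>2) ^ l)"
    by (simp add: sum_distrib_left)
  also have "\<dots> \<le> K * (1 / (1 - c\<^sup>2) ^ Suc r)"
    using K one_minus_square_bounds by (intro mult_left_mono negative_binomial_sum_le) auto
  also have "\<dots> \<le> K * (1 / (1 - c) ^ Suc r)"
    using K one_minus_square_bounds c by (intro mult_left_mono divide_left_mono power_mono mult_pos_pos zero_less_power) auto
  finally show ?thesis by simp
qed

lemma taylor_second_moment:
  assumes A: "A \<subseteq> {..n}"
  shows "(\<Sum>i\<in>A. (real (i choose j) * c ^ (i - j))\<^sup>2) \<le> 4 ^ j / (1 - c) ^ (2 * j + 1)"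
proof -
  have "(\<Sum>i\<in>A. (real (i choose j) * c ^ (i - j))\<^sup>2) \<le> 4 ^ j / (1 - c) ^ Suc (2 * j)"
  proof (rule sum_shift_le[OF A])
    fix i assume i: "i \<in> A" "i \<ge> j"
    have "i + j = i - j + 2 * j" using i by simp
    then show "(real (i choose j))\<^sup>2 \<le> 4 ^ j * real (i - j + 2 * j choose (2 * j))"
      using binomial_square_le[of i j] by (simp only:)
  qed simp
  then show ?thesis by (simp only: Suc_eq_plus1)
qed

lemma taylor_second_moment_high:
  assumes A: "A \<subseteq> {..n}" and B: "B > 0" "\<And>i. i \<in> A \<Longrightarrow> B \<le> real i"
  shows "(\<Sum>i\<in>A. (real (i choose j) * c ^ (i - j))\<^sup>2) \<le> 4 ^ j * (2 * real j + 1) / B / (1 - c) ^ (2 * j + 2)"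
proof -
  have "(\<Sum>i\<in>A. (real (i choose j) * c ^ (i - j))\<^sup>2) \<le> (4 ^ j * (2 * real j + 1) / B) / (1 - c) ^ Suc (2 * j + 1)"
  proof (rule sum_shift_le[OF A])
    fix i assume i: "i \<in> A" "i \<ge> j"
    have "B * (real (i choose j))\<^sup>2 \<le> (real i + 1) * (real (i choose j))\<^sup>2"
      using B(2)[OF i(1)] by (intro mult_right_mono) auto
    also have "\<dots> \<le> 4 ^ j * (2 * real j + 1) * real (i + j + 1 choose (2 * j + 1))" by (rule binomial_square_le')
    also have "i + j + 1 = i - j + (2 * j + 1)" using i by simp
    finally have "(real (i choose j))\<^sup>2 \<le> 4 ^ j * (2 * real j + 1) * real (i - j + (2 * j + 1) choose (2 * j + 1)) / B"
      using B(1) by (subst pos_le_divide_eq) (auto simp only: mult.commute)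
    then show "(real (i choose j))\<^sup>2 \<le> 4 ^ j * (2 * real j + 1) / B * real (i - j + (2 * j + 1) choose (2 * j + 1))"
      by (simp only: times_divide_eq_left)
  qed (use B(1) in simp)
  moreover have "Suc (2 * j + 1) = 2 * j + 2" by simp
  ultimately show ?thesis by (simp only:)
qed

end

lemma taylor_second_moment_low:
  assumes A: "A \<subseteq> {..N}" and c: "0 \<le> c" "c \<le> (1::real)"
  shows "(\<Sum>i\<in>A. (real (i choose j) * c ^ (i - j))\<^sup>2) \<le> (real N + 1) * (real N ^ j / fact j)\<^sup>2"
proof -
  have fA: "finite A" using A finite_subset by auto
  have "(\<Sum>i\<in>A. (real (i choose j) * c ^ (i - j))\<^sup>2) \<le> (\<Sum>i\<in>A. (real N ^ j / fact j)\<^sup>2)"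
  proof (intro sum_mono power_mono)
    fix i assume i: "i \<in> A"
    have "real ((i choose j) * fact j) \<le> real (i ^ j)"
      using binomial_fact_pow[of i j] by (simp only: of_nat_le_iff)
    then have "real (i choose j) * fact j \<le> real i ^ j" by simp
    also have "\<dots> \<le> real N ^ j" using i A by (intro power_mono) auto
    finally have "real (i choose j) \<le> real N ^ j / fact j" by (simp add: field_simps)
    moreover have "real (i choose j) * c ^ (i - j) \<le> real (i choose j) * 1"
      using c by (intro mult_left_mono power_le_one) auto
    ultimately show "real (i choose j) * c ^ (i - j) \<le> real N ^ j / fact j" by linarith
  qed (use c in auto)
  also have "\<dots> = real (card A) * (real N ^ j / fact j)\<^sup>2" by simp
  also have "\<dots> \<le> (real N + 1) * (real N ^ j / fact j)\<^sup>2"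
    using card_mono[OF _ A] by (intro mult_right_mono) auto
  finally show ?thesis .
qed

section \<open>Scales approaching 1\<close>

text \<open>
  Consecutive values \<open>h = (7/8)^k\<close> tile \<open>[0, 1)\<close>. The ratio is close to 1 so that three times the half
  length \<open>h / 16\<close> is only a fifth of the distance from the centre to 1, which keeps the Taylor norm with
  that radius bounded.
\<close>
abbreviation scale_interval :: "real \<Rightarrow> real set" where "scale_interval h \<equiv> {1 - h..<1 - 7 / 8 * h}"

abbreviation mid :: "real \<Rightarrow> real" where "mid h \<equiv> 1 - 15 / 16 * h"

lemma scale_interval_subset: "scale_interval h \<subseteq> {mid h - h / 16..mid h + h / 16}"
  by auto

text \<open>
  The indices that guarantee the typical size \<open>1 / sqrt h\<close> of the polynomial at scale \<open>h\<close>: for them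
  \<open>x^i\<close> is bounded below, and there are of order \<open>1 / h\<close> many.
\<close>
definition core :: "real \<Rightarrow> nat set" where
  "core h = {i. 1 / 2 \<le> real i * h \<and> real i * h \<le> 1}"

definition window :: "nat \<Rightarrow> real \<Rightarrow> real \<Rightarrow> nat set" where
  "window n y h = {i \<in> {..n}. y \<le> real i * h \<and> real i * h \<le> 1 / y}"

lemma core_subset_window:
  assumes "0 < y" "y \<le> 1 / 2" "0 < h" "1 \<le> real n * h"
  shows "core h \<subseteq> window n y h"
proof
  fix i assume i: "i \<in> core h"
  then have "real i * h \<le> real n * h" using assms(4) unfolding core_def mem_Collect_eq by linarith
  then have "real i \<le> real n" using assms(3) by (rule mult_right_le_imp_le)
  then have "i \<le> n" by simp
  moreover have "1 \<le> 1 / y" using assms by simp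
  moreover have "y \<le> real i * h" "real i * h \<le> 1" using i assms(2) unfolding core_def mem_Collect_eq by linarith+
  ultimately show "i \<in> window n y h" unfolding window_def by (auto intro: order.trans)
qed

text \<open>
  In units of scales a window extends by \<open>m\<close> on either side.
\<close>
lemma window_disjoint:
  fixes q :: real
  assumes q: "0 < q" "q < 1" and k: "k + (2 * m + 1) \<le> k'"
  shows "window n (q ^ m) (q ^ k) \<inter> window n (q ^ m) (q ^ k') = {}"
proof (rule ccontr)
  assume "\<not> ?thesis"
  then obtain i where i: "real i * q ^ k \<le> 1 / q ^ m" "q ^ m \<le> real i * q ^ k'"
    by (auto simp: window_def)
  have "q ^ k' \<le> q ^ (k + (2 * m + 1))" using q k by (intro power_decreasing) auto
  then have "real i * q ^ k' \<le> real i * q ^ (k + (2 * m + 1))" by (intro mult_left_mono) auto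
  also have "\<dots> = (real i * q ^ k) * q ^ (2 * m + 1)" by (simp only: power_add mult.assoc)
  also have "\<dots> \<le> (1 / q ^ m) * q ^ (2 * m + 1)" using i q by (intro mult_right_mono) auto
  also have "\<dots> = (1 / q ^ m * q ^ m) * (q ^ m * q)" by (simp only: power_add mult_2 power_one_right mult.assoc)
  also have "\<dots> = q ^ m * q" using q by simp
  also have "\<dots> < q ^ m" using q by simp
  finally show False using i(2) by linarith
qed

lemma finite_of_le: "A \<subseteq> {..n::nat} \<Longrightarrow> finite A"
  using finite_subset by auto

section \<open>Random Taylor coefficients\<close>

context tame_coeffs
begin

definition partial_poly :: "nat set \<Rightarrow> 'a \<Rightarrow> real poly" where
  "partial_poly A \<omega> = coeff_poly A (\<lambda>i. \<xi> i \<omega>)"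

lemma measurable_poly_partial_poly[measurable]: "(\<lambda>\<omega>. poly (partial_poly A \<omega>) x) \<in> borel_measurable M"
  unfolding partial_poly_def poly_coeff_poly by simp

lemma measurable_nroots_partial_poly: "sigma_compact T \<Longrightarrow> (\<lambda>\<omega>. real (nroots T (partial_poly A \<omega>))) \<in> borel_measurable M"
  unfolding partial_poly_def by (intro borel_measurable_nroots_coeff_poly) auto

lemma taylor_norm_partial_poly:
  assumes "A \<subseteq> {..n}"
  shows "taylor_norm c \<rho> (partial_poly A \<omega>) = (\<Sum>j\<le>n. \<bar>\<Sum>i\<in>A. \<xi> i \<omega> * (real (i choose j) * c ^ (i - j))\<bar> * \<rho> ^ j)"
  unfolding partial_poly_def by (rule taylor_norm_coeff_poly[OF assms])

lemma measurable_taylor_norm_partial_poly[measurable]: "finite A \<Longrightarrow> (\<lambda>\<omega>. taylor_norm c \<rho> (partial_poly A \<omega>)) \<in> borel_measurable M"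
  by (subst taylor_norm_partial_poly[of A "Max (insert 0 A)"]) auto

text \<open>
  The Taylor coefficients are centred sums of independent variables, so the mean modulus is at most the
  root of a sum of squares.
\<close>
lemma expectation_taylor_norm:
  assumes A: "A \<subseteq> {..n}" and \<rho>: "\<rho> \<ge> 0"
    and v: "\<And>j. (\<Sum>i\<in>A. (real (i choose j) * c ^ (i - j))\<^sup>2) \<le> v j ^ 2" "\<And>j. v j \<ge> 0"
    and sums: "(\<Sum>j\<le>n. v j * \<rho> ^ j) \<le> B"
  shows "integrable M (\<lambda>\<omega>. taylor_norm c \<rho> (partial_poly A \<omega>))"
    and "expectation (\<lambda>\<omega>. taylor_norm c \<rho> (partial_poly A \<omega>)) \<le> B"
proof -
  have fA: "finite A" using A finite_subset by auto
  note E = expectation_abs_sum_le[OF fA]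
  show "integrable M (\<lambda>\<omega>. taylor_norm c \<rho> (partial_poly A \<omega>))"
    unfolding taylor_norm_partial_poly[OF A] using E(1) by simp
  have "expectation (\<lambda>\<omega>. taylor_norm c \<rho> (partial_poly A \<omega>)) =
     (\<Sum>j\<le>n. expectation (\<lambda>\<omega>. \<bar>\<Sum>i\<in>A. \<xi> i \<omega> * (real (i choose j) * c ^ (i - j))\<bar>) * \<rho> ^ j)"
    unfolding taylor_norm_partial_poly[OF A] using E(1) by (subst Bochner_Integration.integral_sum) auto
  also have "\<dots> \<le> (\<Sum>j\<le>n. v j * \<rho> ^ j)"
  proof (intro sum_mono mult_right_mono)
    fix j
    have "expectation (\<lambda>\<omega>. \<bar>\<Sum>i\<in>A. \<xi> i \<omega> * (real (i choose j) * c ^ (i - j))\<bar>) \<le> sqrt (\<Sum>i\<in>A. (real (i choose j) * c ^ (i - j))\<^sup>2)"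
      by (rule E(2))
    also have "\<dots> \<le> v j" using v by (intro real_le_lsqrt sum_nonneg) auto
    finally show "expectation (\<lambda>\<omega>. \<bar>\<Sum>i\<in>A. \<xi> i \<omega> * (real (i choose j) * c ^ (i - j))\<bar>) \<le> v j" .
  qed (use \<rho> in auto)
  finally show "expectation (\<lambda>\<omega>. taylor_norm c \<rho> (partial_poly A \<omega>)) \<le> B" using sums by linarith
qed

lemma expectation_taylor_norm_full:
  assumes A: "A \<subseteq> {..n}" and c: "0 \<le> c" "c < 1"
  shows "integrable M (\<lambda>\<omega>. taylor_norm c ((1 - c) / 5) (partial_poly A \<omega>))"
    and "expectation (\<lambda>\<omega>. taylor_norm c ((1 - c) / 5) (partial_poly A \<omega>)) \<le> 5 / 3 / sqrt (1 - c)"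
proof -
  define u where "u = 1 - c"
  have u: "u > 0" using c by (simp add: u_def)
  define v where "v j = 2 ^ j / (u ^ j * sqrt u)" for j
  have v2: "(v j)\<^sup>2 = 4 ^ j / u ^ (2 * j + 1)" for j
  proof -
    have "(u ^ j * sqrt u)\<^sup>2 = u ^ (2 * j + 1)"
      using u by (simp add: power_mult_distrib power2_eq_square power_add mult_2)
    moreover have "(2 ^ j)\<^sup>2 = (4 ^ j :: real)" by (simp add: power2_eq_square flip: power_mult_distrib)
    ultimately show ?thesis by (simp add: v_def power_divide)
  qed
  have "(\<Sum>j\<le>n. v j * (u / 5) ^ j) = (\<Sum>j\<le>n. (2 / 5) ^ j) / sqrt u"
    using u by (simp add: v_def power_divide sum_divide_distrib mult.commute)
  also have "\<dots> \<le> (5 / 3) / sqrt u"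
    using geometric_sum_le[of "2/5" n] u by (intro divide_right_mono) auto
  finally have s: "(\<Sum>j\<le>n. v j * (u / 5) ^ j) \<le> 5 / 3 / sqrt u" .
  have "(\<Sum>i\<in>A. (real (i choose j) * c ^ (i - j))\<^sup>2) \<le> v j ^ 2" for j
    using taylor_second_moment[OF c A, of j] by (simp add: v2 u_def)
  moreover have "v j \<ge> 0" for j using u by (simp add: v_def)
  ultimately show "integrable M (\<lambda>\<omega>. taylor_norm c ((1 - c) / 5) (partial_poly A \<omega>))"
    "expectation (\<lambda>\<omega>. taylor_norm c ((1 - c) / 5) (partial_poly A \<omega>)) \<le> 5 / 3 / sqrt (1 - c)"
    using expectation_taylor_norm[OF A, of "(1 - c) / 5" c v] s u unfolding u_def[symmetric] by auto
qed

text \<open>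
  Indices above \<open>B\<close> contribute less than the full sum by a factor of order \<open>((1 - c) * B)^(-1/2)\<close>. This
  polynomial gain is far from the truth but holds without any relation between \<open>B\<close> and the scale.
\<close>
lemma expectation_taylor_norm_high:
  assumes A: "A \<subseteq> {..n}" and B: "B > 0" "\<And>i. i \<in> A \<Longrightarrow> B \<le> real i" and c: "0 \<le> c" "c < 1"
  shows "integrable M (\<lambda>\<omega>. taylor_norm c ((1 - c) / 5) (partial_poly A \<omega>))"
    and "expectation (\<lambda>\<omega>. taylor_norm c ((1 - c) / 5) (partial_poly A \<omega>)) \<le> 5 / ((1 - c) * sqrt B)"
proof -
  define u where "u = 1 - c"
  have u: "u > 0" using c by (simp add: u_def)
  define v where "v j = 4 ^ j / (u ^ Suc j * sqrt B)" for j
  have v2: "4 ^ j * (2 * real j + 1) / B / u ^ (2 * j + 2) \<le> (v j)\<^sup>2" for j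
  proof -
    have "2 * real j + 1 \<le> 4 ^ j" by (induction j) auto
    then have "4 ^ j * (2 * real j + 1) / B / u ^ (2 * j + 2) \<le> 4 ^ j * 4 ^ j / B / u ^ (2 * j + 2)"
      using u B by (intro divide_right_mono mult_left_mono) auto
    also have "\<dots> = (v j)\<^sup>2"
    proof -
      have "(u ^ Suc j * sqrt B)\<^sup>2 = u ^ (2 * j + 2) * B"
        using B by (simp add: power_mult_distrib power2_eq_square power_add mult_2)
      then have "(v j)\<^sup>2 = (4 ^ j)\<^sup>2 / (u ^ (2 * j + 2) * B)"
        unfolding v_def power_divide by simp
      then show ?thesis by (simp add: power2_eq_square mult.commute)
    qed
    finally show ?thesis .
  qed
  have "(\<Sum>j\<le>n. v j * (u / 5) ^ j) = (\<Sum>j\<le>n. (4 / 5) ^ j) / (u * sqrt B)"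
    using u by (simp add: v_def power_divide sum_divide_distrib mult_ac)
  also have "\<dots> \<le> 5 / (u * sqrt B)"
    using geometric_sum_le[of "4/5" n] u B by (intro divide_right_mono) auto
  finally have s: "(\<Sum>j\<le>n. v j * (u / 5) ^ j) \<le> 5 / (u * sqrt B)" .
  have "(\<Sum>i\<in>A. (real (i choose j) * c ^ (i - j))\<^sup>2) \<le> v j ^ 2" for j
    using taylor_second_moment_high[OF c A B, of j] v2[of j] by (simp add: u_def)
  moreover have "v j \<ge> 0" for j using u B by (simp add: v_def)
  ultimately show "integrable M (\<lambda>\<omega>. taylor_norm c ((1 - c) / 5) (partial_poly A \<omega>))"
    "expectation (\<lambda>\<omega>. taylor_norm c ((1 - c) / 5) (partial_poly A \<omega>)) \<le> 5 / ((1 - c) * sqrt B)"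
    using expectation_taylor_norm[OF A, of "(1 - c) / 5" c v] s u unfolding u_def[symmetric] by auto
qed

text \<open>
  For indices up to \<open>1 / \<rho>\<close> little is lost by bounding the powers of \<open>c\<close> by 1, which also covers the
  expansion at \<open>c = 1\<close>.
\<close>
lemma expectation_taylor_norm_low:
  assumes A: "A \<subseteq> {..N}" and c: "0 \<le> c" "c \<le> 1" and \<rho>: "\<rho> \<ge> 0"
  shows "integrable M (\<lambda>\<omega>. taylor_norm c \<rho> (partial_poly A \<omega>))"
    and "expectation (\<lambda>\<omega>. taylor_norm c \<rho> (partial_poly A \<omega>)) \<le> sqrt (real N + 1) * exp (\<rho> * real N)"
proof -
  define v where "v j = sqrt (real N + 1) * (real N ^ j / fact j)" for j
  have "(\<Sum>j\<le>N. v j * \<rho> ^ j) = sqrt (real N + 1) * (\<Sum>j\<le>N. (\<rho> * real N) ^ j /\<^sub>R fact j)"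
    by (simp add: v_def sum_distrib_left power_mult_distrib divide_inverse mult_ac)
  also have "\<dots> \<le> sqrt (real N + 1) * exp (\<rho> * real N)"
    unfolding exp_def using \<rho>
    by (intro mult_left_mono sum_le_suminf summable_exp_generic) auto
  finally have s: "(\<Sum>j\<le>N. v j * \<rho> ^ j) \<le> sqrt (real N + 1) * exp (\<rho> * real N)" .
  have "(\<Sum>i\<in>A. (real (i choose j) * c ^ (i - j))\<^sup>2) \<le> v j ^ 2" for j
  proof -
    have "(v j)\<^sup>2 = (real N + 1) * (real N ^ j / fact j)\<^sup>2"
      unfolding v_def power_mult_distrib by simp
    then show ?thesis using taylor_second_moment_low[OF A c, of j] by simp
  qed
  moreover have "v j \<ge> 0" for j by (simp add: v_def)
  ultimately show "integrable M (\<lambda>\<omega>. taylor_norm c \<rho> (partial_poly A \<omega>))"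
    "expectation (\<lambda>\<omega>. taylor_norm c \<rho> (partial_poly A \<omega>)) \<le> sqrt (real N + 1) * exp (\<rho> * real N)"
    using expectation_taylor_norm[OF A \<rho>, of c v] s by auto
qed

text \<open>
  The core alone makes the variance at least a constant times \<open>1 / h\<close>.
\<close>
lemma core_small_ball:
  assumes h: "0 < h" "h \<le> 1 / 4" and A: "finite A" "core h \<subseteq> A" and x: "1 - h \<le> x" "x \<le> 1" and R: "R \<ge> 1 / s"
  shows "prob {\<omega> \<in> space M. \<bar>poly (partial_poly A \<omega>) x\<bar> \<le> R} \<le> 250 * R * sqrt h"
proof -
  have R0: "R > 0" using R s_pos by (smt (verit) divide_pos_pos)
  have x0: "0 < x" using x h by linarith
  define V where "V = exp (- 4) / (4 * h)"
  have card: "real (card (core h)) \<ge> 1 / (4 * h)"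
  proof -
    define a where "a = nat \<lceil>1 / (2 * h)\<rceil>"
    define b where "b = nat \<lfloor>1 / h\<rfloor>"
    have ab: "real (nat \<lceil>y\<rceil>) \<ge> y \<and> real (nat \<lceil>y\<rceil>) < y + 1"
      "real (nat \<lfloor>y\<rfloor>) \<le> y \<and> real (nat \<lfloor>y\<rfloor>) > y - 1" if "y > 0" for y :: real
      using that ceiling_correct[of y] floor_correct[of y] by linarith+
    have a: "real a \<ge> 1 / (2 * h)" "real a < 1 / (2 * h) + 1"
      using ab(1)[of "1 / (2 * h)"] h unfolding a_def by auto
    have b: "real b \<le> 1 / h" "real b > 1 / h - 1"
      using ab(2)[of "1 / h"] h unfolding b_def by auto
    have sub: "{a..b} \<subseteq> core h"
    proof
      fix i assume "i \<in> {a..b}"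
      then have "1 / (2 * h) \<le> real i" "real i \<le> 1 / h" using a b by (auto intro: order.trans)
      then show "i \<in> core h" using h by (simp add: core_def field_simps)
    qed
    have "1 / (4 * h) \<le> 1 / (2 * h) - 1" using h by (simp add: field_simps)
    also have "\<dots> \<le> real b + 1 - real a" using a b h by (simp add: field_simps)
    also have "\<dots> \<le> real (card {a..b})" by simp
    also have "\<dots> \<le> real (card (core h))" using card_mono[OF finite_subset[OF A(2,1)] sub] by simp
    finally show ?thesis .
  qed
  have "V = (1 / (4 * h)) * exp (- 4)" by (simp add: V_def)
  also have "\<dots> \<le> real (card (core h)) * exp (- 4)" using card by (intro mult_right_mono) auto
  also have "\<dots> = (\<Sum>i\<in>core h. exp (- 4))" by simp
  also have "\<dots> \<le> (\<Sum>i\<in>core h. (x ^ i)\<^sup>2)"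
  proof (rule sum_mono)
    fix i assume i: "i \<in> core h"
    have "exp (- (2 * h)) \<le> 1 - h"
    proof -
      have "0 \<le> h * (1 - 2 * h)" using h by simp
      then have "1 \<le> (1 + 2 * h) * (1 - h)" by (simp add: algebra_simps)
      also have "\<dots> \<le> exp (2 * h) * (1 - h)" using h by (intro mult_right_mono exp_ge_add_one_self) auto
      finally show ?thesis by (simp add: exp_minus field_simps)
    qed
    also have "\<dots> \<le> x" by (rule x)
    finally have "exp (- (2 * h)) ^ (2 * i) \<le> x ^ (2 * i)" by (intro power_mono) auto
    moreover have "exp (- (2 * h)) ^ (2 * i) = exp (- 4 * (real i * h))"
      by (subst exp_of_nat_mult[symmetric]) (simp add: mult_ac)
    moreover have "exp (- 4) \<le> exp (- 4 * (real i * h))" using i by (simp add: core_def)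
    moreover have "x ^ (2 * i) = (x ^ i)\<^sup>2" by (metis power_mult mult.commute)
    ultimately show "exp (- 4) \<le> (x ^ i)\<^sup>2" by linarith
  qed
  also have "\<dots> \<le> (\<Sum>i\<in>A. (x ^ i)\<^sup>2)" using A by (intro sum_mono2) auto
  finally have V: "(\<Sum>i\<in>A. (x ^ i)\<^sup>2) \<ge> V" .
  have V0: "V > 0" using h by (simp add: V_def)
  have "prob {\<omega> \<in> space M. \<bar>\<Sum>i\<in>A. \<xi> i \<omega> * x ^ i\<bar> \<le> R} \<le> 16 * R / sqrt V"
    by (rule small_ball[OF A(1) _ V V0 R]) (use x x0 in \<open>auto simp: power_le_one\<close>)
  also have "sqrt V = exp (- 2) / (2 * sqrt h)"
  proof -
    have "exp (- 4) = (exp (- 2 :: real))\<^sup>2" by (simp add: power2_eq_square flip: exp_add)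
    then show ?thesis unfolding V_def by (simp add: real_sqrt_divide real_sqrt_mult)
  qed
  also have "16 * R / (exp (- 2) / (2 * sqrt h)) = 32 * exp 2 * (R * sqrt h)" using h by (simp add: exp_minus field_simps)
  also have "\<dots> \<le> 250 * (R * sqrt h)"
  proof (intro mult_right_mono)
    have "exp (2::real) = (exp 1)\<^sup>2" by (simp add: power2_eq_square flip: exp_add)
    also have "\<dots> \<le> (272/100)\<^sup>2" using e_less_272 by (intro power_mono) auto
    finally show "32 * exp 2 \<le> (250::real)" by (simp add: power2_eq_square)
  qed (use R0 h in auto)
  finally show ?thesis by (simp add: partial_poly_def poly_coeff_poly mult.assoc)
qed

end

section \<open>Roots at a single scale\<close>

context tame_coeffs
begin

abbreviation scale_norm :: "real \<Rightarrow> nat set \<Rightarrow> 'a \<Rightarrow> real" where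
  "scale_norm h A \<omega> \<equiv> taylor_norm (mid h) (3 * (h / 16)) (partial_poly A \<omega>)"

lemma expectation_scale_norm:
  assumes A: "A \<subseteq> {..n}" and h: "0 < h" "h \<le> 1"
  shows "integrable M (scale_norm h A)" "expectation (scale_norm h A) \<le> 2 / sqrt h"
proof -
  have c: "0 \<le> mid h" "mid h < 1" using h by auto
  have eq: "(1 - mid h) / 5 = 3 * (h / 16)" by simp
  show "integrable M (scale_norm h A)"
    using expectation_taylor_norm_full(1)[OF A c] unfolding eq by simp
  have "expectation (scale_norm h A) \<le> 5 / 3 / sqrt (15 / 16 * h)"
    using expectation_taylor_norm_full(2)[OF A c] unfolding eq by simp
  also have "\<dots> = 5 / 3 / sqrt (15 / 16) / sqrt h" by (simp only: real_sqrt_mult divide_divide_eq_left)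
  also have "\<dots> \<le> 2 / sqrt h"
  proof (rule divide_right_mono)
    have "5 / 6 \<le> sqrt (15 / 16)" by (rule real_le_rsqrt) (simp add: power2_eq_square)
    then show "5 / 3 / sqrt (15 / 16) \<le> (2::real)" by (simp add: divide_le_eq)
  qed (use h in simp)
  finally show "expectation (scale_norm h A) \<le> 2 / sqrt h" .
qed

lemma prob_scale_norm:
  assumes A: "A \<subseteq> {..n}" and h: "0 < h" "h \<le> 1" and a: "a > 0"
  shows "prob {\<omega> \<in> space M. a / sqrt h \<le> scale_norm h A \<omega>} \<le> 2 / a"
proof -
  have "prob {\<omega> \<in> space M. a / sqrt h \<le> scale_norm h A \<omega>} \<le> (2 / sqrt h) / (a / sqrt h)"
    using expectation_scale_norm[OF A h] h a
    by (intro prob_gt_le_expectation taylor_norm_nonneg) auto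
  then show ?thesis using h by simp
qed

lemma measurable_nroots_ge:
  assumes "sigma_compact T"
  shows "{\<omega> \<in> space M. k \<le> nroots T (partial_poly A \<omega>)} \<in> events"
proof -
  note [measurable] = measurable_nroots_partial_poly[OF assms, of A]
  have "{\<omega> \<in> space M. real k \<le> real (nroots T (partial_poly A \<omega>))} \<in> events"
    by measurable
  then show ?thesis by simp
qed

text \<open>
  If there are \<open>t\<close> roots, then the norm is at least \<open>a\<close> or the value at the centre is at most \<open>a / 2^t\<close>.
  In the applications \<open>a\<close> exceeds the mean of the norm by a factor growing with \<open>t\<close> that is slower than
  \<open>2^t\<close>.
\<close>
lemma prob_nroots_ge_le:
  assumes A: "finite A" and T: "T \<subseteq> {c - l..c + l}" "l > 0" and ab: "a \<le> b * 2 ^ t"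
  shows "prob {\<omega> \<in> space M. t \<le> nroots T (partial_poly A \<omega>)}
    \<le> prob {\<omega> \<in> space M. a \<le> taylor_norm c (3 * l) (partial_poly A \<omega>)} + prob {\<omega> \<in> space M. \<bar>poly (partial_poly A \<omega>) c\<bar> \<le> b}"
proof -
  define E1 where "E1 = {\<omega> \<in> space M. a \<le> taylor_norm c (3 * l) (partial_poly A \<omega>)}"
  define E2 where "E2 = {\<omega> \<in> space M. \<bar>poly (partial_poly A \<omega>) c\<bar> \<le> b}"
  have m: "E1 \<in> events" "E2 \<in> events" unfolding E1_def E2_def using A by measurable
  have "{\<omega> \<in> space M. t \<le> nroots T (partial_poly A \<omega>)} \<subseteq> E1 \<union> E2"
  proof
    fix \<omega> assume \<omega>: "\<omega> \<in> {\<omega> \<in> space M. t \<le> nroots T (partial_poly A \<omega>)}"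
    have "\<bar>poly (partial_poly A \<omega>) c\<bar> * 2 ^ t \<le> \<bar>poly (partial_poly A \<omega>) c\<bar> * 2 ^ nroots T (partial_poly A \<omega>)"
      using \<omega> by (intro mult_left_mono power_increasing) auto
    also have "\<dots> \<le> taylor_norm c (3 * l) (partial_poly A \<omega>)" by (rule nroots_le_taylor_norm[OF T])
    finally have *: "\<bar>poly (partial_poly A \<omega>) c\<bar> * 2 ^ t \<le> taylor_norm c (3 * l) (partial_poly A \<omega>)" .
    show "\<omega> \<in> E1 \<union> E2"
    proof (cases "a \<le> taylor_norm c (3 * l) (partial_poly A \<omega>)")
      case False
      then have "\<bar>poly (partial_poly A \<omega>) c\<bar> * 2 ^ t \<le> b * 2 ^ t" using * ab by linarith
      then have "\<bar>poly (partial_poly A \<omega>) c\<bar> \<le> b" by (rule mult_right_le_imp_le) simp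
      then show ?thesis using \<omega> by (simp add: E2_def)
    qed (use \<omega> in \<open>simp add: E1_def\<close>)
  qed
  then have "prob {\<omega> \<in> space M. t \<le> nroots T (partial_poly A \<omega>)} \<le> prob (E1 \<union> E2)"
    using m by (intro finite_measure_mono) auto
  also have "\<dots> \<le> prob E1 + prob E2" by (rule measure_Un_le[OF m])
  finally show ?thesis unfolding E1_def E2_def .
qed

text \<open>
  The condition on \<open>t\<close> expresses that the small ball estimate does not reach below the constant level
  \<open>1 / s\<close>.
\<close>
lemma nroots_tail:
  assumes A: "A \<subseteq> {..n}" "core h \<subseteq> A" and h: "0 < h" "h \<le> 1 / 4" and t: "sqrt h / s \<le> (3 / 4) ^ t"
  shows "prob {\<omega> \<in> space M. t \<le> nroots (scale_interval h) (partial_poly A \<omega>)} \<le> 260 * (3 / 4) ^ t"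
proof -
  note fA = finite_of_le[OF A(1)]
  have "prob {\<omega> \<in> space M. t \<le> nroots (scale_interval h) (partial_poly A \<omega>)}
    \<le> prob {\<omega> \<in> space M. (3 / 2) ^ t / sqrt h \<le> scale_norm h A \<omega>}
      + prob {\<omega> \<in> space M. \<bar>poly (partial_poly A \<omega>) (mid h)\<bar> \<le> (3 / 4) ^ t / sqrt h}"
  proof (rule prob_nroots_ge_le[OF fA scale_interval_subset])
    show "(3 / 2) ^ t / sqrt h \<le> (3 / 4) ^ t / sqrt h * 2 ^ t" by (simp flip: power_mult_distrib)
  qed (use h in simp)
  also have "prob {\<omega> \<in> space M. (3 / 2) ^ t / sqrt h \<le> scale_norm h A \<omega>} \<le> 2 / (3 / 2) ^ t"
    using h by (intro prob_scale_norm[OF A(1)]) auto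
  also have "2 / (3 / 2) ^ t = 2 * (2 / 3 :: real) ^ t" by (simp add: power_divide)
  also have "\<dots> \<le> 2 * (3 / 4) ^ t" by (intro mult_left_mono power_mono) auto
  also have "prob {\<omega> \<in> space M. \<bar>poly (partial_poly A \<omega>) (mid h)\<bar> \<le> (3 / 4) ^ t / sqrt h} \<le> 250 * ((3 / 4) ^ t / sqrt h) * sqrt h"
    using h t s_pos by (intro core_small_ball[OF h fA A(2)]) (auto simp: field_simps)
  also have "250 * ((3 / 4) ^ t / sqrt h) * sqrt h = 250 * (3 / 4) ^ t" using h by simp
  finally have "prob {\<omega> \<in> space M. t \<le> nroots (scale_interval h) (partial_poly A \<omega>)} \<le> 252 * (3 / 4) ^ t" by simp
  moreover have "0 \<le> (3 / 4 :: real) ^ t" by simp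
  ultimately show ?thesis by linarith
qed

text \<open>
  For scales at which the polynomial may be very small with substantial probability, so that only the
  geometric small ball estimate is available.
\<close>
lemma nroots_small_scale:
  assumes h: "0 < h" "h \<le> 1" and y: "0 < y" and T: "\<And>j. j < T \<Longrightarrow> d * j \<le> n"
    and d: "mid h ^ d \<le> s / 256" and t: "1 / (y * sqrt h) \<le> 2 ^ t * (mid h ^ d) ^ T"
  shows "prob {\<omega> \<in> space M. t \<le> nroots (scale_interval h) (partial_poly {..n} \<omega>)} \<le> 2 * y + (1 - s\<^sup>2 / 128) ^ T"
proof -
  have "prob {\<omega> \<in> space M. t \<le> nroots (scale_interval h) (partial_poly {..n} \<omega>)}
    \<le> prob {\<omega> \<in> space M. (1 / y) / sqrt h \<le> scale_norm h {..n} \<omega>}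
      + prob {\<omega> \<in> space M. \<bar>poly (partial_poly {..n} \<omega>) (mid h)\<bar> \<le> (mid h ^ d) ^ T}"
  proof (rule prob_nroots_ge_le[OF _ scale_interval_subset])
    have "1 / y / sqrt h = 1 / (y * sqrt h)" by simp
    also note t
    finally show "1 / y / sqrt h \<le> (mid h ^ d) ^ T * 2 ^ t" by (simp only: mult.commute)
  qed (use h in auto)
  moreover have "prob {\<omega> \<in> space M. (1 / y) / sqrt h \<le> scale_norm h {..n} \<omega>} \<le> 2 * y"
    using prob_scale_norm[of "{..n}" n h "1 / y"] h y by simp
  moreover have "prob {\<omega> \<in> space M. \<bar>\<Sum>i\<in>{..n}. \<xi> i \<omega> * mid h ^ i\<bar> \<le> (mid h ^ d) ^ T} \<le> (1 - s\<^sup>2 / 128) ^ T"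
    using h d T by (intro geometric_small_ball) auto
  ultimately show ?thesis unfolding partial_poly_def poly_coeff_poly by linarith
qed

text \<open>
  Near the end point 1 all indices up to \<open>n\<close> count equally, and the Taylor expansion is made at 1 itself.
\<close>
lemma nroots_last_scale:
  assumes h: "0 < h" "real n * h \<le> 8 / 7" and t: "1 / (s * sqrt (real n + 1)) \<le> (3 / 4) ^ t"
  shows "prob {\<omega> \<in> space M. t \<le> nroots {1 - h..1} (partial_poly {..n} \<omega>)} \<le> 100 * (3 / 4) ^ t"
proof -
  define \<sigma> where "\<sigma> = sqrt (real n + 1)"
  have \<sigma>: "\<sigma> > 0" by (simp add: \<sigma>_def)
  define nrm where "nrm \<omega> = taylor_norm 1 (3 * h) (partial_poly {..n} \<omega>)" for \<omega>
  have "prob {\<omega> \<in> space M. t \<le> nroots {1 - h..1} (partial_poly {..n} \<omega>)}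
    \<le> prob {\<omega> \<in> space M. (3 / 2) ^ t * \<sigma> \<le> nrm \<omega>} + prob {\<omega> \<in> space M. \<bar>poly (partial_poly {..n} \<omega>) 1\<bar> \<le> (3 / 4) ^ t * \<sigma>}"
    unfolding nrm_def
  proof (rule prob_nroots_ge_le)
    have pow: "(3 / 2 :: real) ^ t = (3 / 4) ^ t * 2 ^ t" by (simp flip: power_mult_distrib)
    show "(3 / 2) ^ t * \<sigma> \<le> (3 / 4) ^ t * \<sigma> * 2 ^ t" unfolding pow by (simp only: mult_ac order.refl)
  qed (use h in auto)
  moreover have "prob {\<omega> \<in> space M. (3 / 2) ^ t * \<sigma> \<le> nrm \<omega>} \<le> 81 * (3 / 4) ^ t"
  proof -
    have "integrable M nrm" "expectation nrm \<le> \<sigma> * exp (3 * h * real n)"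
      using expectation_taylor_norm_low[of "{..n}" n 1 "3 * h"] h unfolding nrm_def \<sigma>_def by auto
    moreover have "exp (3 * h * real n) \<le> 81"
    proof -
      have "exp (3 * h * real n) \<le> exp 4" using h by (simp add: mult_ac)
      also have "exp 4 = exp (1::real) ^ 4" by (simp flip: exp_of_nat_mult)
      also have "\<dots> \<le> 3 ^ 4" using exp_le by (intro power_mono) auto
      finally show ?thesis by simp
    qed
    ultimately have "integrable M nrm" "expectation nrm \<le> \<sigma> * 81"
      using \<sigma> by (auto intro: order.trans mult_left_mono)
    moreover have "0 \<le> nrm \<omega>" for \<omega> unfolding nrm_def using h by (intro taylor_norm_nonneg) simp
    ultimately have "prob {\<omega> \<in> space M. (3 / 2) ^ t * \<sigma> \<le> nrm \<omega>} \<le> (\<sigma> * 81) / ((3 / 2) ^ t * \<sigma>)"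
      using \<sigma> by (intro prob_gt_le_expectation) auto
    also have "\<dots> = 81 * (2 / 3) ^ t" using \<sigma> by (simp add: power_divide)
    also have "\<dots> \<le> 81 * (3 / 4) ^ t" by (intro mult_left_mono power_mono) auto
    finally show ?thesis .
  qed
  moreover have "prob {\<omega> \<in> space M. \<bar>poly (partial_poly {..n} \<omega>) 1\<bar> \<le> (3 / 4) ^ t * \<sigma>} \<le> 16 * (3 / 4) ^ t"
  proof -
    have "1 / (s * \<sigma>) \<le> (3 / 4) ^ t" using t by (simp add: \<sigma>_def)
    from mult_right_mono[OF this, of \<sigma>] have "1 / s \<le> (3 / 4) ^ t * \<sigma>" using \<sigma> by simp
    then have "prob {\<omega> \<in> space M. \<bar>\<Sum>i\<in>{..n}. \<xi> i \<omega> * 1\<bar> \<le> (3 / 4) ^ t * \<sigma>} \<le> 16 * ((3 / 4) ^ t * \<sigma>) / sqrt (real n + 1)"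
      by (intro small_ball) auto
    then show ?thesis using \<sigma> by (simp add: partial_poly_def poly_coeff_poly \<sigma>_def[symmetric])
  qed
  moreover have "0 \<le> (3 / 4 :: real) ^ t" by simp
  ultimately show ?thesis by linarith
qed

text \<open>
  The low indices have too small a variance, the high ones are damped; \<open>Q\<close> is the square root of the
  window parameter because the gain in the norm is the square root of the gain in the variance.
\<close>
lemma expectation_removed_norm:
  assumes h: "0 < h" "h \<le> Q\<^sup>2" and Q: "0 < Q" "Q\<^sup>2 \<le> 1 / 4"
  shows "integrable M (scale_norm h ({..n} - window n (Q\<^sup>2) h))"
    and "expectation (scale_norm h ({..n} - window n (Q\<^sup>2) h)) \<le> 8 * Q / sqrt h"
proof -
  define L where "L = {i \<in> {..n}. real i * h < Q\<^sup>2}"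
  define H where "H = {i \<in> {..n}. 1 / Q\<^sup>2 < real i * h}"
  define N where "N = nat \<lfloor>Q\<^sup>2 / h\<rfloor>"
  have N: "real N \<le> Q\<^sup>2 / h" using h Q by (simp add: N_def)
  have LN: "L \<subseteq> {..N}"
  proof
    fix i assume "i \<in> L"
    then have "real i \<le> Q\<^sup>2 / h" using h by (simp add: L_def field_simps)
    then show "i \<in> {..N}" by (simp add: N_def le_nat_iff le_floor_iff)
  qed
  have Ln: "L \<subseteq> {..n}" and Hn: "H \<subseteq> {..n}" by (auto simp: L_def H_def)
  have "1 / Q\<^sup>2 \<ge> 1" using Q by simp
  then have "i \<notin> H" if "i \<in> L" for i
    using Q that unfolding L_def H_def mem_Collect_eq by linarith
  then have disj: "L \<inter> H = {}" by auto
  have eq: "{..n} - window n (Q\<^sup>2) h = L \<union> H" by (auto simp: window_def L_def H_def)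
  have c: "0 \<le> mid h" "mid h < 1" using h Q by auto
  have \<rho>: "(1 - mid h) / 5 = 3 * (h / 16)" by simp
  have iL: "integrable M (scale_norm h L)" and eL: "expectation (scale_norm h L) \<le> 2 * Q / sqrt h"
  proof -
    have hN: "3 * (h / 16) * real N \<le> 1 / 4"
    proof -
      have "h * real N \<le> Q\<^sup>2" using N h by (simp add: field_simps)
      then show ?thesis using Q by simp
    qed
    show "integrable M (scale_norm h L)" using expectation_taylor_norm_low(1)[OF LN, of "mid h" "3 * (h / 16)"] c h by auto
    have "expectation (scale_norm h L) \<le> sqrt (real N + 1) * exp (3 * (h / 16) * real N)"
      using expectation_taylor_norm_low(2)[OF LN, of "mid h" "3 * (h / 16)"] c h by auto
    also have "\<dots> \<le> sqrt (2 * (Q\<^sup>2 / h)) * (4 / 3)"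
    proof (intro mult_mono)
      have "1 \<le> Q\<^sup>2 / h" using h by simp
      then show "sqrt (real N + 1) \<le> sqrt (2 * (Q\<^sup>2 / h))" using N by simp
      have "exp (3 * (h / 16) * real N) \<le> exp (1 / 4)" using hN by simp
      also have "\<dots> \<le> 4 / 3"
      proof -
        have "3 / 4 \<le> exp (- 1 / 4 :: real)" using exp_ge_add_one_self[of "-1/4::real"] by simp
        then have "3 / 4 * exp (1/4) \<le> exp (- 1 / 4) * exp (1 / 4 :: real)" by (intro mult_right_mono) auto
        then show ?thesis by (simp flip: exp_add)
      qed
      finally show "exp (3 * (h / 16) * real N) \<le> 4 / 3" .
    qed (use h Q in auto)
    also have "\<dots> = (sqrt 2 * 4 / 3) * (Q / sqrt h)" using Q by (simp add: real_sqrt_mult real_sqrt_divide)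
    also have "\<dots> \<le> 2 * (Q / sqrt h)"
    proof (rule mult_right_mono)
      have "sqrt 2 \<le> 3 / 2" by (rule real_le_lsqrt) (auto simp: power2_eq_square)
      then show "sqrt 2 * 4 / 3 \<le> 2" by simp
    qed (use h Q in auto)
    finally show "expectation (scale_norm h L) \<le> 2 * Q / sqrt h" by simp
  qed
  have iH: "integrable M (scale_norm h H)" and eH: "expectation (scale_norm h H) \<le> 16 / 3 * Q / sqrt h"
  proof -
    have B: "0 < 1 / (Q\<^sup>2 * h)" "\<And>i. i \<in> H \<Longrightarrow> 1 / (Q\<^sup>2 * h) \<le> real i"
      using h Q by (auto simp: H_def field_simps)
    show "integrable M (scale_norm h H)" using expectation_taylor_norm_high(1)[OF Hn B c] unfolding \<rho> .
    have "expectation (scale_norm h H) \<le> 5 / ((1 - mid h) * sqrt (1 / (Q\<^sup>2 * h)))"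
      using expectation_taylor_norm_high(2)[OF Hn B c] unfolding \<rho> .
    also have "sqrt (1 / (Q\<^sup>2 * h)) = 1 / (Q * sqrt h)" using Q by (simp add: real_sqrt_divide real_sqrt_mult)
    also have "5 / ((1 - mid h) * (1 / (Q * sqrt h))) = 16 / 3 * Q * (sqrt h / h)" using h Q by (simp add: field_simps)
    also have "sqrt h / h = 1 / sqrt h" using h by (simp add: real_div_sqrt field_simps)
    finally show "expectation (scale_norm h H) \<le> 16 / 3 * Q / sqrt h" by simp
  qed
  have i: "integrable M (scale_norm h ({..n} - window n (Q\<^sup>2) h))"
    using expectation_scale_norm(1)[of "{..n} - window n (Q\<^sup>2) h" n h] h Q by auto
  then show "integrable M (scale_norm h ({..n} - window n (Q\<^sup>2) h))" .
  have le: "scale_norm h (L \<union> H) \<omega> \<le> scale_norm h L \<omega> + scale_norm h H \<omega>" for \<omega>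
  proof -
    have "partial_poly (L \<union> H) \<omega> = partial_poly L \<omega> + partial_poly H \<omega>" unfolding partial_poly_def
      using disj finite_of_le[OF Ln] finite_of_le[OF Hn] by (intro coeff_poly_union) auto
    then show ?thesis using taylor_norm_add[of "3 * (h / 16)"] h by simp
  qed
  have "expectation (scale_norm h (L \<union> H)) \<le> expectation (\<lambda>\<omega>. scale_norm h L \<omega> + scale_norm h H \<omega>)"
    using i le iL iH unfolding eq by (intro integral_mono) auto
  also have "\<dots> = expectation (scale_norm h L) + expectation (scale_norm h H)" using iL iH by simp
  also have "\<dots> \<le> 22 / 3 * (Q / sqrt h)" using eL eH by simp
  also have "\<dots> \<le> 8 * (Q / sqrt h)" using Q h by (intro mult_right_mono) auto
  finally show "expectation (scale_norm h ({..n} - window n (Q\<^sup>2) h)) \<le> 8 * Q / sqrt h" unfolding eq by simp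
qed

text \<open>
  In units of the typical size \<open>1 / sqrt h\<close>, the hypotheses of \<open>nroots_stable\<close> are checked with the
  threshold \<open>y^4\<close> for the value, the relative spacing \<open>y\<^sup>2\<close> of the net and the bound \<open>1 / y\<close> for the
  norm. The window parameter \<open>y^12\<close> makes the perturbation of size \<open>y^6\<close>, well below \<open>y^4\<close>. Each of
  about \<open>y^(-2)\<close> net points fails with probability of order \<open>y^3\<close>, which leaves a total of order \<open>y\<close>.
\<close>
lemma nroots_window_eq:
  assumes y: "0 < y" "y ^ 12 \<le> 1 / 4" "y ^ 3 \<le> s" and h: "0 < h" "h \<le> y ^ 12" "1 \<le> real n * h"
  shows "prob {\<omega> \<in> space M. nroots (scale_interval h) (partial_poly {..n} \<omega>) \<noteq> nroots (scale_interval h) (partial_poly (window n (y ^ 12) h) \<omega>)} \<le> 6000 * y"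
proof -
  define \<Theta> where "\<Theta> = 1 / sqrt h"
  define l where "l = h / 16"
  define r where "r = y\<^sup>2"
  define N where "N = nat \<lceil>1 / r\<rceil>"
  define W where "W = window n (y ^ 12) h"
  define x where "x t = mid h - l + 2 * l * real t / real N" for t :: nat
  have T: "\<Theta> > 0" and l: "l > 0" and r: "r > 0" using h y by (auto simp: \<Theta>_def l_def r_def)
  have y1: "y < 1"
  proof (rule ccontr)
    assume "\<not> y < 1"
    then have "1 \<le> y ^ 12" by (intro one_le_power) auto
    then show False using y by simp
  qed
  have r1: "r \<le> 1" unfolding r_def using y y1 by (intro power_le_one) auto
  have h4: "h \<le> 1 / 4" using h y by linarith
  have N: "real N * r \<ge> 1" "real N + 1 \<le> 3 / r"
  proof -
    have "real N \<ge> 1 / r" using r by (simp add: N_def of_nat_ceiling)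
    then show "real N * r \<ge> 1" using r by (simp add: field_simps)
    have "real N \<le> 1 / r + 1" unfolding N_def using r by (simp add: of_nat_ceiling)
    moreover have "1 \<le> 1 / r" using r r1 by simp
    ultimately show "real N + 1 \<le> 3 / r" by (simp add: field_simps)
  qed
  have N0: "N > 0" using N by (cases N) auto
  have xI: "1 - h \<le> x t" "x t \<le> 1" if "t \<le> N" for t
  proof -
    have "real t / real N \<le> 1" using that N0 by simp
    then have "2 * l * (real t / real N) \<le> 2 * l * 1" using l by (intro mult_left_mono) auto
    moreover have "0 \<le> 2 * l * real t / real N" using l by simp
    ultimately show "1 - h \<le> x t" "x t \<le> 1" using h by (auto simp: x_def l_def)
  qed
  have core: "core h \<subseteq> {..n}" using core_subset_window[of "1/2" h n] h by (auto simp: window_def)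
  \<comment> \<open>A large norm, a small value on the net, a large perturbation.\<close>
  define E1 where "E1 = {\<omega> \<in> space M. (1 / y) / sqrt h \<le> scale_norm h {..n} \<omega>}"
  define E2 where "E2 = (\<Union>t\<in>{..N}. {\<omega> \<in> space M. \<bar>poly (partial_poly {..n} \<omega>) (x t)\<bar> \<le> 7 * y ^ 3 * \<Theta>})"
  define E3 where "E3 = {\<omega> \<in> space M. y ^ 4 * \<Theta> / 2 \<le> scale_norm h ({..n} - W) \<omega>}"
  have m: "E1 \<in> events" "E2 \<in> events" "E3 \<in> events" unfolding E1_def E2_def E3_def by measurable
  have p1: "prob E1 \<le> 2 * y"
    using prob_scale_norm[of "{..n}" n h "1 / y"] h h4 y by (simp add: E1_def)
  have p2: "prob E2 \<le> 5250 * y"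
  proof -
    have "prob E2 \<le> (\<Sum>t\<in>{..N}. prob {\<omega> \<in> space M. \<bar>poly (partial_poly {..n} \<omega>) (x t)\<bar> \<le> 7 * y ^ 3 * \<Theta>})"
      unfolding E2_def by (intro finite_measure_subadditive_finite) auto
    also have "\<dots> \<le> (\<Sum>t\<in>{..N}. 250 * (7 * y ^ 3 * \<Theta>) * sqrt h)"
    proof (intro sum_mono core_small_ball core xI)
      have "sqrt h \<le> sqrt (y ^ 12)" using h by simp
      also have "sqrt (y ^ 12) = y ^ 6" using y by (intro real_sqrt_unique) (auto simp flip: power_mult)
      finally have "1 / y ^ 6 \<le> \<Theta>" unfolding \<Theta>_def using h y by (intro divide_left_mono) auto
      then have "y ^ 3 * (1 / y ^ 6) \<le> y ^ 3 * \<Theta>" using y by (intro mult_left_mono) auto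
      moreover have "y ^ 3 * (1 / y ^ 6) = 1 / y ^ 3" using y by (simp add: field_simps flip: power_add)
      moreover have "1 / s \<le> 1 / y ^ 3" using y s_pos by (intro divide_left_mono) auto
      moreover have "0 \<le> y ^ 3 * \<Theta>" using y T by simp
      ultimately show "1 / s \<le> 7 * y ^ 3 * \<Theta>" by linarith
    qed (use h h4 in auto)
    also have "\<dots> = (real N + 1) * (1750 * y ^ 3)" using h by (simp add: \<Theta>_def)
    also have "\<dots> \<le> (3 / r) * (1750 * y ^ 3)" using N y by (intro mult_right_mono) auto
    also have "\<dots> = 5250 * y" using y by (simp add: r_def power2_eq_square power3_eq_cube)
    finally show ?thesis .
  qed
  have p3: "prob E3 \<le> 16 * y"
  proof -
    have W: "W = window n ((y ^ 6)\<^sup>2) h" by (simp add: W_def flip: power_mult)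
    have y12: "(y ^ 6)\<^sup>2 = y ^ 12" by (simp flip: power_mult)
    have "prob E3 \<le> (8 * y ^ 6 / sqrt h) / (y ^ 4 * \<Theta> / 2)" unfolding E3_def
      using expectation_removed_norm[of h "y ^ 6" n] h y T unfolding W y12
      by (intro prob_gt_le_expectation taylor_norm_nonneg) auto
    also have "\<dots> = 16 * y\<^sup>2" using h y by (simp add: \<Theta>_def field_simps flip: power_add)
    also have "\<dots> \<le> 16 * y" using y y1 by (simp add: power2_eq_square mult_left_le)
    finally show ?thesis .
  qed
  have "{\<omega> \<in> space M. nroots (scale_interval h) (partial_poly {..n} \<omega>) \<noteq> nroots (scale_interval h) (partial_poly W \<omega>)} \<subseteq> E1 \<union> E2 \<union> E3"
  proof (rule ccontr)
    assume "\<not> ?thesis"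
    then obtain \<omega> where \<omega>: "\<omega> \<in> space M" "\<omega> \<notin> E1" "\<omega> \<notin> E2" "\<omega> \<notin> E3"
      and ne: "nroots (scale_interval h) (partial_poly {..n} \<omega>) \<noteq> nroots (scale_interval h) (partial_poly W \<omega>)" by auto
    define p where "p = partial_poly {..n} \<omega>"
    have norm: "taylor_norm (mid h) (3 * l) p \<le> (1 / y) * \<Theta>"
      using \<omega> by (auto simp: E1_def l_def p_def \<Theta>_def)
    have "3 + 4 * (1 / y) \<le> 7 / y" using y y1 by (simp add: field_simps)
    then have "(3 + 4 * (1 / y)) * (r\<^sup>2 * \<Theta>) \<le> 7 / y * (r\<^sup>2 * \<Theta>)" using T by (intro mult_right_mono) auto
    also have "7 / y * (r\<^sup>2 * \<Theta>) = 7 * y ^ 3 * \<Theta>" using y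
      by (simp add: r_def field_simps power2_eq_square power3_eq_cube)
    finally have lam: "(3 + 4 * (1 / y)) * r\<^sup>2 * \<Theta> \<le> 7 * y ^ 3 * \<Theta>" by (simp only: mult.assoc)
    have net: "\<bar>poly p (mid h - l + 2 * l * real t / real N)\<bar> > (3 + 4 * (1 / y)) * r\<^sup>2 * \<Theta>" if "t \<le> N" for t
    proof -
      have "\<not> \<bar>poly p (x t)\<bar> \<le> 7 * y ^ 3 * \<Theta>"
        using \<omega>(1,3) that unfolding E2_def p_def by blast
      then show ?thesis using lam unfolding x_def by linarith
    qed
    have small: "taylor_norm (mid h) (3 * l) (partial_poly ({..n} - W) \<omega>) < r\<^sup>2 * \<Theta> / 2"
      using \<omega> by (auto simp: E3_def l_def r_def)
    have "W \<subseteq> {..n}" by (auto simp: W_def window_def)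
    then have "partial_poly {..n} \<omega> = partial_poly W \<omega> + partial_poly ({..n} - W) \<omega>"
      unfolding partial_poly_def using coeff_poly_union[of W "{..n} - W" "\<lambda>i. \<xi> i \<omega>"] finite_of_le[of W n]
      by (simp add: Un_absorb1)
    then have diff: "p - partial_poly W \<omega> = partial_poly ({..n} - W) \<omega>" by (simp add: p_def)
    have ends: "mid h - l + 2 * l * real 0 / real N = 1 - h" "mid h - l + 2 * l * real N / real N = 1 - 7 / 8 * h"
      using N0 by (auto simp: l_def)
    have big: "r\<^sup>2 * \<Theta> \<le> (3 + 4 * (1 / y)) * r\<^sup>2 * \<Theta>"
    proof -
      have "1 * (r\<^sup>2 * \<Theta>) \<le> (3 + 4 * (1 / y)) * (r\<^sup>2 * \<Theta>)" using y T by (intro mult_right_mono) auto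
      then show ?thesis by (simp add: mult.assoc)
    qed
    have "nroots {1 - h..<1 - 7 / 8 * h} p = nroots {1 - h..<1 - 7 / 8 * h} (partial_poly W \<omega>)"
    proof (rule nroots_stable[where \<eta> = "r\<^sup>2 * \<Theta>" and \<kappa> = "r * \<Theta> / l"])
      show "r * \<Theta> / l < \<bar>poly (pderiv p) z\<bar>" if "1 - h \<le> z" "z \<le> 1 - 7 / 8 * h" "\<bar>poly p z\<bar> \<le> r\<^sup>2 * \<Theta>" for z
      proof (rule no_near_double_root_of_net[OF l r N(1) T norm net _ that(3)])
        show "\<bar>z - mid h\<bar> \<le> l" using that(1,2) unfolding l_def by linarith
      qed
      show "r\<^sup>2 * \<Theta> < \<bar>poly p (1 - h)\<bar>" using net[of 0] big unfolding ends by linarith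
      show "r\<^sup>2 * \<Theta> < \<bar>poly p (1 - 7 / 8 * h)\<bar>" using net[of N] big unfolding ends by linarith
      fix z assume z: "1 - h \<le> z" "z \<le> 1 - 7 / 8 * h"
      then have zl: "\<bar>z - mid h\<bar> \<le> l" unfolding l_def by linarith
      have "\<bar>poly (p - partial_poly W \<omega>) z\<bar> \<le> taylor_norm (mid h) (3 * l) (partial_poly ({..n} - W) \<omega>)"
        unfolding diff by (rule abs_poly_le_taylor_norm[OF zl])
      then show "\<bar>poly p z - poly (partial_poly W \<omega>) z\<bar> < r\<^sup>2 * \<Theta> / 2" using small by simp
      have "\<bar>poly (pderiv (p - partial_poly W \<omega>)) z\<bar> \<le> taylor_norm (mid h) (3 * l) (partial_poly ({..n} - W) \<omega>) / l"
        unfolding diff by (rule abs_pderiv_le_taylor_norm[OF zl l])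
      also have "\<dots> \<le> r * \<Theta> / l"
      proof (rule divide_right_mono)
        have "r\<^sup>2 * \<Theta> / 2 \<le> r * \<Theta>" using r r1 T by (simp add: power2_eq_square mult_left_le)
        then show "taylor_norm (mid h) (3 * l) (partial_poly ({..n} - W) \<omega>) \<le> r * \<Theta>" using small by linarith
      qed (use l in simp)
      finally show "\<bar>poly (pderiv p) z - poly (pderiv (partial_poly W \<omega>)) z\<bar> \<le> r * \<Theta> / l" by (simp add: pderiv_diff)
    qed (use h r T in auto)
    then show False using ne by (simp add: p_def)
  qed
  then have "prob {\<omega> \<in> space M. nroots (scale_interval h) (partial_poly {..n} \<omega>) \<noteq> nroots (scale_interval h) (partial_poly W \<omega>)} \<le> prob (E1 \<union> E2 \<union> E3)"
    using m by (intro finite_measure_mono) auto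
  also have "\<dots> \<le> prob (E1 \<union> E2) + prob E3" using m by (intro measure_Un_le) auto
  also have "\<dots> \<le> prob E1 + prob E2 + prob E3" using measure_Un_le[OF m(1,2)] by simp
  also have "\<dots> \<le> 6000 * y" using p1 p2 p3 y by linarith
  finally show ?thesis by (simp add: W_def)
qed

end

section \<open>Exponential moments\<close>

lemma exp_le_quadratic:
  assumes "0 \<le> (x::real)"
  shows "exp x \<le> 1 + x + x\<^sup>2 * exp x"
proof -
  have "(1 - x) * exp x \<le> exp (- x) * exp x"
    using exp_ge_add_one_self[of "- x"] by (intro mult_right_mono) auto
  then have *: "exp x - 1 \<le> x * exp x" by (simp add: algebra_simps flip: exp_add)
  then have "x * (exp x - 1) \<le> x * (x * exp x)" using assms by (intro mult_left_mono) auto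
  then show ?thesis using * by (simp add: algebra_simps power2_eq_square)
qed

context prob_space
begin

text \<open>
  The exponential tail bounds \<open>expectation (Z\<^sup>2 * exp (Z / 10))\<close> independently of the truncation level
  \<open>D\<close>: \<open>exp (1 / 10) * 3 / 4 \<le> 5 / 6\<close>, and \<open>t\<^sup>2 \<le> 2 * (t + 2 choose 2)\<close> reduces the series to a
  negative binomial sum with value \<open>2 * 6^3 = 432\<close>.
\<close>
lemma exponential_moment_le:
  fixes Z :: "'a \<Rightarrow> nat"
  assumes [measurable]: "(\<lambda>\<omega>. real (Z \<omega>)) \<in> borel_measurable M"
    and ZD: "\<And>\<omega>. Z \<omega> \<le> D"
    and tail: "\<And>t. t \<le> D \<Longrightarrow> prob {\<omega> \<in> space M. t \<le> Z \<omega>} \<le> C * (3 / 4) ^ t" and C: "C \<ge> 0"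
    and l: "0 \<le> l" "l \<le> 1 / 10"
  shows "expectation (\<lambda>\<omega>. exp (l * (real (Z \<omega>) - expectation (\<lambda>\<omega>. real (Z \<omega>))))) \<le> exp (l\<^sup>2 * (432 * C))"
proof -
  define m where "m = expectation (\<lambda>\<omega>. real (Z \<omega>))"
  have iZ: "integrable M (\<lambda>\<omega>. real (Z \<omega>))"
    by (rule integrable_const_bound[where B = "real D"]) (use ZD in auto)
  have ms[measurable]: "{\<omega> \<in> space M. Z \<omega> = t} \<in> events" for t
  proof -
    have "{\<omega> \<in> space M. real (Z \<omega>) = real t} \<in> events" by measurable
    then show ?thesis by simp
  qed
  have mg[measurable]: "{\<omega> \<in> space M. t \<le> Z \<omega>} \<in> events" for t
  proof -
    have "{\<omega> \<in> space M. real t \<le> real (Z \<omega>)} \<in> events" by measurable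
    then show ?thesis by simp
  qed
  \<comment> \<open>The weight that dominates the second-order remainder of the exponential for all admissible \<open>l\<close>.\<close>
  define w where "w t = (real t)\<^sup>2 * exp (real t / 10)" for t
  have e0: "exp (1 / 10) \<le> (10 / 9 :: real)"
  proof -
    have "9 / 10 * exp (1/10) \<le> exp (- 1 / 10) * exp (1 / 10 :: real)"
      using exp_ge_add_one_self[of "-1/10::real"] by (intro mult_right_mono) auto
    then show ?thesis by (simp flip: exp_add)
  qed
  have e: "exp (real t / 10) \<le> (10 / 9) ^ t" for t
  proof -
    have "exp (real t / 10) = exp (1 / 10) ^ t" by (simp flip: exp_of_nat_mult)
    also have "\<dots> \<le> (10 / 9) ^ t" using e0 by (intro power_mono) auto
    finally show ?thesis .
  qed
  have iw: "integrable M (\<lambda>\<omega>. w t * indicat_real {\<omega> \<in> space M. Z \<omega> = t} \<omega>)" for t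
    by (intro integrable_mult_right integrable_indicat) measurable
  have weq: "w (Z \<omega>) = (\<Sum>t\<le>D. w t * indicat_real {\<omega> \<in> space M. Z \<omega> = t} \<omega>)" if "\<omega> \<in> space M" for \<omega>
  proof -
    have "(\<Sum>t\<le>D. w t * indicat_real {\<omega> \<in> space M. Z \<omega> = t} \<omega>) = (\<Sum>t\<le>D. if t = Z \<omega> then w t else 0)"
      using that by (intro sum.cong) (auto simp: indicator_def)
    then show ?thesis using ZD[of \<omega>] by simp
  qed
  have iwZ: "integrable M (\<lambda>\<omega>. w (Z \<omega>))"
    by (subst Bochner_Integration.integrable_cong[OF refl weq], assumption)
       (intro Bochner_Integration.integrable_sum iw)
  have "expectation (\<lambda>\<omega>. w (Z \<omega>)) = (\<Sum>t\<le>D. w t * prob {\<omega> \<in> space M. Z \<omega> = t})"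
  proof -
    have "expectation (\<lambda>\<omega>. w (Z \<omega>)) = expectation (\<lambda>\<omega>. \<Sum>t\<le>D. w t * indicat_real {\<omega> \<in> space M. Z \<omega> = t} \<omega>)"
      by (intro Bochner_Integration.integral_cong refl weq)
    also have "\<dots> = (\<Sum>t\<le>D. expectation (\<lambda>\<omega>. w t * indicat_real {\<omega> \<in> space M. Z \<omega> = t} \<omega>))"
      by (rule Bochner_Integration.integral_sum) (rule iw)
    finally show ?thesis by simp
  qed
  also have "\<dots> \<le> (\<Sum>t\<le>D. C * (2 * (real (t + 2 choose 2) * (5 / 6) ^ t)))"
  proof (rule sum_mono)
    fix t assume t: "t \<in> {..D}"
    have "prob {\<omega> \<in> space M. Z \<omega> = t} \<le> prob {\<omega> \<in> space M. t \<le> Z \<omega>}"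
      by (rule finite_measure_mono) auto
    also have "\<dots> \<le> C * (3 / 4) ^ t" using tail t by simp
    finally have p: "prob {\<omega> \<in> space M. Z \<omega> = t} \<le> C * (3 / 4) ^ t" .
    have "w t \<le> (2 * real (t + 2 choose 2)) * (10 / 9) ^ t"
      unfolding w_def
    proof (intro mult_mono e)
      have "2 * real (t + 2 choose 2) = real ((t + 2) * (t + 1))"
        using choose_two[of "t + 2"] by (simp add: real_of_nat_div)
      also have "\<dots> \<ge> (real t)\<^sup>2" by (simp add: power2_eq_square algebra_simps)
      finally show "(real t)\<^sup>2 \<le> 2 * real (t + 2 choose 2)" .
    qed auto
    then have "w t * prob {\<omega> \<in> space M. Z \<omega> = t} \<le> (2 * real (t + 2 choose 2) * (10 / 9) ^ t) * (C * (3 / 4) ^ t)"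
      using p C by (intro mult_mono) auto
    also have "\<dots> = C * (2 * (real (t + 2 choose 2) * ((10 / 9) ^ t * (3 / 4) ^ t)))" by simp
    also have "(10 / 9) ^ t * (3 / 4) ^ t = (5 / 6 :: real) ^ t" by (simp flip: power_mult_distrib)
    finally show "w t * prob {\<omega> \<in> space M. Z \<omega> = t} \<le> C * (2 * (real (t + 2 choose 2) * (5 / 6) ^ t))" .
  qed
  also have "\<dots> = C * (2 * (\<Sum>t\<le>D. real (t + 2 choose 2) * (5 / 6) ^ t))"
    by (simp add: sum_distrib_left)
  also have "\<dots> \<le> C * (2 * (1 / (1 - 5 / 6) ^ Suc 2))"
    using C by (intro mult_left_mono negative_binomial_sum_le) auto
  also have "\<dots> = 432 * C" by (simp add: power_divide eval_nat_numeral)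
  finally have W: "expectation (\<lambda>\<omega>. w (Z \<omega>)) \<le> 432 * C" .
  have iE: "integrable M (\<lambda>\<omega>. exp (l * real (Z \<omega>)))"
    by (rule integrable_const_bound[where B = "exp (l * real D)"]) (use ZD l in \<open>auto intro!: mult_left_mono\<close>)
  have "expectation (\<lambda>\<omega>. exp (l * real (Z \<omega>))) \<le> expectation (\<lambda>\<omega>. 1 + l * real (Z \<omega>) + l\<^sup>2 * w (Z \<omega>))"
  proof (rule integral_mono[OF iE])
    show "integrable M (\<lambda>\<omega>. 1 + l * real (Z \<omega>) + l\<^sup>2 * w (Z \<omega>))" using iZ iwZ by auto
    fix \<omega>
    have "exp (l * real (Z \<omega>)) \<le> 1 + l * real (Z \<omega>) + (l * real (Z \<omega>))\<^sup>2 * exp (l * real (Z \<omega>))"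
      using l by (intro exp_le_quadratic) auto
    also have "(l * real (Z \<omega>))\<^sup>2 * exp (l * real (Z \<omega>)) \<le> (l * real (Z \<omega>))\<^sup>2 * exp (real (Z \<omega>) / 10)"
      using l mult_right_mono[OF l(2), of "real (Z \<omega>)"] by (intro mult_left_mono) auto
    also have "\<dots> = l\<^sup>2 * w (Z \<omega>)" by (simp add: w_def power_mult_distrib)
    finally show "exp (l * real (Z \<omega>)) \<le> 1 + l * real (Z \<omega>) + l\<^sup>2 * w (Z \<omega>)" by simp
  qed
  also have "\<dots> = 1 + (l * m + l\<^sup>2 * expectation (\<lambda>\<omega>. w (Z \<omega>)))"
    using iZ iwZ by (simp add: m_def prob_space)
  also have "\<dots> \<le> 1 + (l * m + l\<^sup>2 * (432 * C))" using W by (intro add_left_mono mult_left_mono) auto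
  also have "\<dots> \<le> exp (l * m + l\<^sup>2 * (432 * C))" by (rule exp_ge_add_one_self)
  finally have "expectation (\<lambda>\<omega>. exp (l * real (Z \<omega>))) \<le> exp (l * m + l\<^sup>2 * (432 * C))" .
  then have "exp (- l * m) * expectation (\<lambda>\<omega>. exp (l * real (Z \<omega>))) \<le> exp (- l * m) * exp (l * m + l\<^sup>2 * (432 * C))"
    by (intro mult_left_mono) auto
  moreover have "(\<lambda>\<omega>. exp (l * (real (Z \<omega>) - m))) = (\<lambda>\<omega>. exp (- l * m) * exp (l * real (Z \<omega>)))"
    by (rule ext) (simp add: algebra_simps flip: exp_add)
  moreover have "exp (- l * m) * exp (l * m + l\<^sup>2 * (432 * C)) = exp (l\<^sup>2 * (432 * C))"
    by (simp flip: exp_add)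
  ultimately show ?thesis unfolding m_def[symmetric] by (simp only: integral_mult_right_zero)
qed

lemma chernoff_bound:
  fixes Z :: "'i \<Rightarrow> 'a \<Rightarrow> nat"
  assumes I: "finite I" and ind: "indep_vars (\<lambda>_. borel) (\<lambda>k \<omega>. real (Z k \<omega>)) I"
    and ZD: "\<And>k \<omega>. k \<in> I \<Longrightarrow> Z k \<omega> \<le> D"
    and tail: "\<And>k t. k \<in> I \<Longrightarrow> t \<le> D \<Longrightarrow> prob {\<omega> \<in> space M. t \<le> Z k \<omega>} \<le> C * (3 / 4) ^ t" and C: "C \<ge> 0"
    and l: "0 \<le> l" "l \<le> 1 / 10"
  shows "prob {\<omega> \<in> space M. (\<Sum>k\<in>I. expectation (\<lambda>\<omega>. real (Z k \<omega>))) + u \<le> (\<Sum>k\<in>I. real (Z k \<omega>))}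
    \<le> exp (l\<^sup>2 * (432 * C) * real (card I) - l * u)"
proof -
  have mZ: "(\<lambda>\<omega>. real (Z k \<omega>)) \<in> borel_measurable M" if "k \<in> I" for k
    using ind that by (auto simp: indep_vars_def)
  define m where "m k = expectation (\<lambda>\<omega>. real (Z k \<omega>))" for k
  define X where "X k \<omega> = exp (l * (real (Z k \<omega>) - m k))" for k \<omega>
  have indX: "indep_vars (\<lambda>_. borel) X I"
    unfolding X_def by (rule indep_vars_compose2[OF ind]) simp
  have iX: "integrable M (X k)" if "k \<in> I" for k
    unfolding X_def
    by (rule integrable_const_bound[where B = "exp (l * (real D - m k))"])
       (use ZD[OF that] l mZ[OF that] in \<open>auto intro!: mult_left_mono\<close>)
  have iP: "integrable M (\<lambda>\<omega>. \<Prod>k\<in>I. X k \<omega>)" by (rule indep_vars_integrable[OF I indX iX])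
  have "expectation (\<lambda>\<omega>. \<Prod>k\<in>I. X k \<omega>) = (\<Prod>k\<in>I. expectation (X k))"
    by (rule indep_vars_lebesgue_integral[OF I indX iX])
  also have "\<dots> \<le> (\<Prod>k\<in>I. exp (l\<^sup>2 * (432 * C)))"
  proof (intro prod_mono conjI)
    fix k assume k: "k \<in> I"
    show "0 \<le> expectation (X k)" unfolding X_def by (intro integral_nonneg_AE) auto
    show "expectation (X k) \<le> exp (l\<^sup>2 * (432 * C))"
      unfolding X_def m_def by (rule exponential_moment_le[OF mZ[OF k] ZD[OF k] tail[OF k] C l])
  qed
  also have "\<dots> = exp (l\<^sup>2 * (432 * C) * real (card I))" by (simp add: exp_of_nat_mult[symmetric] mult.commute)
  finally have E: "expectation (\<lambda>\<omega>. \<Prod>k\<in>I. X k \<omega>) \<le> exp (l\<^sup>2 * (432 * C) * real (card I))" .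
  have prodX: "(\<Prod>k\<in>I. X k \<omega>) = exp (l * ((\<Sum>k\<in>I. real (Z k \<omega>)) - (\<Sum>k\<in>I. m k)))" for \<omega>
    unfolding X_def by (simp add: exp_sum[OF I, symmetric] sum_distrib_left sum_subtractf right_diff_distrib)
  have "prob {\<omega> \<in> space M. (\<Sum>k\<in>I. m k) + u \<le> (\<Sum>k\<in>I. real (Z k \<omega>))} \<le> prob {\<omega> \<in> space M. exp (l * u) \<le> (\<Prod>k\<in>I. X k \<omega>)}"
  proof (rule finite_measure_mono)
    show "{\<omega> \<in> space M. (\<Sum>k\<in>I. m k) + u \<le> (\<Sum>k\<in>I. real (Z k \<omega>))} \<subseteq> {\<omega> \<in> space M. exp (l * u) \<le> (\<Prod>k\<in>I. X k \<omega>)}"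
      unfolding prodX using l by (auto intro!: mult_left_mono)
    note [measurable] = borel_measurable_integrable[OF iP]
    show "{\<omega> \<in> space M. exp (l * u) \<le> (\<Prod>k\<in>I. X k \<omega>)} \<in> events" by measurable
  qed
  also have "\<dots> \<le> exp (l\<^sup>2 * (432 * C) * real (card I)) / exp (l * u)"
    by (rule prob_gt_le_expectation[OF iP _ E]) (auto simp: X_def intro!: prod_nonneg)
  also have "\<dots> = exp (l\<^sup>2 * (432 * C) * real (card I) - l * u)" by (simp add: exp_diff)
  finally show ?thesis unfolding m_def .
qed

end

section \<open>The unit interval\<close>

lemma nroots_Un_disjoint:
  assumes "A \<inter> B = {}" "infinite A" "infinite B"
  shows "nroots (A \<union> B) p = nroots A p + nroots B p"
proof (cases "p = 0")
  case True
  then show ?thesis using assms by (simp add: nroots_def)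
next
  case False
  have fin: "finite {x \<in> S. poly p x = 0}" for S
    by (rule finite_subset[OF _ poly_roots_finite[OF False]]) auto
  have "{x \<in> A \<union> B. poly p x = 0} = {x \<in> A. poly p x = 0} \<union> {x \<in> B. poly p x = 0}" by auto
  then show ?thesis unfolding nroots_def using fin assms by (simp add: card_Un_disjoint disjoint_iff)
qed

lemma nroots_unit_interval_scales:
  "nroots {0..1} p = (\<Sum>k<K. nroots {1 - (7/8) ^ k..<1 - 7/8 * (7/8) ^ k} p) + nroots {1 - (7/8) ^ K..1} p"
proof (induction K)
  case (Suc K)
  define h where "h = (7/8 :: real) ^ K"
  have h: "h > 0" by (simp add: h_def)
  have un: "{1 - h..1} = {1 - h..<1 - 7/8 * h} \<union> {1 - 7/8 * h..1}"
    using h by (intro ivl_disj_un_two(7)[symmetric]) auto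
  have split: "nroots {1 - h..1} p = nroots {1 - h..<1 - 7/8 * h} p + nroots {1 - 7/8 * h..1} p"
    unfolding un by (rule nroots_Un_disjoint) (use h in \<open>auto simp: infinite_Ico infinite_Icc\<close>)
  have "nroots {0..1} p = (\<Sum>k<K. nroots {1 - (7/8) ^ k..<1 - 7/8 * (7/8) ^ k} p) + nroots {1 - h..1} p"
    using Suc unfolding h_def .
  also have "\<dots> = (\<Sum>k<Suc K. nroots {1 - (7/8) ^ k..<1 - 7/8 * (7/8) ^ k} p) + nroots {1 - (7/8) ^ Suc K..1} p"
    unfolding sum.lessThan_Suc power_Suc h_def[symmetric] split by (rule add.assoc[symmetric])
  finally show ?case .
qed simp

lemma card_residue_class_le:
  assumes "S \<subseteq> {..<K}"
  shows "card {k \<in> S. k mod w = r} \<le> K div w + (1::nat)"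
proof -
  have inj: "inj_on (\<lambda>k. k div w) {k \<in> S. k mod w = r}"
  proof (rule inj_onI)
    fix a b assume ab: "a \<in> {k \<in> S. k mod w = r}" "b \<in> {k \<in> S. k mod w = r}" and d: "a div w = b div w"
    have m: "a mod w = b mod w" using ab unfolding mem_Collect_eq by (elim conjE) (simp only:)
    have "a = a div w * w + a mod w" by (rule div_mult_mod_eq[symmetric])
    also have "\<dots> = b" unfolding d m by (rule div_mult_mod_eq)
    finally show "a = b" .
  qed
  have img: "(\<lambda>k. k div w) ` {k \<in> S. k mod w = r} \<subseteq> {..K div w}"
  proof (rule image_subsetI)
    fix k assume "k \<in> {k \<in> S. k mod w = r}"
    then have "k \<in> {..<K}" using assms by blast
    then have "k div w \<le> K div w" by (intro div_le_mono) (simp add: less_imp_le)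
    then show "k div w \<in> {..K div w}" by (simp only: atMost_iff)
  qed
  have "card {k \<in> S. k mod w = r} \<le> card {..K div w}"
    by (rule card_inj_on_le[OF inj img]) simp
  then show ?thesis by simp
qed

context tame_coeffs
begin

lemma indep_window_counts:
  fixes q :: real
  assumes q: "0 < q" "q < 1"
  shows "indep_vars (\<lambda>_. borel) (\<lambda>k \<omega>. real (min (nroots (scale_interval (q ^ k)) (partial_poly (window n (q ^ m) (q ^ k)) \<omega>)) D))
     {k \<in> S. k mod (2 * m + 1) = r}"
proof -
  define L where "L = {k \<in> S. k mod (2 * m + 1) = r}"
  define W where "W k = window n (q ^ m) (q ^ k)" for k
  have far: "k + (2 * m + 1) \<le> k'" if "k \<in> L" "k' \<in> L" "k < k'" for k k'
  proof -
    have "k mod (2 * m + 1) = k' mod (2 * m + 1)" using that by (simp add: L_def)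
    then have "(2 * m + 1) dvd k' - k" using that mod_eq_dvd_iff_nat[of k k' "2 * m + 1"] by simp
    then have "2 * m + 1 \<le> k' - k" using that by (intro dvd_imp_le) auto
    then show ?thesis using that by simp
  qed
  have disj: "disjoint_family_on W L"
    unfolding disjoint_family_on_def W_def
  proof (intro ballI impI)
    fix k k' assume kk: "k \<in> L" "k' \<in> L" "k \<noteq> k'"
    show "window n (q ^ m) (q ^ k) \<inter> window n (q ^ m) (q ^ k') = {}"
    proof (cases "k < k'")
      case True
      then show ?thesis by (rule window_disjoint[OF q far[OF kk(1,2)]])
    next
      case False
      then have "k' < k" using kk(3) by simp
      then have "window n (q ^ m) (q ^ k') \<inter> window n (q ^ m) (q ^ k) = {}"
        by (rule window_disjoint[OF q far[OF kk(2,1)]])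
      then show ?thesis by (simp only: Int_commute)
    qed
  qed
  have r: "indep_vars (\<lambda>k. PiM (W k) (\<lambda>_. borel)) (\<lambda>k \<omega>. restrict (\<lambda>i. \<xi> i \<omega>) (W k)) L"
    by (rule indep_vars_restrict[OF indep _ disj]) simp
  have "indep_vars (\<lambda>_. borel) (\<lambda>k \<omega>. min (real (nroots (scale_interval (q ^ k)) (coeff_poly (W k) (restrict (\<lambda>i. \<xi> i \<omega>) (W k))))) (real D)) L"
  proof (rule indep_vars_compose2[OF r, where Y = "\<lambda>k v. min (real (nroots (scale_interval (q ^ k)) (coeff_poly (W k) v))) (real D)"])
    fix k
    have "(\<lambda>v. real (nroots (scale_interval (q ^ k)) (coeff_poly (W k) (\<lambda>i. v i)))) \<in> borel_measurable (PiM (W k) (\<lambda>_. borel))"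
      by (intro borel_measurable_nroots_coeff_poly measurable_component_singleton sigma_compact_Ico)
    then show "(\<lambda>v. min (real (nroots (scale_interval (q ^ k)) (coeff_poly (W k) v))) (real D)) \<in> borel_measurable (PiM (W k) (\<lambda>_. borel))"
      by (intro borel_measurable_min borel_measurable_const)
  qed
  moreover have "coeff_poly (W k) (restrict (\<lambda>i. \<xi> i \<omega>) (W k)) = partial_poly (W k) \<omega>" for k \<omega>
    unfolding partial_poly_def by (rule coeff_poly_cong) simp
  ultimately show ?thesis unfolding L_def W_def of_nat_min by (simp only:)
qed

text \<open>
  The finite form of the result. The terms added to the mean are, in order, the roots at the first
  \<open>12 * D\<close> scales, the loss in mean through localization, the fluctuation \<open>u\<close> allowed in each of the
  \<open>24 * D + 1\<close> residue classes, and the roots at the last scale.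
\<close>
lemma unit_interval_bound:
  fixes D K n t1 :: nat and l u :: real
  defines "q \<equiv> 7 / 8 :: real"
  defines "y \<equiv> q ^ D" and "w \<equiv> 24 * D + 1"
  defines "N \<equiv> \<lambda>\<omega>. real (nroots {0..1} (partial_poly {..n} \<omega>))"
  assumes D: "D \<ge> 1" and ys: "y ^ 3 \<le> s" and K: "12 * D \<le> K"
    and nK: "1 \<le> real n * q ^ K" "real n * q ^ K \<le> 8 / 7"
    and small: "\<And>k. k < 12 * D \<Longrightarrow> \<exists>d. mid (q ^ k) ^ d \<le> s / 256 \<and> d * D \<le> n \<and>
       1 / (y * sqrt (q ^ k)) \<le> 2 ^ t1 * (mid (q ^ k) ^ d) ^ D"
    and l: "0 \<le> l" "l \<le> 1 / 10"
  shows "prob {\<omega> \<in> space M. expectation N + (12 * real D * real t1 + real K * (real D * (6000 * y)) + real w * u + real D) \<le> N \<omega>}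
    \<le> 12 * real D * (2 * y + (1 - s\<^sup>2 / 128) ^ D) + real K * (6000 * y + 260 * (3 / 4) ^ D)
      + real w * exp (l\<^sup>2 * 112320 * (real K / real w + 1) - l * u) + 100 * (3 / 4) ^ D"
proof -
  have q: "0 < q" "q < 1" by (auto simp: q_def)
  define m where "m = 12 * D"
  have w: "w = 2 * m + 1" "w > 0" by (auto simp: w_def m_def)
  have y0: "y > 0" using q by (simp add: y_def)
  have y12: "y ^ 12 = q ^ m" by (simp add: y_def m_def mult.commute flip: power_mult)
  have y1: "y \<le> 7 / 8" unfolding y_def q_def using D power_decreasing[of 1 D "7/8::real"] by simp
  have y4: "y ^ 12 \<le> 1 / 4"
  proof -
    have "y ^ 12 \<le> (7 / 8) ^ 12" using y0 y1 by (intro power_mono) auto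
    also have "\<dots> \<le> 1 / 4" by (simp add: power_divide)
    finally show ?thesis .
  qed
  have y3: "y ^ 3 \<le> (3 / 4) ^ t" if "t \<le> D" for t
  proof -
    have "y ^ 3 = ((7 / 8) ^ 3) ^ D" by (simp add: y_def q_def mult.commute flip: power_mult)
    also have "\<dots> \<le> (3 / 4) ^ D" by (intro power_mono) (auto simp: power_divide)
    also have "\<dots> \<le> (3 / 4) ^ t" using that by (intro power_decreasing) auto
    finally show ?thesis .
  qed
  have y6: "y ^ 6 / s \<le> y ^ 3"
  proof -
    have "y ^ 6 = y ^ 3 * y ^ 3" by (simp flip: power_add)
    also have "\<dots> \<le> y ^ 3 * s" using ys y0 by (intro mult_left_mono) auto
    finally show ?thesis using s_pos by (simp add: field_simps)
  qed
  have sqrt_y12: "sqrt (y ^ 12) = y ^ 6" using y0 by (intro real_sqrt_unique) (auto simp flip: power_mult)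
  define B where "B = {m..<K}"
  define W where "W k = window n (q ^ m) (q ^ k)" for k
  define Nk where "Nk k \<omega> = nroots (scale_interval (q ^ k)) (partial_poly {..n} \<omega>)" for k \<omega>
  define Zk where "Zk k \<omega> = nroots (scale_interval (q ^ k)) (partial_poly (W k) \<omega>)" for k \<omega>
  define Y where "Y k \<omega> = min (Zk k \<omega>) D" for k \<omega>
  define Last where "Last \<omega> = nroots {1 - q ^ K..1} (partial_poly {..n} \<omega>)" for \<omega>
  have scale: "0 < q ^ k" "q ^ k \<le> y ^ 12" "q ^ k \<le> 1 / 4" "1 \<le> real n * q ^ k" if "k \<in> B" for k
  proof -
    show "0 < q ^ k" using q by simp
    show le: "q ^ k \<le> y ^ 12" unfolding y12 using q that by (intro power_decreasing) (auto simp: B_def)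
    show "q ^ k \<le> 1 / 4" using le y4 by linarith
    have "q ^ K \<le> q ^ k" using q that by (intro power_decreasing) (auto simp: B_def)
    then have "real n * q ^ K \<le> real n * q ^ k" by (intro mult_left_mono) auto
    then show "1 \<le> real n * q ^ k" using nK by linarith
  qed
  have mN[measurable]: "(\<lambda>\<omega>. real (Nk k \<omega>)) \<in> borel_measurable M" and
    mZ[measurable]: "(\<lambda>\<omega>. real (Zk k \<omega>)) \<in> borel_measurable M" for k
    unfolding Nk_def Zk_def by (auto intro!: measurable_nroots_partial_poly sigma_compact_Ico)
  have mY[measurable]: "(\<lambda>\<omega>. real (Y k \<omega>)) \<in> borel_measurable M" for k
  proof -
    have "(\<lambda>\<omega>. min (real (Zk k \<omega>)) (real D)) \<in> borel_measurable M"
      by (intro borel_measurable_min mZ borel_measurable_const)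
    then show ?thesis unfolding Y_def of_nat_min .
  qed
  have mL[measurable]: "(\<lambda>\<omega>. real (Last \<omega>)) \<in> borel_measurable M"
    unfolding Last_def by (auto intro!: measurable_nroots_partial_poly sigma_compact_closed)
  have deg: "degree (partial_poly {..n} \<omega>) \<le> n" for \<omega>
    unfolding partial_poly_def by (rule degree_coeff_poly) simp
  have Nkn: "Nk k \<omega> \<le> n" for k \<omega>
  proof -
    have "q ^ k > 0" using q by simp
    then show ?thesis unfolding Nk_def by (intro order.trans[OF nroots_le_degree deg]) (auto simp: infinite_Ico)
  qed
  have Lastn: "Last \<omega> \<le> n" for \<omega>
  proof -
    have "q ^ K > 0" using q by simp
    then show ?thesis unfolding Last_def by (intro order.trans[OF nroots_le_degree deg]) (auto simp: infinite_Icc)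
  qed
  have iN: "integrable M (\<lambda>\<omega>. real (Nk k \<omega>))" for k
    by (rule integrable_const_bound[where B = "real n"]) (use Nkn in auto)
  have iL: "integrable M (\<lambda>\<omega>. real (Last \<omega>))"
    by (rule integrable_const_bound[where B = "real n"]) (use Lastn in auto)
  have iY: "integrable M (\<lambda>\<omega>. real (Y k \<omega>))" for k
  proof (rule integrable_const_bound[where B = "real D"])
    show "AE \<omega> in M. norm (real (Y k \<omega>)) \<le> real D" by (simp add: Y_def)
  qed (rule mY)
  have Nsum: "N \<omega> = (\<Sum>k<K. real (Nk k \<omega>)) + real (Last \<omega>)" for \<omega>
    unfolding N_def Nk_def Last_def q_def by (subst nroots_unit_interval_scales[of _ K]) simp
  define EY where "EY k = expectation (\<lambda>\<omega>. real (Y k \<omega>))" for k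
  define Unstable where "Unstable k = {\<omega> \<in> space M. Nk k \<omega> \<noteq> Zk k \<omega>}" for k
  have ne_ev: "Unstable k \<in> events" for k
  proof -
    have "{\<omega> \<in> space M. real (Nk k \<omega>) \<noteq> real (Zk k \<omega>)} \<in> events" by measurable
    then show ?thesis by (simp add: Unstable_def)
  qed
  have p_ne: "prob (Unstable k) \<le> 6000 * y" if "k \<in> B" for k
    using nroots_window_eq[OF y0 y4 ys scale(1)[OF that] scale(2)[OF that] scale(4)[OF that]]
    unfolding Unstable_def Nk_def Zk_def W_def y12 .
  have tail: "prob {\<omega> \<in> space M. t \<le> Zk k \<omega>} \<le> 260 * (3 / 4) ^ t" if "k \<in> B" "t \<le> D" for k t
    unfolding Zk_def
  proof (rule nroots_tail)
    show "W k \<subseteq> {..n}" by (auto simp: W_def window_def)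
    show "core (q ^ k) \<subseteq> W k" unfolding W_def
      using y4 y12 y0 scale[OF that(1)] by (intro core_subset_window) auto
    have "sqrt (q ^ k) \<le> y ^ 6" using scale(2)[OF that(1)] sqrt_y12 by (metis real_sqrt_le_mono)
    then have "sqrt (q ^ k) / s \<le> y ^ 6 / s" using s_pos by (simp add: divide_right_mono)
    then show "sqrt (q ^ k) / s \<le> (3 / 4) ^ t" using y6 y3[OF that(2)] by linarith
  qed (use scale[OF that(1)] in auto)
  \<comment> \<open>Truncation at \<open>D\<close> limits the damage of failed localization in mean to \<open>D\<close> times its probability.\<close>
  have EN: "expectation N \<ge> (\<Sum>k\<in>B. EY k) - real K * (real D * (6000 * y))"
  proof -
    have one: "EY k - real D * (6000 * y) \<le> expectation (\<lambda>\<omega>. real (Nk k \<omega>))" if "k \<in> B" for k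
    proof -
      have "EY k \<le> expectation (\<lambda>\<omega>. real (Nk k \<omega>) + real D * indicat_real (Unstable k) \<omega>)"
      unfolding EY_def
      proof (rule integral_mono[OF iY])
        show "integrable M (\<lambda>\<omega>. real (Nk k \<omega>) + real D * indicat_real (Unstable k) \<omega>)"
          by (intro Bochner_Integration.integrable_add iN integrable_mult_right integrable_indicat ne_ev)
        fix \<omega> assume "\<omega> \<in> space M"
        then show "real (Y k \<omega>) \<le> real (Nk k \<omega>) + real D * indicat_real (Unstable k) \<omega>"
          by (auto simp: Y_def indicator_def Unstable_def)
      qed
      also have "\<dots> = expectation (\<lambda>\<omega>. real (Nk k \<omega>)) + real D * prob (Unstable k)"
        using iN integrable_indicat[OF ne_ev] ne_ev by (subst Bochner_Integration.integral_add) auto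
      also have "\<dots> \<le> expectation (\<lambda>\<omega>. real (Nk k \<omega>)) + real D * (6000 * y)"
        using p_ne[OF that] by (intro add_left_mono mult_left_mono) auto
      finally show ?thesis by simp
    qed
    have "real (card B) * (real D * (6000 * y)) \<le> real K * (real D * (6000 * y))"
      using y0 by (intro mult_right_mono) (auto simp: B_def)
    then have "(\<Sum>k\<in>B. EY k) - real K * (real D * (6000 * y))
       \<le> (\<Sum>k\<in>B. EY k - real D * (6000 * y))"
      by (simp add: sum_subtractf)
    also have "\<dots> \<le> (\<Sum>k\<in>B. expectation (\<lambda>\<omega>. real (Nk k \<omega>)))" by (intro sum_mono one)
    also have "\<dots> \<le> (\<Sum>k<K. expectation (\<lambda>\<omega>. real (Nk k \<omega>)))"
      by (intro sum_mono2) (auto simp: B_def intro!: integral_nonneg_AE)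
    also have "\<dots> \<le> (\<Sum>k<K. expectation (\<lambda>\<omega>. real (Nk k \<omega>))) + expectation (\<lambda>\<omega>. real (Last \<omega>))"
      by (simp add: integral_nonneg_AE)
    also have "\<dots> = expectation (\<lambda>\<omega>. (\<Sum>k<K. real (Nk k \<omega>)) + real (Last \<omega>))"
      using iN iL by (subst Bochner_Integration.integral_add) auto
    also have "\<dots> = expectation N" unfolding Nsum by simp
    finally show ?thesis .
  qed
  define C where "C r = {k \<in> B. k mod w = r}" for r
  define Large where "Large r = {\<omega> \<in> space M. (\<Sum>k\<in>C r. EY k) + u \<le> (\<Sum>k\<in>C r. real (Y k \<omega>))}" for r
  \<comment> \<open>Too many roots at an early scale; failed localization or truncation; a large fluctuation in a residue class; too many roots at the last scale.\<close>
  define E1 where "E1 = (\<Union>k\<in>{..<m}. {\<omega> \<in> space M. t1 \<le> Nk k \<omega>})"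
  define E2 where "E2 = (\<Union>k\<in>B. Unstable k \<union> {\<omega> \<in> space M. D \<le> Zk k \<omega>})"
  define E3 where "E3 = (\<Union>r\<in>{..<w}. Large r)"
  define E4 where "E4 = {\<omega> \<in> space M. D \<le> Last \<omega>}"
  have ev_ge: "{\<omega> \<in> space M. t \<le> Nk k \<omega>} \<in> events" "{\<omega> \<in> space M. t \<le> Zk k \<omega>} \<in> events" "E4 \<in> events" for t k
    unfolding Nk_def Zk_def E4_def Last_def
    by (auto intro!: measurable_nroots_ge sigma_compact_Ico sigma_compact_closed)
  have m12: "E1 \<in> events" "E2 \<in> events" unfolding E1_def E2_def using ev_ge ne_ev by (auto simp: B_def)
  have m_large: "Large r \<in> events" for r unfolding Large_def by measurable
  then have m3: "E3 \<in> events" unfolding E3_def by auto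
  have p1: "prob E1 \<le> real m * (2 * y + (1 - s\<^sup>2 / 128) ^ D)"
  proof -
    have "prob E1 \<le> (\<Sum>k\<in>{..<m}. prob {\<omega> \<in> space M. t1 \<le> Nk k \<omega>})"
      unfolding E1_def using ev_ge by (intro finite_measure_subadditive_finite) auto
    also have "\<dots> \<le> (\<Sum>k\<in>{..<m}. 2 * y + (1 - s\<^sup>2 / 128) ^ D)"
    proof (rule sum_mono)
      fix k assume "k \<in> {..<m}"
      then obtain d where d: "mid (q ^ k) ^ d \<le> s / 256" "d * D \<le> n"
        "1 / (y * sqrt (q ^ k)) \<le> 2 ^ t1 * (mid (q ^ k) ^ d) ^ D" using small[of k] by (auto simp: m_def)
      show "prob {\<omega> \<in> space M. t1 \<le> Nk k \<omega>} \<le> 2 * y + (1 - s\<^sup>2 / 128) ^ D"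
        unfolding Nk_def
      proof (rule nroots_small_scale[OF _ _ y0 _ d(1) d(3)])
        show "0 < q ^ k" "q ^ k \<le> 1" using q by (auto intro: power_le_one)
        show "d * j \<le> n" if "j < D" for j
          using d(2) that by (meson le_trans less_imp_le mult_le_mono2)
      qed
    qed
    finally show ?thesis by simp
  qed
  have p2: "prob E2 \<le> real K * (6000 * y + 260 * (3 / 4) ^ D)"
  proof -
    have "prob E2 \<le> (\<Sum>k\<in>B. prob (Unstable k \<union> {\<omega> \<in> space M. D \<le> Zk k \<omega>}))"
      unfolding E2_def using ev_ge ne_ev by (intro finite_measure_subadditive_finite) (auto simp: B_def)
    also have "\<dots> \<le> (\<Sum>k\<in>B. 6000 * y + 260 * (3 / 4) ^ D)"
    proof (rule sum_mono)
      fix k assume k: "k \<in> B"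
      show "prob (Unstable k \<union> {\<omega> \<in> space M. D \<le> Zk k \<omega>}) \<le> 6000 * y + 260 * (3 / 4) ^ D"
        using measure_Un_le[OF ne_ev ev_ge(2), of k D k] p_ne[OF k] tail[OF k order.refl] by linarith
    qed
    also have "\<dots> = real (card B) * (6000 * y + 260 * (3 / 4) ^ D)" by simp
    also have "\<dots> \<le> real K * (6000 * y + 260 * (3 / 4) ^ D)"
      using y0 by (intro mult_right_mono add_nonneg_nonneg) (auto simp: B_def)
    finally show ?thesis .
  qed
  have p3: "prob E3 \<le> real w * exp (l\<^sup>2 * 112320 * (real K / real w + 1) - l * u)"
  proof -
    have "prob E3 \<le> (\<Sum>r\<in>{..<w}. prob (Large r))"
      unfolding E3_def using m_large by (intro finite_measure_subadditive_finite) auto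
    also have "\<dots> \<le> (\<Sum>r\<in>{..<w}. exp (l\<^sup>2 * 112320 * (real K / real w + 1) - l * u))"
    proof (rule sum_mono)
      fix r
      have "prob (Large r)
         \<le> exp (l\<^sup>2 * (432 * 260) * real (card (C r)) - l * u)"
      unfolding Large_def EY_def
      proof (rule chernoff_bound[where D = D])
        show "indep_vars (\<lambda>_. borel) (\<lambda>k \<omega>. real (Y k \<omega>)) (C r)"
          using indep_window_counts[OF q, of n m D B r] unfolding Y_def Zk_def W_def C_def w(1) .
        fix k t assume k: "k \<in> C r" and t: "t \<le> D"
        then have "{\<omega> \<in> space M. t \<le> Y k \<omega>} = {\<omega> \<in> space M. t \<le> Zk k \<omega>}" by (auto simp: Y_def)
        then show "prob {\<omega> \<in> space M. t \<le> Y k \<omega>} \<le> 260 * (3 / 4) ^ t"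
          using tail[of k t] k t by (simp add: C_def)
      qed (use l in \<open>auto simp: Y_def C_def B_def\<close>)
      also have "\<dots> \<le> exp (l\<^sup>2 * 112320 * (real K / real w + 1) - l * u)"
      proof -
        have "card (C r) \<le> K div w + 1" unfolding C_def by (rule card_residue_class_le) (auto simp: B_def)
        then have "real (card (C r)) \<le> real (K div w) + 1" by linarith
        also have "real (K div w) \<le> real K / real w"
        proof -
          have "real (K div w * w) \<le> real K" by (simp only: of_nat_le_iff div_times_less_eq_dividend)
          then show ?thesis using w(2) by (simp add: pos_le_divide_eq)
        qed
        finally have "l\<^sup>2 * 112320 * real (card (C r)) \<le> l\<^sup>2 * 112320 * (real K / real w + 1)"
          by (intro mult_left_mono) auto
        then show ?thesis by simp
      qed
      finally show "prob (Large r)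
         \<le> exp (l\<^sup>2 * 112320 * (real K / real w + 1) - l * u)" .
    qed
    finally show ?thesis by simp
  qed
  have p4: "prob E4 \<le> 100 * (3 / 4) ^ D"
    unfolding E4_def Last_def
  proof (rule nroots_last_scale)
    show "0 < q ^ K" using q by simp
    show "real n * q ^ K \<le> 8 / 7" by (rule nK)
    have "1 / q ^ K \<le> real n + 1" using nK q by (simp add: field_simps) (smt (verit) zero_less_power)
    then have "sqrt (1 / q ^ K) \<le> sqrt (real n + 1)" by simp
    moreover have "q ^ K \<le> y ^ 12" unfolding y12 using q K by (intro power_decreasing) (auto simp: m_def)
    then have "1 / y ^ 12 \<le> 1 / q ^ K" using q y0 by (intro divide_left_mono mult_pos_pos zero_less_power) auto
    then have "sqrt (1 / y ^ 12) \<le> sqrt (1 / q ^ K)" by simp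
    moreover have "sqrt (1 / y ^ 12) = 1 / y ^ 6" using sqrt_y12 by (simp add: real_sqrt_divide)
    ultimately have "1 / y ^ 6 \<le> sqrt (real n + 1)" by linarith
    then have "1 / (s * sqrt (real n + 1)) \<le> 1 / (s * (1 / y ^ 6))"
      using s_pos y0 by (intro divide_left_mono mult_left_mono) auto
    also have "\<dots> = y ^ 6 / s" by simp
    finally show "1 / (s * sqrt (real n + 1)) \<le> (3 / 4) ^ D" using y6 y3[of D] by linarith
  qed
  have "{\<omega> \<in> space M. expectation N + (12 * real D * real t1 + real K * (real D * (6000 * y)) + real w * u + real D) \<le> N \<omega>}
      \<subseteq> E1 \<union> E2 \<union> E3 \<union> E4"
  proof (rule ccontr)
    assume "\<not> ?thesis"
    then obtain \<omega> where \<omega>: "\<omega> \<in> space M" "\<omega> \<notin> E1" "\<omega> \<notin> E2" "\<omega> \<notin> E3" "\<omega> \<notin> E4"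
      and big: "expectation N + (12 * real D * real t1 + real K * (real D * (6000 * y)) + real w * u + real D) \<le> N \<omega>" by auto
    have a: "(\<Sum>k<m. real (Nk k \<omega>)) \<le> real m * real t1"
    proof -
      have "real (Nk k \<omega>) \<le> real t1" if "k < m" for k
      proof -
        have "\<not> t1 \<le> Nk k \<omega>" using \<omega>(1,2) that unfolding E1_def by blast
        then show ?thesis by simp
      qed
      then have "(\<Sum>k<m. real (Nk k \<omega>)) \<le> (\<Sum>k<m. real t1)" by (intro sum_mono) auto
      then show ?thesis by simp
    qed
    have b: "(\<Sum>k\<in>B. real (Nk k \<omega>)) = (\<Sum>k\<in>B. real (Y k \<omega>))"
    proof (rule sum.cong)
      fix k assume "k \<in> B"
      then have "Nk k \<omega> = Zk k \<omega>" "\<not> D \<le> Zk k \<omega>" using \<omega>(1,3) unfolding E2_def Unstable_def by blast+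
      then show "real (Nk k \<omega>) = real (Y k \<omega>)" by (simp add: Y_def)
    qed simp
    have grp: "(\<Sum>k\<in>B. g k) = (\<Sum>r<w. \<Sum>k\<in>C r. g k)" for g :: "nat \<Rightarrow> real"
      unfolding C_def using w(2) by (subst sum.group) (auto simp: B_def)
    have c: "(\<Sum>k\<in>B. real (Y k \<omega>)) \<le> (\<Sum>k\<in>B. EY k) + real w * u"
    proof -
      have "(\<Sum>k\<in>C r. real (Y k \<omega>)) \<le> (\<Sum>k\<in>C r. EY k) + u" if "r < w" for r
      proof -
        have "\<not> (\<Sum>k\<in>C r. EY k) + u \<le> (\<Sum>k\<in>C r. real (Y k \<omega>))"
          using \<omega>(1,4) that unfolding E3_def Large_def by blast
        then show ?thesis by simp
      qed
      then have "(\<Sum>r<w. \<Sum>k\<in>C r. real (Y k \<omega>)) \<le> (\<Sum>r<w. (\<Sum>k\<in>C r. EY k) + u)"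
        by (intro sum_mono) auto
      then show ?thesis unfolding grp by (simp add: sum.distrib)
    qed
    have d: "real (Last \<omega>) < real D" using \<omega>(1,5) by (auto simp: E4_def)
    have "(\<Sum>k<K. real (Nk k \<omega>)) = (\<Sum>k<m. real (Nk k \<omega>)) + (\<Sum>k\<in>B. real (Nk k \<omega>))"
      unfolding B_def using K by (simp add: m_def lessThan_atLeast0 sum.atLeastLessThan_concat)
    then have "N \<omega> < real m * real t1 + ((\<Sum>k\<in>B. EY k) + real w * u) + real D"
      unfolding Nsum using a b c d by linarith
    moreover have "real m = 12 * real D" by (simp add: m_def)
    ultimately show False using big EN by (simp add: algebra_simps)
  qed
  then have "prob {\<omega> \<in> space M. expectation N + (12 * real D * real t1 + real K * (real D * (6000 * y)) + real w * u + real D) \<le> N \<omega>}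
     \<le> prob (E1 \<union> E2 \<union> E3 \<union> E4)"
    using m12 m3 ev_ge(3) by (intro finite_measure_mono) auto
  also have "\<dots> \<le> prob (E1 \<union> E2 \<union> E3) + prob E4" using m12 m3 ev_ge(3) by (intro measure_Un_le) auto
  also have "prob (E1 \<union> E2 \<union> E3) \<le> prob (E1 \<union> E2) + prob E3" using m12 m3 by (intro measure_Un_le) auto
  also have "prob (E1 \<union> E2) \<le> prob E1 + prob E2" using m12 by (intro measure_Un_le) auto
  finally show ?thesis using p1 p2 p3 p4 by (simp add: m_def)
qed

end

section \<open>Choice of the parameters\<close>

lemma num_roots_eq_nroots: "num_roots \<xi> n S \<omega> = real (nroots S (coeff_poly {..n} (\<lambda>i. \<xi> i \<omega>)))"
  by (simp add: num_roots_def rand_poly_def nroots_def poly_coeff_poly)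

text \<open>
  The last scale is the one whose length is comparable to \<open>1 / n\<close>.
\<close>
lemma last_scale_exists:
  assumes n: "n \<ge> (1::nat)"
  obtains K where "1 \<le> real n * (7/8) ^ K" "real n * (7/8) ^ K \<le> 8 / 7" "real K \<le> 8 * ln (real n)"
proof -
  have "(\<lambda>j. real n * (7/8) ^ j) \<longlonglongrightarrow> real n * 0"
    by (intro tendsto_mult tendsto_const LIMSEQ_power_zero) auto
  then have "eventually (\<lambda>j. real n * (7/8) ^ j < 1) sequentially"
    by (rule order_tendstoD) simp
  then obtain j0 where "real n * (7/8) ^ j0 < 1" by (auto simp: eventually_sequentially)
  define j where "j = (LEAST j. real n * (7/8) ^ j < 1)"
  have j: "real n * (7/8) ^ j < 1" unfolding j_def by (rule LeastI) fact
  have "j \<noteq> 0" using j n by (cases j) auto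
  then obtain K where K: "j = Suc K" by (cases j) auto
  have 1: "1 \<le> real n * (7/8) ^ K"
    using not_less_Least[of K "\<lambda>j. real n * (7/8) ^ j < 1"] K unfolding j_def by simp
  have 2: "real n * (7/8) ^ K \<le> 8 / 7" using j unfolding K by simp
  have "0 \<le> ln (real n * (7/8) ^ K)" using 1 by simp
  also have "\<dots> = ln (real n) + real K * ln (7/8)" using n by (simp add: ln_mult ln_realpow)
  also have "\<dots> \<le> ln (real n) + real K * (- (1/8))"
    using ln_le_minus_one[of "7/8"] by (intro add_left_mono mult_left_mono) auto
  finally have 3: "real K \<le> 8 * ln (real n)" by simp
  show ?thesis by (rule that[OF 1 2 3])
qed

text \<open>
  The least exponent that brings \<open>c\<close> below \<open>\<rho>\<close>; minimality bounds the overshoot, and \<open>ln c \<le> c - 1\<close>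
  bounds the exponent.
\<close>
lemma gap_exists:
  fixes c \<rho> :: real
  assumes c: "1 / 16 \<le> c" "c < 1" and \<rho>: "0 < \<rho>" "\<rho> < 1"
  obtains d where "c ^ d \<le> \<rho>" "\<rho> / 16 \<le> c ^ d" "real d \<le> 1 + ln (1 / \<rho>) / (1 - c)"
proof -
  have "(\<lambda>j. c ^ j) \<longlonglongrightarrow> 0" using c by (intro LIMSEQ_power_zero) auto
  then have "eventually (\<lambda>j. c ^ j < \<rho>) sequentially" by (rule order_tendstoD) (use \<rho> in simp)
  then obtain j0 where "c ^ j0 \<le> \<rho>" by (auto simp: eventually_sequentially intro: less_imp_le)
  define d where "d = (LEAST j. c ^ j \<le> \<rho>)"
  have d: "c ^ d \<le> \<rho>" unfolding d_def by (rule LeastI) fact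
  have "d \<noteq> 0" using d \<rho> by (cases d) auto
  then obtain e where e: "d = Suc e" by (cases d) auto
  have ce: "\<rho> < c ^ e" using not_less_Least[of e "\<lambda>j. c ^ j \<le> \<rho>"] e unfolding d_def by simp
  have "\<rho> * (1 / 16) \<le> c ^ e * c" using ce c \<rho> by (intro mult_mono) auto
  then have 2: "\<rho> / 16 \<le> c ^ d" by (simp add: e mult.commute)
  have "ln \<rho> \<le> ln (c ^ e)" using ce \<rho> by simp
  also have "\<dots> = real e * ln c" using c by (simp add: ln_realpow)
  also have "\<dots> \<le> real e * (c - 1)" using c ln_le_minus_one[of c] by (intro mult_left_mono) auto
  finally have "real e * (1 - c) \<le> ln (1 / \<rho>)" using \<rho> by (simp add: ln_div algebra_simps)
  then have "real e \<le> ln (1 / \<rho>) / (1 - c)" using c by (simp add: pos_le_divide_eq)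
  then have 3: "real d \<le> 1 + ln (1 / \<rho>) / (1 - c)" by (simp add: e)
  show ?thesis by (rule that[OF d 2 3])
qed

text \<open>
  Supplies the gap \<open>d\<close> between the exponents in the geometric small ball estimate with \<open>D\<close> terms. It is
  of order \<open>1 / h\<close>, hence all exponents stay below \<open>n\<close>; the bound \<open>(c^d)^D\<close> on the value and the bound
  \<open>(8/7)^(7 * D)\<close> on the norm are exponential in \<open>D\<close> and are offset by \<open>C1 * D\<close> factors of 2.
\<close>
lemma small_scale_parameters:
  fixes s :: real
  assumes s: "0 < s" "s \<le> 1" and C1: "12288 / s \<le> 2 ^ C1"
    and n: "(1 + 2 * ln (256 / s)) * 10 ^ D \<le> real n" and k: "k < 12 * D"
  shows "\<exists>d. (1 - 15 / 16 * (7/8) ^ k) ^ d \<le> s / 256 \<and> d * D \<le> n \<and>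
       1 / ((7/8) ^ D * sqrt ((7/8) ^ k)) \<le> 2 ^ (C1 * D) * ((1 - 15 / 16 * (7/8) ^ k) ^ d) ^ D"
proof -
  define h where "h = (7/8 :: real) ^ k"
  define c where "c = 1 - 15 / 16 * h"
  have h: "0 < h" "h \<le> 1" by (auto simp: h_def intro: power_le_one)
  have c: "1 / 16 \<le> c" "c < 1" using h by (auto simp: c_def)
  have hD: "(7/8) ^ (12 * D) \<le> h" unfolding h_def using k by (intro power_decreasing) auto
  obtain d where d: "c ^ d \<le> s / 256" "s / 256 / 16 \<le> c ^ d" "real d \<le> 1 + ln (1 / (s / 256)) / (1 - c)"
    by (rule gap_exists[OF c, of "s / 256"]) (use s in auto)
  have dD: "d * D \<le> n"
  proof -
    have lnpos: "0 \<le> ln (256 / s)" using s by (simp add: field_simps)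
    have h5: "1 / h \<le> 5 ^ D"
    proof -
      have "1 / h \<le> 1 / (7/8) ^ (12 * D)" using hD h by (intro divide_left_mono) auto
      also have "\<dots> = ((8/7) ^ 12) ^ D" by (simp add: power_divide power_mult)
      also have "\<dots> \<le> 5 ^ D" by (intro power_mono) (auto simp: power_divide)
      finally show ?thesis .
    qed
    have "real d \<le> 1 + ln (256 / s) * (16 / 15) * (1 / h)" using d(3) by (simp add: c_def)
    also have "\<dots> \<le> 1 * (1 / h) + ln (256 / s) * 2 * (1 / h)"
      using h lnpos by (intro add_mono mult_right_mono mult_left_mono) auto
    also have "\<dots> = (1 + 2 * ln (256 / s)) * (1 / h)" by (simp add: algebra_simps)
    also have "\<dots> \<le> (1 + 2 * ln (256 / s)) * 5 ^ D" using h5 lnpos by (intro mult_left_mono) auto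
    finally have "real d * real D \<le> ((1 + 2 * ln (256 / s)) * 5 ^ D) * 2 ^ D"
      using lnpos of_nat_less_two_power[of D, where 'a = real] by (intro mult_mono) auto
    also have "\<dots> = (1 + 2 * ln (256 / s)) * 10 ^ D" by (simp flip: power_mult_distrib)
    also have "\<dots> \<le> real n" by (rule n)
    finally have "real (d * D) \<le> real n" by simp
    then show ?thesis by (simp only: of_nat_le_iff)
  qed
  have "1 / ((7/8) ^ D * sqrt h) \<le> 1 / ((7/8) ^ D * (7/8) ^ (6 * D))"
  proof (intro divide_left_mono mult_left_mono)
    have "(7/8) ^ (12 * D) = ((7/8 :: real) ^ (6 * D))\<^sup>2" by (simp flip: power_mult)
    then show "(7/8) ^ (6 * D) \<le> sqrt h" using hD by (intro real_le_rsqrt) simp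
  qed (use h in auto)
  also have "(7/8) ^ D * (7/8) ^ (6 * D) = ((7/8 :: real) ^ 7) ^ D" by (simp flip: power_mult power_add)
  also have "1 / ((7/8 :: real) ^ 7) ^ D = ((8/7) ^ 7) ^ D" by (simp add: power_divide)
  also have "\<dots> \<le> 3 ^ D" by (intro power_mono) (auto simp: power_divide)
  also have "\<dots> \<le> (2 ^ C1 * c ^ d) ^ D"
  proof (intro power_mono)
    have "3 = (12288 / s) * (s / 256 / 16)" using s by simp
    also have "\<dots> \<le> 2 ^ C1 * c ^ d" using C1 d(2) s by (intro mult_mono) auto
    finally show "3 \<le> 2 ^ C1 * c ^ d" .
  qed simp
  also have "\<dots> = 2 ^ (C1 * D) * (c ^ d) ^ D" by (simp add: power_mult_distrib power_mult)
  finally show ?thesis using d(1) dD unfolding c_def h_def by blast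
qed

text \<open>
  The exponent in the Chernoff bound. With \<open>L = sqrt (ln n)\<close> there are \<open>w = O(L)\<close> classes of \<open>O(L\<^sup>2 / w)\<close>
  scales each, and the fluctuation \<open>\<epsilon> / 4 * L\<^sup>2 / w\<close> allowed per class makes the exponent at most a
  negative multiple of \<open>L\<close>.
\<close>
lemma exp_error_bound:
  fixes l L w K \<epsilon> :: real
  assumes l: "0 < l" "l \<le> 1 / 10" "l \<le> \<epsilon> / 7188480" and w: "0 < w" "w \<le> 25 * L" and K: "0 \<le> K" "K \<le> 8 * L\<^sup>2"
    and L: "L > 0"
  shows "l\<^sup>2 * 112320 * (K / w + 1) - l * (\<epsilon> / 4 * L\<^sup>2 / w) \<le> 1124 - l * \<epsilon> / 200 * L"
proof -
  have \<epsilon>: "0 < \<epsilon>" using l by linarith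
  have "l\<^sup>2 \<le> 1 / 100"
    using power_mono[OF l(2), of 2] l by (simp add: power2_eq_square)
  then have 1: "l\<^sup>2 * 112320 \<le> 1124" by linarith
  have "l\<^sup>2 * 112320 * (K / w) \<le> l\<^sup>2 * 112320 * (8 * L\<^sup>2 / w)"
    using K w by (intro mult_left_mono divide_right_mono) auto
  also have "\<dots> = l * (l * 898560) * (L\<^sup>2 / w)" by (simp add: power2_eq_square)
  also have "\<dots> \<le> l * (\<epsilon> / 8) * (L\<^sup>2 / w)"
    using l w by (intro mult_right_mono mult_left_mono) auto
  finally have 2: "l\<^sup>2 * 112320 * (K / w) \<le> l * \<epsilon> / 8 * (L\<^sup>2 / w)" by simp
  have "L / 25 = L\<^sup>2 / (25 * L)" using L by (simp add: power2_eq_square)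
  also have "\<dots> \<le> L\<^sup>2 / w" using w L by (intro divide_left_mono) auto
  finally have "l * \<epsilon> / 8 * (L / 25) \<le> l * \<epsilon> / 8 * (L\<^sup>2 / w)" using l \<epsilon> by (intro mult_left_mono) auto
  moreover have "l * (\<epsilon> / 4 * L\<^sup>2 / w) = l * \<epsilon> / 8 * (L\<^sup>2 / w) + l * \<epsilon> / 8 * (L\<^sup>2 / w)" by simp
  moreover have "l\<^sup>2 * 112320 * (K / w + 1) = l\<^sup>2 * 112320 * (K / w) + l\<^sup>2 * 112320" by (simp add: algebra_simps)
  moreover have "l * \<epsilon> / 200 * L = l * \<epsilon> / 8 * (L / 25)" by simp
  ultimately show ?thesis using 1 2 by linarith
qed

text \<open>
  Here \<open>D\<close> is the integer part of \<open>\<delta> * sqrt (ln n)\<close>. The quantifier over \<open>M\<close> and \<open>\<xi>\<close> inside the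
  statement records that the constants depend only on \<open>s\<close> and \<open>\<epsilon>\<close>.
\<close>
lemma unit_interval_tail:
  fixes s \<epsilon> :: real
  assumes s: "0 < s" "s \<le> 1" and \<epsilon>: "\<epsilon> > 0"
  shows "\<exists>c>0. \<exists>C>0. \<forall>(M :: 'a measure) \<xi> n. tame_coeffs M \<xi> s \<longrightarrow> n \<ge> 1 \<longrightarrow>
    measure M {\<omega> \<in> space M. integral\<^sup>L M (num_roots \<xi> n {0..1}) + \<epsilon> * ln (real n) \<le> num_roots \<xi> n {0..1} \<omega>}
      \<le> C * exp (- c * sqrt (ln (real n)))"
proof -
  obtain C1 :: nat where C1: "12288 / s \<le> 2 ^ C1"
    using real_arch_pow[of 2 "12288 / s"] by (auto intro: less_imp_le)
  define A where "A = 1 + 2 * ln (256 / s)"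
  have A: "A \<ge> 1" using s by (simp add: A_def field_simps)
  \<comment> \<open>The early scales contribute \<open>12 * C1 * D\<^sup>2\<close> roots, which \<open>\<delta>\<close> keeps below \<open>\<epsilon> / 4 * ln n\<close>.\<close>
  define \<delta> where "\<delta> = min 1 (sqrt (\<epsilon> / (48 * (real C1 + 1))))"
  have \<delta>: "0 < \<delta>" "\<delta> \<le> 1" using \<epsilon> by (auto simp: \<delta>_def)
  have \<delta>2: "48 * real C1 * \<delta>\<^sup>2 \<le> \<epsilon>"
  proof -
    have "\<delta>\<^sup>2 \<le> (sqrt (\<epsilon> / (48 * (real C1 + 1))))\<^sup>2" using \<delta> by (intro power_mono) (auto simp: \<delta>_def)
    also have "\<dots> = \<epsilon> / (48 * (real C1 + 1))" using \<epsilon> by simp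
    finally have "48 * (real C1 + 1) * \<delta>\<^sup>2 \<le> \<epsilon>" by (simp add: field_simps)
    moreover have "48 * real C1 * \<delta>\<^sup>2 \<le> 48 * (real C1 + 1) * \<delta>\<^sup>2" by (intro mult_right_mono) auto
    ultimately show ?thesis by linarith
  qed
  define \<theta> where "\<theta> = 1 - s\<^sup>2 / 128"
  have s2: "0 < s\<^sup>2" "s\<^sup>2 \<le> 1" using s by (auto simp: power_le_one)
  define \<tau> where "\<tau> = max (7/8) \<theta>"
  have \<theta>: "0 \<le> \<theta>" "\<theta> < 1" using s2 by (auto simp: \<theta>_def)
  have \<tau>: "7/8 \<le> \<tau>" "\<theta> \<le> \<tau>" "\<tau> < 1" using \<theta> by (auto simp: \<tau>_def)
  \<comment> \<open>The decay rate in \<open>L = sqrt (ln n)\<close> of the powers \<open>\<tau>^D\<close>.\<close>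
  define \<kappa> where "\<kappa> = - \<delta> * ln \<tau>"
  have \<kappa>: "\<kappa> > 0" using \<tau> \<delta> by (auto simp: \<kappa>_def mult_less_0_iff)
  \<comment> \<open>Small enough for the quadratic term in the Chernoff exponent to be at most half of the linear one.\<close>
  define l where "l = min (1 / 10) (\<epsilon> / 7188480)"
  have l: "0 < l" "l \<le> 1 / 10" "l \<le> \<epsilon> / 7188480" using \<epsilon> by (auto simp: l_def)
  define \<kappa>' where "\<kappa>' = l * \<epsilon> / 200"
  have \<kappa>': "\<kappa>' > 0" using l \<epsilon> by (simp add: \<kappa>'_def)
  define c where "c = min (\<kappa> / 2) (\<kappa>' / 2)"
  have c: "c > 0" using \<kappa> \<kappa>' by (simp add: c_def)
  define D where "D L = nat \<lfloor>\<delta> * L\<rfloor>" for L :: real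
  have Dlim: "filterlim D at_top at_top"
  proof -
    have "filterlim (\<lambda>L. \<delta> * L) at_top at_top" using \<delta> by real_asymp
    then show ?thesis unfolding D_def
      by (intro filterlim_compose[OF filterlim_nat_sequentially] filterlim_compose[OF filterlim_floor_sequentially])
  qed
  have "eventually (\<lambda>D::nat. D \<ge> 1) sequentially" by (rule eventually_ge_at_top)
  note e1 = filterlim_iff[THEN iffD1, OF Dlim, rule_format, OF this]
  have "(\<lambda>D::nat. (7/8 :: real) ^ D) \<longlonglongrightarrow> 0" by real_asymp
  then have "eventually (\<lambda>D::nat. (7/8 :: real) ^ D < s) sequentially" by (rule order_tendstoD) (use s in simp)
  note e2 = filterlim_iff[THEN iffD1, OF Dlim, rule_format, OF this]
  have "(\<lambda>D::nat. 192000 * (real D * (7/8 :: real) ^ D)) \<longlonglongrightarrow> 0" by real_asymp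
  then have "eventually (\<lambda>D::nat. 192000 * (real D * (7/8 :: real) ^ D) < \<epsilon>) sequentially" by (rule order_tendstoD) (use \<epsilon> in simp)
  note e3 = filterlim_iff[THEN iffD1, OF Dlim, rule_format, OF this]
  have e4: "eventually (\<lambda>L::real. A * exp (4 * L) \<le> exp (L\<^sup>2)) at_top"
    using A by real_asymp
  have e5: "eventually (\<lambda>L::real. L \<le> \<epsilon> / 4 * L\<^sup>2) at_top" using \<epsilon> by real_asymp
  have e6: "eventually (\<lambda>L::real. (36 * L + 50080 * L\<^sup>2 + 100) / \<tau> * exp (- \<kappa> * L) \<le> exp (- (\<kappa> / 2) * L) / 2) at_top"
    using \<kappa> \<tau> by real_asymp
  have e7: "eventually (\<lambda>L::real. 25 * L * exp (1124 - \<kappa>' * L) \<le> exp (- (\<kappa>' / 2) * L) / 2) at_top"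
    using \<kappa>' by real_asymp
  have e8: "eventually (\<lambda>L::real. L > 0) at_top" by (rule eventually_gt_at_top)
  obtain L0 where L0: "\<And>L. L \<ge> L0 \<Longrightarrow> 1 \<le> D L \<and> (7/8) ^ D L < s \<and> 192000 * (real (D L) * (7/8) ^ D L) < \<epsilon>
      \<and> A * exp (4 * L) \<le> exp (L\<^sup>2) \<and> L \<le> \<epsilon> / 4 * L\<^sup>2
      \<and> (36 * L + 50080 * L\<^sup>2 + 100) / \<tau> * exp (- \<kappa> * L) \<le> exp (- (\<kappa> / 2) * L) / 2
      \<and> 25 * L * exp (1124 - \<kappa>' * L) \<le> exp (- (\<kappa>' / 2) * L) / 2 \<and> L > 0"
    using eventually_conj[OF e1 eventually_conj[OF e2 eventually_conj[OF e3 eventually_conj[OF e4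
       eventually_conj[OF e5 eventually_conj[OF e6 eventually_conj[OF e7 e8]]]]]]]
    unfolding eventually_at_top_linorder by blast
  define C where "C = max 1 (exp (c * L0))"
  have main: "measure M {\<omega> \<in> space M. integral\<^sup>L M (num_roots \<xi> n {0..1}) + \<epsilon> * ln (real n) \<le> num_roots \<xi> n {0..1} \<omega>}
      \<le> C * exp (- c * sqrt (ln (real n)))" if tame: "tame_coeffs M \<xi> s" and n: "n \<ge> 1" for M :: "'a measure" and \<xi> n
  proof -
    interpret tame_coeffs M \<xi> s by (rule tame)
    define L where "L = sqrt (ln (real n))"
    have L2: "L\<^sup>2 = ln (real n)" using n by (simp add: L_def)
    define N where "N \<omega> = real (nroots {0..1} (partial_poly {..n} \<omega>))" for \<omega>
    have NN: "num_roots \<xi> n {0..1} = N" by (rule ext) (simp add: N_def partial_poly_def num_roots_eq_nroots)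
    have mN[measurable]: "N \<in> borel_measurable M" unfolding N_def
      by (intro measurable_nroots_partial_poly sigma_compact_closed) simp
    have "prob {\<omega> \<in> space M. expectation N + \<epsilon> * L\<^sup>2 \<le> N \<omega>} \<le> C * exp (- c * L)"
    proof (cases "L \<ge> L0")
      case False
      have "1 \<le> exp (c * L0 + - c * L)" using False c by simp
      also have "\<dots> = exp (c * L0) * exp (- c * L)" by (simp only: exp_add)
      also have "\<dots> \<le> C * exp (- c * L)" by (intro mult_right_mono) (auto simp: C_def)
      finally show ?thesis using prob_le_1 by (rule order.trans[rotated])
    next
      case True
      define d where "d = D L"
      define y where "y = (7/8 :: real) ^ d"
      have f: "1 \<le> d" "y < s" "192000 * (real d * y) < \<epsilon>" "A * exp (4 * L) \<le> exp (L\<^sup>2)" "L \<le> \<epsilon> / 4 * L\<^sup>2"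
        "(36 * L + 50080 * L\<^sup>2 + 100) / \<tau> * exp (- \<kappa> * L) \<le> exp (- (\<kappa> / 2) * L) / 2"
        "25 * L * exp (1124 - \<kappa>' * L) \<le> exp (- (\<kappa>' / 2) * L) / 2" "L > 0"
        using L0[OF True] unfolding d_def y_def by auto
      have dL: "real d \<le> \<delta> * L" "\<delta> * L < real d + 1"
        using f(8) \<delta> by (auto simp: d_def D_def mult_nonneg_nonneg)
      have dL': "real d \<le> L" proof -
        have "\<delta> * L \<le> 1 * L" using \<delta> f(8) by (intro mult_right_mono) auto
        then show ?thesis using dL(1) by simp
      qed
      have y01: "0 < y" "y \<le> 1" by (auto simp: y_def intro: power_le_one)
      have y3: "y ^ 3 \<le> s"
      proof -
        have "y ^ 3 \<le> y ^ 1" using y01 by (intro power_decreasing) auto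
        then show ?thesis using f(2) by simp
      qed
      have n10: "A * 10 ^ d \<le> real n"
      proof -
        have "(10::real) ^ d \<le> (exp 4) ^ d"
        proof (intro power_mono)
          have "10 \<le> (2::real) ^ 4" by simp
          also have "\<dots> \<le> exp 1 ^ 4" using exp_ge_add_one_self[of 1] by (intro power_mono) auto
          also have "\<dots> = exp 4" by (simp flip: exp_of_nat_mult)
          finally show "(10::real) \<le> exp 4" .
        qed simp
        also have "\<dots> = exp (4 * real d)" by (simp add: mult.commute flip: exp_of_nat_mult)
        also have "\<dots> \<le> exp (4 * L)" using dL' by simp
        finally have "A * 10 ^ d \<le> A * exp (4 * L)" using A by (intro mult_left_mono) auto
        also have "\<dots> \<le> exp (L\<^sup>2)" by (rule f)
        also have "\<dots> = real n" using n by (simp add: L2)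
        finally show ?thesis .
      qed
      obtain K where K: "1 \<le> real n * (7/8) ^ K" "real n * (7/8) ^ K \<le> 8 / 7" "real K \<le> 8 * ln (real n)"
        using last_scale_exists[OF n] .
      have K12: "12 * d \<le> K"
      proof (rule ccontr)
        assume "\<not> 12 * d \<le> K"
        then have "(7/8 :: real) ^ (12 * d) \<le> (7/8) ^ Suc K" by (intro power_decreasing) auto
        also have "\<dots> = 7/8 * (7/8) ^ K" by simp
        finally have "real n * (7/8) ^ (12 * d) \<le> real n * (7/8 * (7/8) ^ K)" by (intro mult_left_mono) auto
        also have "\<dots> \<le> 1" using K(2) by simp
        finally have "real n * ((7/8) ^ 12) ^ d \<le> 1" by (simp add: power_mult)
        have "2 \<le> (2::real) ^ d" using f(1) power_increasing[of 1 d "2::real"] by simp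
        also have "\<dots> \<le> (10 * (7/8) ^ 12) ^ d" by (intro power_mono) (auto simp: power_divide)
        also have "\<dots> = 10 ^ d * ((7/8) ^ 12) ^ d" by (simp only: power_mult_distrib)
        also have "\<dots> \<le> real n * ((7/8) ^ 12) ^ d"
        proof (rule mult_right_mono)
          have "1 * 10 ^ d \<le> A * 10 ^ d" using A by (intro mult_right_mono) auto
          then have "10 ^ d \<le> A * 10 ^ d" by (simp only: mult_1)
          then show "10 ^ d \<le> real n" using n10 by (rule order.trans)
        qed simp
        finally show False using \<open>real n * ((7/8) ^ 12) ^ d \<le> 1\<close> by linarith
      qed
      define w where "w = 24 * d + 1"
      define u where "u = \<epsilon> / 4 * L\<^sup>2 / real w"
      have w0: "0 < real w" by (simp add: w_def)
      \<comment> \<open>Each of the four terms is at most \<open>\<epsilon> / 4 * ln n\<close>.\<close>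
      define T where "T = 12 * real d * real (C1 * d) + real K * (real d * (6000 * y)) + real w * u + real d"
      have bound: "prob {\<omega> \<in> space M. expectation N + T \<le> N \<omega>}
        \<le> 12 * real d * (2 * y + \<theta> ^ d) + real K * (6000 * y + 260 * (3 / 4) ^ d)
          + real w * exp (l\<^sup>2 * 112320 * (real K / real w + 1) - l * u) + 100 * (3 / 4) ^ d"
        unfolding T_def N_def \<theta>_def y_def w_def
      proof (rule unit_interval_bound)
        show "\<exists>da. (1 - 15 / 16 * (7/8) ^ k) ^ da \<le> s / 256 \<and> da * d \<le> n \<and>
          1 / ((7/8) ^ d * sqrt ((7/8) ^ k)) \<le> 2 ^ (C1 * d) * ((1 - 15 / 16 * (7/8) ^ k) ^ da) ^ d" if "k < 12 * d" for k
          by (rule small_scale_parameters[OF s C1 n10[unfolded A_def] that])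
        show "((7/8) ^ d) ^ 3 \<le> s" using y3 by (simp add: y_def)
      qed (use f(1) K12 K l in auto)
      have K8: "real K \<le> 8 * L\<^sup>2" using K(3) L2 by simp
      have TL: "T \<le> \<epsilon> * L\<^sup>2"
      proof -
        have "real d * real d \<le> (\<delta> * L) * (\<delta> * L)" using dL \<delta> f(8) by (intro mult_mono) auto
        then have "12 * real C1 * (real d * real d) \<le> 12 * real C1 * ((\<delta> * L) * (\<delta> * L))" by (intro mult_left_mono) auto
        also have "\<dots> = (48 * real C1 * \<delta>\<^sup>2) * (L\<^sup>2 / 4)" by (simp add: power2_eq_square)
        also have "\<dots> \<le> \<epsilon> * (L\<^sup>2 / 4)" using \<delta>2 by (intro mult_right_mono) auto
        finally have t1: "12 * real d * real (C1 * d) \<le> \<epsilon> / 4 * L\<^sup>2" by (simp add: mult_ac)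
        have "real K * (real d * (6000 * y)) \<le> (8 * L\<^sup>2) * (real d * (6000 * y))"
          using K8 y01 by (intro mult_right_mono) auto
        also have "\<dots> = (192000 * (real d * y)) * (L\<^sup>2 / 4)" by simp
        also have "\<dots> \<le> \<epsilon> * (L\<^sup>2 / 4)" using f(3) by (intro mult_right_mono) auto
        finally have t2: "real K * (real d * (6000 * y)) \<le> \<epsilon> / 4 * L\<^sup>2" by simp
        have t3: "real w * u = \<epsilon> / 4 * L\<^sup>2" using w0 by (simp add: u_def)
        have t4: "real d \<le> \<epsilon> / 4 * L\<^sup>2" using dL' f(5) by linarith
        show ?thesis unfolding T_def using t1 t2 t3 t4 by linarith
      qed
      have "prob {\<omega> \<in> space M. expectation N + \<epsilon> * L\<^sup>2 \<le> N \<omega>} \<le> prob {\<omega> \<in> space M. expectation N + T \<le> N \<omega>}"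
        using TL by (intro finite_measure_mono) auto
      also note bound
      also have "12 * real d * (2 * y + \<theta> ^ d) + real K * (6000 * y + 260 * (3 / 4) ^ d)
          + real w * exp (l\<^sup>2 * 112320 * (real K / real w + 1) - l * u) + 100 * (3 / 4) ^ d \<le> exp (- c * L)"
      proof -
        have tp: "y \<le> \<tau> ^ d" "\<theta> ^ d \<le> \<tau> ^ d" "(3/4) ^ d \<le> \<tau> ^ d"
          unfolding y_def using \<tau> \<theta> by (auto intro!: power_mono)
        have \<tau>d: "\<tau> ^ d \<le> exp (- \<kappa> * L) / \<tau>"
        proof -
          have "\<tau> ^ Suc d = exp (real (Suc d) * ln \<tau>)" using \<tau> by (simp add: exp_of_nat_mult del: of_nat_Suc power_Suc)
          also have "\<dots> \<le> exp (\<delta> * L * ln \<tau>)"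
            using dL(2) \<tau> by (intro iffD2[OF exp_le_cancel_iff] mult_right_mono_neg) auto
          also have "\<dots> = exp (- \<kappa> * L)" by (simp add: \<kappa>_def mult_ac)
          finally have "\<tau> * \<tau> ^ d \<le> exp (- \<kappa> * L)" by simp
          then show ?thesis using \<tau> by (simp add: field_simps)
        qed
        have a1: "12 * real d * (2 * y + \<theta> ^ d) \<le> 12 * L * (3 * \<tau> ^ d)"
          using dL' tp y01 \<theta> f(8) by (intro mult_mono) auto
        have a2: "real K * (6000 * y + 260 * (3 / 4) ^ d) \<le> 8 * L\<^sup>2 * (6260 * \<tau> ^ d)"
          using K8 tp y01 by (intro mult_mono) auto
        have "12 * real d * (2 * y + \<theta> ^ d) + real K * (6000 * y + 260 * (3 / 4) ^ d) + 100 * (3 / 4) ^ d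
           \<le> (36 * L + 50080 * L\<^sup>2 + 100) * \<tau> ^ d"
          using a1 a2 tp(3) by (simp add: algebra_simps)
        also have "\<dots> \<le> (36 * L + 50080 * L\<^sup>2 + 100) * (exp (- \<kappa> * L) / \<tau>)"
          using \<tau>d f(8) by (intro mult_left_mono) (auto intro!: add_nonneg_nonneg)
        also have "\<dots> \<le> exp (- (\<kappa> / 2) * L) / 2" using f(6) by simp
        also have "\<dots> \<le> exp (- c * L) / 2" using f(8) by (auto simp: c_def intro!: divide_right_mono mult_right_mono)
        finally have b1: "12 * real d * (2 * y + \<theta> ^ d) + real K * (6000 * y + 260 * (3 / 4) ^ d) + 100 * (3 / 4) ^ d
           \<le> exp (- c * L) / 2" .
        have w25: "real w \<le> 25 * L" using dL' f(1) by (simp add: w_def)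
        have "real w * exp (l\<^sup>2 * 112320 * (real K / real w + 1) - l * u) \<le> (25 * L) * exp (1124 - \<kappa>' * L)"
          unfolding u_def \<kappa>'_def
          using exp_error_bound[OF l w0 w25 _ K8 f(8)] w25 f(8) by (intro mult_mono) auto
        also have "\<dots> \<le> exp (- (\<kappa>' / 2) * L) / 2" by (rule f)
        also have "\<dots> \<le> exp (- c * L) / 2" using f(8) by (auto simp: c_def intro!: divide_right_mono mult_right_mono)
        finally show ?thesis using b1 by linarith
      qed
      also have "\<dots> \<le> C * exp (- c * L)" by (simp add: C_def)
      finally show ?thesis .
    qed
    then show ?thesis unfolding L2 unfolding NN L_def .
  qed
  show ?thesis using c main by (intro exI[of _ c] conjI exI[of _ C] allI impI) (auto simp: C_def)
qed

section \<open>Characteristic functions near the origin\<close>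

text \<open>
  Interpolation between the two terms of the minimum: their common factor \<open>x\<^sup>2\<close> is multiplied by 1 or
  by \<open>\<bar>t * x\<bar>\<close>, and the smaller of these is at most \<open>\<bar>t * x\<bar> powr e\<close>.
\<close>
lemma min_square_cube_le:
  fixes x t e :: real
  assumes e: "0 < e" "e \<le> 1"
  shows "min (6 * x\<^sup>2) (\<bar>t\<bar> * \<bar>x\<bar> ^ 3) \<le> 6 * \<bar>t\<bar> powr e * \<bar>x\<bar> powr (2 + e)"
proof (cases "x = 0 \<or> t = 0")
  case True
  then show ?thesis using e by auto
next
  case False
  then have pos: "0 < \<bar>x\<bar>" "0 < \<bar>t\<bar>" by auto
  define v where "v = \<bar>t\<bar> * \<bar>x\<bar>"
  have v: "v > 0" using pos by (simp add: v_def)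
  have x2: "\<bar>x\<bar> powr 2 = x\<^sup>2" using pos by (simp add: powr_numeral)
  have rhs: "6 * \<bar>t\<bar> powr e * \<bar>x\<bar> powr (2 + e) = 6 * x\<^sup>2 * v powr e"
    using pos by (simp add: v_def powr_add powr_mult x2)
  show ?thesis
  proof (cases "v \<le> 1")
    case True
    have "v powr 1 \<le> v powr e" using True v e by (intro powr_mono') auto
    then have "x\<^sup>2 * v \<le> 6 * x\<^sup>2 * v powr e" using v by (intro mult_mono) auto
    moreover have "\<bar>t\<bar> * \<bar>x\<bar> ^ 3 = x\<^sup>2 * v" by (simp add: v_def power2_eq_square power3_eq_cube)
    ultimately show ?thesis unfolding rhs by (simp add: min.coboundedI2)
  next
    case False
    then have "1 \<le> v powr e" using e by (intro ge_one_powr_ge_zero) auto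
    then have "6 * x\<^sup>2 * 1 \<le> 6 * x\<^sup>2 * v powr e" by (intro mult_left_mono) auto
    then show ?thesis unfolding rhs by (simp add: min.coboundedI1)
  qed
qed

text \<open>
  The error in \<open>1 - t\<^sup>2 / 2\<close> is of order \<open>t\<^sup>2 * \<bar>t\<bar> powr e\<close> uniformly in \<open>i\<close>, hence at most
  \<open>t\<^sup>2 / 4\<close> for small \<open>t\<close>.
\<close>
lemma (in prob_space) exists_char_radius:
  fixes \<xi> :: "nat \<Rightarrow> 'a \<Rightarrow> real"
  assumes rv: "\<And>i. \<xi> i \<in> borel_measurable M"
    and mean: "\<And>i. expectation (\<xi> i) = 0"
    and sq: "\<And>i. integrable M (\<lambda>\<omega>. (\<xi> i \<omega>)\<^sup>2)" "\<And>i. expectation (\<lambda>\<omega>. (\<xi> i \<omega>)\<^sup>2) = 1"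
    and e0: "\<epsilon>\<^sub>0 > 0" and mom: "unif_bounded_moments M \<xi> (2 + \<epsilon>\<^sub>0)"
  shows "\<exists>s. 0 < s \<and> s \<le> 1 \<and> (\<forall>i t. \<bar>t\<bar> \<le> s \<longrightarrow> cmod (char (distr M borel (\<xi> i)) t) \<le> exp (- t\<^sup>2 / 4))"
proof -
  note rv[measurable]
  obtain C0 where C0: "\<And>i. integrable M (\<lambda>\<omega>. \<bar>\<xi> i \<omega>\<bar> powr (2 + \<epsilon>\<^sub>0))"
    "\<And>i. expectation (\<lambda>\<omega>. \<bar>\<xi> i \<omega>\<bar> powr (2 + \<epsilon>\<^sub>0)) \<le> C0"
    using mom by (auto simp: unif_bounded_moments_def)
  have C00: "0 \<le> C0"
  proof -
    have "0 \<le> expectation (\<lambda>\<omega>. \<bar>\<xi> 0 \<omega>\<bar> powr (2 + \<epsilon>\<^sub>0))" by (rule integral_nonneg_AE) auto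
    then show ?thesis using C0(2)[of 0] by linarith
  qed
  define e where "e = min \<epsilon>\<^sub>0 1"
  have e: "0 < e" "e \<le> 1" "e \<le> \<epsilon>\<^sub>0" using e0 by (auto simp: e_def)
  define a where "a = 1 / (4 * (1 + C0))"
  have a: "0 < a" using C00 by (simp add: a_def)
  define s where "s = min 1 (a powr (1 / e))"
  have s: "0 < s" "s \<le> 1" using a by (auto simp: s_def)
  have "cmod (char (distr M borel (\<xi> i)) t) \<le> exp (- t\<^sup>2 / 4)" if t: "\<bar>t\<bar> \<le> s" for i t
  proof -
    have te: "\<bar>t\<bar> powr e \<le> a"
    proof -
      have "\<bar>t\<bar> powr e \<le> (a powr (1 / e)) powr e" using t e by (intro powr_mono2) (auto simp: s_def)
      also have "\<dots> = a" using a e by (simp add: powr_powr)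
      finally show ?thesis .
    qed
    have pw: "\<bar>x\<bar> powr (2 + e) \<le> 1 + \<bar>x\<bar> powr (2 + \<epsilon>\<^sub>0)" for x :: real
    proof (cases "\<bar>x\<bar> \<le> 1")
      case True
      then have "\<bar>x\<bar> powr (2 + e) \<le> 1" using e by (intro powr_le1) auto
      then show ?thesis by (simp add: add_increasing2)
    next
      case False
      then have "\<bar>x\<bar> powr (2 + e) \<le> \<bar>x\<bar> powr (2 + \<epsilon>\<^sub>0)" using e by (intro powr_mono) auto
      then show ?thesis by simp
    qed
    have "expectation (\<lambda>\<omega>. min (6 * (\<xi> i \<omega>)\<^sup>2) (\<bar>t\<bar> * \<bar>\<xi> i \<omega>\<bar> ^ 3))
        \<le> expectation (\<lambda>\<omega>. 6 * a * (1 + \<bar>\<xi> i \<omega>\<bar> powr (2 + \<epsilon>\<^sub>0)))"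
    proof (rule integral_mono)
      show "integrable M (\<lambda>\<omega>. min (6 * (\<xi> i \<omega>)\<^sup>2) (\<bar>t\<bar> * \<bar>\<xi> i \<omega>\<bar> ^ 3))"
        by (rule Bochner_Integration.integrable_bound[of M "\<lambda>\<omega>. 6 * (\<xi> i \<omega>)\<^sup>2"]) (use sq in auto)
      show "integrable M (\<lambda>\<omega>. 6 * a * (1 + \<bar>\<xi> i \<omega>\<bar> powr (2 + \<epsilon>\<^sub>0)))" using C0(1) by simp
      fix \<omega>
      have "min (6 * (\<xi> i \<omega>)\<^sup>2) (\<bar>t\<bar> * \<bar>\<xi> i \<omega>\<bar> ^ 3) \<le> 6 * \<bar>t\<bar> powr e * \<bar>\<xi> i \<omega>\<bar> powr (2 + e)"
        by (rule min_square_cube_le[OF e(1,2)])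
      also have "\<dots> \<le> 6 * a * (1 + \<bar>\<xi> i \<omega>\<bar> powr (2 + \<epsilon>\<^sub>0))"
        using te pw a by (intro mult_mono) auto
      finally show "min (6 * (\<xi> i \<omega>)\<^sup>2) (\<bar>t\<bar> * \<bar>\<xi> i \<omega>\<bar> ^ 3) \<le> 6 * a * (1 + \<bar>\<xi> i \<omega>\<bar> powr (2 + \<epsilon>\<^sub>0))" .
    qed
    also have "\<dots> = 6 * a * (1 + expectation (\<lambda>\<omega>. \<bar>\<xi> i \<omega>\<bar> powr (2 + \<epsilon>\<^sub>0)))"
      using C0(1) by (simp add: prob_space)
    also have "\<dots> \<le> 6 * a * (1 + C0)" using a C0(2) by (intro mult_left_mono) auto
    also have "\<dots> = 3 / 2"
    proof -
      have "a * (1 + C0) = 1 / 4" unfolding a_def using C00 by (simp add: divide_simps)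
      then show ?thesis by simp
    qed
    finally have E: "expectation (\<lambda>\<omega>. min (6 * (\<xi> i \<omega>)\<^sup>2) (\<bar>t\<bar> * \<bar>\<xi> i \<omega>\<bar> ^ 3)) \<le> 3 / 2" .
    have "cmod (char (distr M borel (\<xi> i)) t - (1 - t\<^sup>2 * 1 / 2))
      \<le> (t\<^sup>2 / 6) * expectation (\<lambda>\<omega>. min (6 * (\<xi> i \<omega>)\<^sup>2) (\<bar>t\<bar> * \<bar>\<xi> i \<omega>\<bar> ^ 3))"
      using expectation_abs_le_sqrt(1)[OF rv sq(1)] sq mean
      by (intro char_approx3') auto
    also have "\<dots> \<le> (t\<^sup>2 / 6) * (3 / 2)" using E by (intro mult_left_mono) auto
    finally have d: "cmod (char (distr M borel (\<xi> i)) t - complex_of_real (1 - t\<^sup>2 / 2)) \<le> t\<^sup>2 / 4" by simp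
    have "t\<^sup>2 \<le> 1" using t s by (simp add: abs_square_le_1)
    then have "cmod (complex_of_real (1 - t\<^sup>2 / 2)) = 1 - t\<^sup>2 / 2" unfolding norm_of_real by simp
    then have "cmod (char (distr M borel (\<xi> i)) t) \<le> 1 - t\<^sup>2 / 4"
      using d norm_triangle_sub[of "char (distr M borel (\<xi> i)) t" "complex_of_real (1 - t\<^sup>2 / 2)"] by linarith
    also have "\<dots> \<le> exp (- t\<^sup>2 / 4)" using exp_ge_add_one_self[of "- t\<^sup>2 / 4"] by simp
    finally show ?thesis .
  qed
  then show ?thesis using s by blast
qed

section \<open>Symmetries\<close>

text \<open>
  An instance of grouping independent variables into disjoint blocks, all of them singletons.
\<close>
lemma (in prob_space) indep_vars_reindex_inj:
  fixes X :: "'i \<Rightarrow> 'a \<Rightarrow> real"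
  assumes ind: "indep_vars (\<lambda>_. borel) X UNIV" and inj: "inj \<pi>"
  shows "indep_vars (\<lambda>_. borel) (\<lambda>i. X (\<pi> i)) UNIV"
proof -
  have "disjoint_family_on (\<lambda>i. {\<pi> i}) UNIV"
    using inj by (auto simp: disjoint_family_on_def inj_def)
  then have "indep_vars (\<lambda>i. PiM {\<pi> i} (\<lambda>_. borel)) (\<lambda>i \<omega>. restrict (\<lambda>j. X j \<omega>) {\<pi> i}) UNIV"
    by (intro indep_vars_restrict[OF ind]) auto
  then have "indep_vars (\<lambda>_. borel) (\<lambda>i \<omega>. restrict (\<lambda>j. X j \<omega>) {\<pi> i} (\<pi> i)) UNIV"
    by (rule indep_vars_compose2) (rule measurable_component_singleton, simp)
  then show ?thesis by simp
qed

context tame_coeffs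
begin

lemma tame_coeffs_reindex:
  assumes "inj \<pi>"
  shows "tame_coeffs M (\<lambda>i. \<xi> (\<pi> i)) s"
  by (intro_locales, unfold_locales)
     (use indep_vars_reindex_inj[OF indep assms] mean sq_integrable sq_mean s_pos s_le_1 char_le in auto)

lemma tame_coeffs_alternate: "tame_coeffs M (\<lambda>i \<omega>. (-1) ^ i * \<xi> i \<omega>) s"
proof (intro_locales, unfold_locales)
  show "indep_vars (\<lambda>_. borel) (\<lambda>i \<omega>. (-1) ^ i * \<xi> i \<omega>) UNIV"
    by (rule indep_vars_compose2[OF indep]) simp
  show "cmod (char (distr M borel (\<lambda>\<omega>. (-1) ^ i * \<xi> i \<omega>)) t) \<le> exp (- t\<^sup>2 / 4)" if "\<bar>t\<bar> \<le> s" for i t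
  proof -
    have "char (distr M borel (\<lambda>\<omega>. (-1) ^ i * \<xi> i \<omega>)) t = char (distr M borel (\<xi> i)) ((-1) ^ i * t)"
      unfolding char_def by (subst (1 2) integral_distr) (auto simp: mult_ac)
    moreover have "\<bar>(-1) ^ i * t\<bar> = \<bar>t\<bar>" by (simp add: abs_mult power_abs)
    then have "cmod (char (distr M borel (\<xi> i)) ((-1) ^ i * t)) \<le> exp (- ((-1) ^ i * t)\<^sup>2 / 4)"
      using that by (intro char_le) simp
    moreover have "((-1) ^ i * t)\<^sup>2 = t\<^sup>2" by (simp add: power_mult_distrib flip: power_mult)
    ultimately show ?thesis by simp
  qed
  show "expectation (\<lambda>\<omega>. (-1) ^ i * \<xi> i \<omega>) = 0" for i using mean[of i] by simp
  have "((-1) ^ i * x)\<^sup>2 = x\<^sup>2" for i and x :: real by (simp add: power_mult_distrib flip: power_mult)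
  then show "integrable M (\<lambda>\<omega>. ((-1) ^ i * \<xi> i \<omega>)\<^sup>2)" "expectation (\<lambda>\<omega>. ((-1) ^ i * \<xi> i \<omega>)\<^sup>2) = 1" for i
    using sq_integrable sq_mean by auto
qed (use s_pos s_le_1 in auto)

lemma integrable_num_roots:
  assumes "infinite S" "sigma_compact S"
  shows "integrable M (num_roots \<xi> n S)"
proof (rule integrable_const_bound[where B = "real n"])
  have "nroots S (coeff_poly {..n} a) \<le> n" for a
    by (rule order.trans[OF nroots_le_degree[OF assms(1)] degree_coeff_poly]) simp
  then show "AE \<omega> in M. norm (num_roots \<xi> n S \<omega>) \<le> real n" by (simp add: num_roots_eq_nroots)
  show "num_roots \<xi> n S \<in> borel_measurable M"
    using measurable_nroots_partial_poly[OF assms(2), of "{..n}"] unfolding partial_poly_def num_roots_eq_nroots .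
qed

end

lemma nroots_bij:
  assumes "bij_betw g S T" "\<And>x. x \<in> S \<Longrightarrow> poly p x = 0 \<longleftrightarrow> poly q (g x) = 0"
  shows "nroots S p = nroots T q"
  unfolding nroots_def
proof (rule bij_betw_same_card[of g])
  show "bij_betw g {x \<in> S. poly p x = 0} {x \<in> T. poly q x = 0}"
    using assms by (auto simp: bij_betw_def inj_on_def)
qed

lemma num_roots_uminus:
  "num_roots (\<lambda>i \<omega>. (-1) ^ i * \<xi> i \<omega>) n (uminus ` S) \<omega> = num_roots \<xi> n S \<omega>"
proof -
  have "nroots S (coeff_poly {..n} (\<lambda>i. \<xi> i \<omega>)) = nroots (uminus ` S) (coeff_poly {..n} (\<lambda>i. (-1) ^ i * \<xi> i \<omega>))"
  proof (rule nroots_bij)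
    show "bij_betw uminus S (uminus ` S)" by (auto simp: bij_betw_def inj_on_def)
    have "(-1) ^ i * a * (- x) ^ i = a * x ^ i" for i and a x :: real
      by (subst power_minus) (simp flip: power_mult_distrib)
    then show "poly (coeff_poly {..n} (\<lambda>i. \<xi> i \<omega>)) x = 0 \<longleftrightarrow> poly (coeff_poly {..n} (\<lambda>i. (-1) ^ i * \<xi> i \<omega>)) (- x) = 0" for x
      by (simp only: poly_coeff_poly)
  qed
  then show ?thesis by (simp add: num_roots_eq_nroots)
qed

text \<open>
  The identity above \<open>n\<close>, so that the map is injective on all indices.
\<close>
definition reversal :: "nat \<Rightarrow> nat \<Rightarrow> nat" where
  "reversal n i = (if i \<le> n then n - i else i)"

lemma inj_reversal: "inj (reversal n)"
  by (rule injI) (auto simp: reversal_def split: if_splits)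

lemma nroots_reverse:
  "nroots {0<..1} (coeff_poly {..n} (\<lambda>i. a (reversal n i))) = nroots {1..} (coeff_poly {..n} a)"
proof (rule nroots_bij)
  show "bij_betw inverse {0<..1} {1::real..}"
    by (rule bij_betwI[of _ _ _ inverse]) (auto simp: one_le_inverse_iff inverse_le_1_iff)
  fix x :: real assume x: "x \<in> {0<..1}"
  have "(\<Sum>i\<le>n. a (reversal n i) * x ^ i) = (\<Sum>i\<le>n. a i * x ^ (n - i))"
    by (rule sum.reindex_bij_witness[of _ "\<lambda>i. n - i" "\<lambda>i. n - i"]) (auto simp: reversal_def)
  also have "\<dots> = x ^ n * (\<Sum>i\<le>n. a i * inverse x ^ i)"
    unfolding sum_distrib_left
  proof (rule sum.cong)
    fix i assume i: "i \<in> {..n}"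
    then have "x ^ n = x ^ (n - i) * x ^ i" by (simp flip: power_add)
    then show "a i * x ^ (n - i) = x ^ n * (a i * inverse x ^ i)" using x by (simp add: power_inverse)
  qed simp
  finally show "poly (coeff_poly {..n} (\<lambda>i. a (reversal n i))) x = 0 \<longleftrightarrow> poly (coeff_poly {..n} a) (inverse x) = 0"
    using x by (simp add: poly_coeff_poly)
qed

text \<open>
  The infiniteness assumptions make the convention for the zero polynomial consistent: all counts
  involved are 0, except that of a singleton.
\<close>
lemma nroots_Un_bounds:
  assumes AB: "A \<inter> B \<subseteq> {z}" and inf: "infinite A"
  shows "nroots (A \<union> B) p \<le> nroots A p + nroots B p"
    and "infinite B \<or> B = {z} \<Longrightarrow> nroots A p + nroots B p \<le> nroots (A \<union> B) p + 1"
proof -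
  have fin: "finite {x \<in> S. poly p x = 0}" if "p \<noteq> 0" for S
    by (rule finite_subset[OF _ poly_roots_finite[OF that]]) auto
  have un: "{x \<in> A \<union> B. poly p x = 0} = {x \<in> A. poly p x = 0} \<union> {x \<in> B. poly p x = 0}" by auto
  show "nroots (A \<union> B) p \<le> nroots A p + nroots B p"
  proof (cases "p = 0")
    case True
    then show ?thesis using inf by (simp add: nroots_def)
  next
    case False
    then show ?thesis unfolding nroots_def un by (intro card_Un_le)
  qed
  assume B: "infinite B \<or> B = {z}"
  show "nroots A p + nroots B p \<le> nroots (A \<union> B) p + 1"
  proof (cases "p = 0")
    case True
    then show ?thesis using inf B by (auto simp: nroots_def)
  next
    case False
    have "card ({x \<in> A. poly p x = 0} \<inter> {x \<in> B. poly p x = 0}) \<le> card {z}"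
      using AB by (intro card_mono) auto
    then show ?thesis
      unfolding nroots_def un using card_Un_Int[OF fin[OF False, of A] fin[OF False, of B]] by simp
  qed
qed

section \<open>Upper tails\<close>

definition log_upper_tail :: "'a measure \<Rightarrow> (nat \<Rightarrow> 'a \<Rightarrow> real) \<Rightarrow> bool" where
  "log_upper_tail M X \<longleftrightarrow> (\<forall>\<epsilon>>0. \<exists>c>0. \<exists>C>0. \<forall>n\<ge>1.
     measure M {\<omega> \<in> space M. integral\<^sup>L M (X n) + \<epsilon> * ln (real n) \<le> X n \<omega>} \<le> C * exp (- c * sqrt (ln (real n))))"

context prob_space
begin

text \<open>
  A bounded change is absorbed by halving \<open>\<epsilon>\<close> when \<open>ln n\<close> is large, and by the constant \<open>C\<close> otherwise.
\<close>
lemma log_upper_tail_perturb: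
  assumes X: "\<And>n. integrable M (X n)" and Y: "\<And>n. integrable M (Y n)" and tail: "log_upper_tail M Y"
    and close: "\<And>n \<omega>. \<bar>X n \<omega> - Y n \<omega>\<bar> \<le> b"
  shows "log_upper_tail M X"
  unfolding log_upper_tail_def
proof (intro allI impI)
  fix \<epsilon> :: real assume \<epsilon>: "\<epsilon> > 0"
  have "\<epsilon> / 2 > 0" using \<epsilon> by simp
  then obtain c C where cC: "c > 0" "C > 0" and bound: "\<And>n. n \<ge> 1 \<Longrightarrow>
     prob {\<omega> \<in> space M. expectation (Y n) + \<epsilon> / 2 * ln (real n) \<le> Y n \<omega>} \<le> C * exp (- c * sqrt (ln (real n)))"
    using tail unfolding log_upper_tail_def by meson
  define C' where "C' = max C (exp (c * sqrt (4 * b / \<epsilon>)))"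
  have "prob {\<omega> \<in> space M. expectation (X n) + \<epsilon> * ln (real n) \<le> X n \<omega>} \<le> C' * exp (- c * sqrt (ln (real n)))"
    if n: "n \<ge> 1" for n
  proof (cases "ln (real n) \<le> 4 * b / \<epsilon>")
    case True
    then have "sqrt (ln (real n)) \<le> sqrt (4 * b / \<epsilon>)" by simp
    then have "1 \<le> exp (c * sqrt (4 * b / \<epsilon>) + - c * sqrt (ln (real n)))" using cC by simp
    also have "\<dots> = exp (c * sqrt (4 * b / \<epsilon>)) * exp (- c * sqrt (ln (real n)))" by (simp only: exp_add)
    also have "\<dots> \<le> C' * exp (- c * sqrt (ln (real n)))" by (intro mult_right_mono) (auto simp: C'_def)
    finally show ?thesis using prob_le_1 by (rule order.trans[rotated])
  next
    case False
    then have b: "2 * b \<le> \<epsilon> / 2 * ln (real n)" using \<epsilon> by (simp add: field_simps)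
    have "expectation (Y n) \<le> expectation (\<lambda>\<omega>. X n \<omega> + b)"
      using X Y close[of n] by (intro integral_mono) (auto simp: abs_le_iff algebra_simps)
    then have E: "expectation (Y n) \<le> expectation (X n) + b" using X by (simp add: prob_space)
    note [measurable] = borel_measurable_integrable[OF Y]
    have "prob {\<omega> \<in> space M. expectation (X n) + \<epsilon> * ln (real n) \<le> X n \<omega>}
        \<le> prob {\<omega> \<in> space M. expectation (Y n) + \<epsilon> / 2 * ln (real n) \<le> Y n \<omega>}"
    proof (rule finite_measure_mono)
      show "{\<omega> \<in> space M. expectation (X n) + \<epsilon> * ln (real n) \<le> X n \<omega>}
        \<subseteq> {\<omega> \<in> space M. expectation (Y n) + \<epsilon> / 2 * ln (real n) \<le> Y n \<omega>}"
      proof safe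
        fix \<omega> assume "expectation (X n) + \<epsilon> * ln (real n) \<le> X n \<omega>"
        moreover have "\<epsilon> * ln (real n) = \<epsilon> / 2 * ln (real n) + \<epsilon> / 2 * ln (real n)" by simp
        moreover have "X n \<omega> \<le> Y n \<omega> + b" using close[of n \<omega>] by (simp add: abs_le_iff)
        ultimately show "expectation (Y n) + \<epsilon> / 2 * ln (real n) \<le> Y n \<omega>" using E b by linarith
      qed
    qed measurable
    also have "\<dots> \<le> C * exp (- c * sqrt (ln (real n)))" by (rule bound[OF n])
    also have "\<dots> \<le> C' * exp (- c * sqrt (ln (real n)))" by (intro mult_right_mono) (auto simp: C'_def)
    finally show ?thesis .
  qed
  moreover have "C' > 0" using cC by (simp add: C'_def)
  ultimately show "\<exists>c>0. \<exists>C>0. \<forall>n\<ge>1. prob {\<omega> \<in> space M. expectation (X n) + \<epsilon> * ln (real n) \<le> X n \<omega>} \<le> C * exp (- c * sqrt (ln (real n)))"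
    using cC(1) by blast
qed

lemma log_upper_tail_add:
  assumes X: "\<And>n. integrable M (X n)" "log_upper_tail M X" and Y: "\<And>n. integrable M (Y n)" "log_upper_tail M Y"
  shows "log_upper_tail M (\<lambda>n \<omega>. X n \<omega> + Y n \<omega>)"
  unfolding log_upper_tail_def
proof (intro allI impI)
  fix \<epsilon> :: real assume "\<epsilon> > 0"
  then have \<epsilon>: "\<epsilon> / 2 > 0" by simp
  obtain c1 C1 where 1: "c1 > 0" "C1 > 0" and b1: "\<And>n. n \<ge> 1 \<Longrightarrow>
     prob {\<omega> \<in> space M. expectation (X n) + \<epsilon> / 2 * ln (real n) \<le> X n \<omega>} \<le> C1 * exp (- c1 * sqrt (ln (real n)))"
    using X(2) \<epsilon> unfolding log_upper_tail_def by meson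
  obtain c2 C2 where 2: "c2 > 0" "C2 > 0" and b2: "\<And>n. n \<ge> 1 \<Longrightarrow>
     prob {\<omega> \<in> space M. expectation (Y n) + \<epsilon> / 2 * ln (real n) \<le> Y n \<omega>} \<le> C2 * exp (- c2 * sqrt (ln (real n)))"
    using Y(2) \<epsilon> unfolding log_upper_tail_def by meson
  define c where "c = min c1 c2"
  note [measurable] = borel_measurable_integrable[OF X(1)] borel_measurable_integrable[OF Y(1)]
  have "prob {\<omega> \<in> space M. expectation (\<lambda>\<omega>. X n \<omega> + Y n \<omega>) + \<epsilon> * ln (real n) \<le> X n \<omega> + Y n \<omega>}
      \<le> (C1 + C2) * exp (- c * sqrt (ln (real n)))" if n: "n \<ge> 1" for n
  proof -
    define E1 where "E1 = {\<omega> \<in> space M. expectation (X n) + \<epsilon> / 2 * ln (real n) \<le> X n \<omega>}"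
    define E2 where "E2 = {\<omega> \<in> space M. expectation (Y n) + \<epsilon> / 2 * ln (real n) \<le> Y n \<omega>}"
    have m: "E1 \<in> events" "E2 \<in> events" unfolding E1_def E2_def by measurable
    have "expectation (\<lambda>\<omega>. X n \<omega> + Y n \<omega>) = expectation (X n) + expectation (Y n)" using X Y by simp
    moreover have "\<epsilon> * ln (real n) = \<epsilon> / 2 * ln (real n) + \<epsilon> / 2 * ln (real n)" by simp
    ultimately have "{\<omega> \<in> space M. expectation (\<lambda>\<omega>. X n \<omega> + Y n \<omega>) + \<epsilon> * ln (real n) \<le> X n \<omega> + Y n \<omega>} \<subseteq> E1 \<union> E2"
      unfolding E1_def E2_def by (intro subsetI, unfold mem_Collect_eq Un_iff) linarith
    then have "prob {\<omega> \<in> space M. expectation (\<lambda>\<omega>. X n \<omega> + Y n \<omega>) + \<epsilon> * ln (real n) \<le> X n \<omega> + Y n \<omega>} \<le> prob (E1 \<union> E2)"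
      using m by (intro finite_measure_mono) auto
    also have "\<dots> \<le> prob E1 + prob E2" by (rule measure_Un_le[OF m])
    also have "\<dots> \<le> C1 * exp (- c1 * sqrt (ln (real n))) + C2 * exp (- c2 * sqrt (ln (real n)))"
      using b1[OF n] b2[OF n] unfolding E1_def E2_def by (rule add_mono)
    also have "\<dots> \<le> C1 * exp (- c * sqrt (ln (real n))) + C2 * exp (- c * sqrt (ln (real n)))"
      using 1 2 n by (intro add_mono mult_left_mono) (auto simp: c_def intro!: mult_right_mono)
    finally show ?thesis by (simp add: distrib_right)
  qed
  moreover have "c > 0" "C1 + C2 > 0" using 1 2 by (auto simp: c_def)
  ultimately show "\<exists>c>0. \<exists>C>0. \<forall>n\<ge>1. prob {\<omega> \<in> space M. expectation (\<lambda>\<omega>. X n \<omega> + Y n \<omega>) + \<epsilon> * ln (real n) \<le> X n \<omega> + Y n \<omega>}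
    \<le> C * exp (- c * sqrt (ln (real n)))" by blast
qed

end

lemma infinite_halfline: "infinite {a::real..}" "infinite {..a::real}"
  by (auto simp: infinite_Ici infinite_Iic)

context tame_coeffs
begin

text \<open>
  The coefficients may change with \<open>n\<close>, as they do under reversal.
\<close>
lemma log_upper_tail_unit:
  assumes "\<And>n. tame_coeffs M (\<eta> n) s"
  shows "log_upper_tail M (\<lambda>n. num_roots (\<eta> n) n {0..1})"
  unfolding log_upper_tail_def
proof (intro allI impI)
  fix \<epsilon> :: real assume "\<epsilon> > 0"
  from unit_interval_tail[OF s_pos s_le_1 this, where 'a = 'a]
  show "\<exists>c>0. \<exists>C>0. \<forall>n\<ge>1. prob {\<omega> \<in> space M. expectation (num_roots (\<eta> n) n {0..1}) + \<epsilon> * ln (real n) \<le> num_roots (\<eta> n) n {0..1} \<omega>}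
     \<le> C * exp (- c * sqrt (ln (real n)))"
    using assms by meson
qed

lemma log_upper_tail_01: "log_upper_tail M (\<lambda>n. num_roots \<xi> n {0..1})"
  using log_upper_tail_unit[of "\<lambda>_. \<xi>"] tame_coeffs_axioms by simp

text \<open>
  Inversion maps \<open>[1, \<infinity>)\<close> to \<open>(0, 1]\<close>; the point 0, a root of the reversed polynomial when the leading
  coefficient vanishes, changes the count by at most 1.
\<close>
lemma log_upper_tail_ge1: "log_upper_tail M (\<lambda>n. num_roots \<xi> n {1..})"
proof (rule log_upper_tail_perturb[where b = 1])
  show "integrable M (num_roots \<xi> n {1..})" for n
    by (intro integrable_num_roots sigma_compact_closed infinite_halfline) auto
  have t: "tame_coeffs M (\<lambda>i. \<xi> (reversal n i)) s" for n by (rule tame_coeffs_reindex[OF inj_reversal])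
  show "log_upper_tail M (\<lambda>n. num_roots (\<lambda>i. \<xi> (reversal n i)) n {0..1})"
    by (rule log_upper_tail_unit[OF t])
  show "integrable M (num_roots (\<lambda>i. \<xi> (reversal n i)) n {0..1})" for n
    by (intro tame_coeffs.integrable_num_roots[OF t] sigma_compact_closed) (auto simp: infinite_Icc)
  fix n \<omega>
  define q where "q = coeff_poly {..n} (\<lambda>i. \<xi> (reversal n i) \<omega>)"
  have eq: "nroots {1..} (coeff_poly {..n} (\<lambda>i. \<xi> i \<omega>)) = nroots {0<..1} q"
    unfolding q_def by (rule nroots_reverse[symmetric])
  have set: "{0<..1} \<union> {0} = {0..1::real}" by auto
  have inf: "infinite {0<..1::real}" by (simp add: infinite_Ioc)
  have "nroots {0<..1} q \<le> nroots ({0<..1} \<union> {0}) q + 1" "nroots ({0<..1} \<union> {0}) q \<le> nroots {0<..1} q + 1"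
  proof -
    have "nroots {0} q \<le> 1" unfolding nroots_def by (rule order.trans[OF card_mono[of "{0}"]]) auto
    then show "nroots ({0<..1} \<union> {0}) q \<le> nroots {0<..1} q + 1"
      using nroots_Un_bounds(1)[OF _ inf, of "{0}" 0 q] by simp
    show "nroots {0<..1} q \<le> nroots ({0<..1} \<union> {0}) q + 1"
      using nroots_Un_bounds(2)[OF _ inf, of "{0}" 0 q] by simp
  qed
  then show "\<bar>num_roots \<xi> n {1..} \<omega> - num_roots (\<lambda>i. \<xi> (reversal n i)) n {0..1} \<omega>\<bar> \<le> 1"
    unfolding num_roots_eq_nroots eq q_def[symmetric] set by linarith
qed

lemma log_upper_tail_negative:
  assumes "\<And>\<xi>. tame_coeffs M \<xi> s \<Longrightarrow> log_upper_tail M (\<lambda>n. num_roots \<xi> n S)"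
  shows "log_upper_tail M (\<lambda>n. num_roots \<xi> n (uminus ` S))"
proof -
  have "num_roots \<xi> n (uminus ` S) = num_roots (\<lambda>i \<omega>. (-1) ^ i * \<xi> i \<omega>) n S" for n
    using num_roots_uminus[of \<xi> n "uminus ` S"] by (intro ext) (simp add: image_image)
  then show ?thesis using assms[OF tame_coeffs_alternate] by simp
qed

lemma log_upper_tail_Un:
  assumes A: "log_upper_tail M (\<lambda>n. num_roots \<xi> n A)" "infinite A" "closed A"
    and B: "log_upper_tail M (\<lambda>n. num_roots \<xi> n B)" "infinite B" "closed B"
    and AB: "A \<inter> B \<subseteq> {z}"
  shows "log_upper_tail M (\<lambda>n. num_roots \<xi> n (A \<union> B))"
proof (rule log_upper_tail_perturb[where b = 1])
  have i: "integrable M (num_roots \<xi> n A)" "integrable M (num_roots \<xi> n B)" "integrable M (num_roots \<xi> n (A \<union> B))" for n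
    using A B by (auto intro!: integrable_num_roots sigma_compact_closed)
  then show "integrable M (num_roots \<xi> n (A \<union> B))" for n by simp
  show "integrable M (\<lambda>\<omega>. num_roots \<xi> n A \<omega> + num_roots \<xi> n B \<omega>)" for n using i by simp
  show "log_upper_tail M (\<lambda>n \<omega>. num_roots \<xi> n A \<omega> + num_roots \<xi> n B \<omega>)"
    by (rule log_upper_tail_add[OF i(1) A(1) i(2) B(1)])
  show "\<bar>num_roots \<xi> n (A \<union> B) \<omega> - (num_roots \<xi> n A \<omega> + num_roots \<xi> n B \<omega>)\<bar> \<le> 1" for n \<omega>
    using nroots_Un_bounds(1)[OF AB A(2), of "coeff_poly {..n} (\<lambda>i. \<xi> i \<omega>)"]
      nroots_Un_bounds(2)[OF AB A(2), of "coeff_poly {..n} (\<lambda>i. \<xi> i \<omega>)"] B(2)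
    unfolding num_roots_eq_nroots by linarith
qed

lemma log_upper_tail_all:
  assumes "S \<in> {UNIV, {0..1}, {1..}, {-1..0}, {..-1}}"
  shows "log_upper_tail M (\<lambda>n. num_roots \<xi> n S)"
proof -
  have neg: "uminus ` {0..1::real} = {-1..0}" "uminus ` {1::real..} = {..-1}" by auto
  have 1: "log_upper_tail M (\<lambda>n. num_roots \<xi> n {0..1})" by (rule log_upper_tail_01)
  have 2: "log_upper_tail M (\<lambda>n. num_roots \<xi> n {1..})" by (rule log_upper_tail_ge1)
  have 3: "log_upper_tail M (\<lambda>n. num_roots \<xi> n {-1..0})"
    using log_upper_tail_negative[of "{0..1}"] tame_coeffs.log_upper_tail_01 unfolding neg by blast
  have 4: "log_upper_tail M (\<lambda>n. num_roots \<xi> n {..-1})"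
    using log_upper_tail_negative[of "{1..}"] tame_coeffs.log_upper_tail_ge1 unfolding neg by blast
  have un: "{0..1} \<union> {1..} = {0::real..}" "{..-1} \<union> {-1..0} = {..0::real}" "{..0} \<union> {0..} = (UNIV :: real set)"
    by auto
  have 5: "log_upper_tail M (\<lambda>n. num_roots \<xi> n {0..})"
    using log_upper_tail_Un[OF 1 _ _ 2, of 1] unfolding un by (auto simp: infinite_Icc infinite_halfline)
  have 6: "log_upper_tail M (\<lambda>n. num_roots \<xi> n {..0})"
    using log_upper_tail_Un[OF 4 _ _ 3, of "-1"] unfolding un by (auto simp: infinite_Icc infinite_halfline)
  have 7: "log_upper_tail M (\<lambda>n. num_roots \<xi> n UNIV)"
  proof -
    have "{..0} \<inter> {0..} \<subseteq> {0::real}" by auto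
    from log_upper_tail_Un[OF 6 _ _ 5 _ _ this] show ?thesis unfolding un by (auto simp: infinite_halfline)
  qed
  show ?thesis using assms 1 2 3 4 7 by auto
qed

end

theorem theorem1p5:
  fixes M :: "'a measure" and \<xi> :: "nat \<Rightarrow> 'a \<Rightarrow> real" and \<epsilon>\<^sub>0 :: real
  assumes "prob_space M"
    and "prob_space.indep_vars M (\<lambda>_. borel) \<xi> UNIV"
    and "\<And>i. prob_space.expectation M (\<xi> i) = 0"
    and "\<And>i. prob_space.variance M (\<xi> i) = 1"
    and "\<epsilon>\<^sub>0 > 0"
    and "unif_bounded_moments M \<xi> (2 + \<epsilon>\<^sub>0)"
  shows "\<forall>S \<in> {UNIV, {0..1}, {1..}, {-1..0}, {..-1}}. \<forall>\<epsilon>>0. \<exists>c>0. \<exists>C>0. \<forall>n\<ge>1.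
           prob_space.prob M {\<omega> \<in> space M.
             num_roots \<xi> n S \<omega> \<ge> prob_space.expectation M (num_roots \<xi> n S) + \<epsilon> * ln (real n)}
           \<le> C * exp (- c * sqrt (ln (real n)))"
proof -
  interpret prob_space M by (rule assms(1))
  have rv: "\<xi> i \<in> borel_measurable M" for i using assms(2) by (auto simp: indep_vars_def)
  have var: "expectation (\<lambda>\<omega>. (\<xi> i \<omega>)\<^sup>2) = 1" for i using assms(4)[of i] assms(3)[of i] by simp
  then have sq: "integrable M (\<lambda>\<omega>. (\<xi> i \<omega>)\<^sup>2)" for i
    using not_integrable_integral_eq by fastforce
  obtain s where s: "0 < s" "s \<le> 1"
    "\<And>i t. \<bar>t\<bar> \<le> s \<Longrightarrow> cmod (char (distr M borel (\<xi> i)) t) \<le> exp (- t\<^sup>2 / 4)"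
    using exists_char_radius[OF rv assms(3) sq var assms(5,6)] by blast
  interpret tame_coeffs M \<xi> s
    by unfold_locales (use assms(2,3) sq var s in auto)
  show ?thesis
    using log_upper_tail_all unfolding log_upper_tail_def by blast
qed

end
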